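(* Let $\mathcal{Q}=(Q_1,\dots,Q_{n+1})$ be a sequence where each $Q_i$ is a closed $K_i$-orbit in $\mathcal{B}_i$, and let $X_{\mathcal{Q}}=\{\mathfrak{b}\in\mathcal{B}_{n+1}:\ \pi_i(\mathfrak{b})\in Q_i \text{ for } 1\le i\le n+1\}$. Then $X_{\mathcal{Q}}$ consists of a single Borel subalgebra of $\mathfrak{g}=\mathfrak{gl}(n+1,\mathbb{C})$, and this Borel subalgebra contains the Cartan subalgebra of diagonal matrices. Moreover, every Borel subalgebra of $\mathfrak{g}$ containing the diagonal matrices equals the unique element of $X_{\mathcal{Q}}$ for some such sequence $\mathcal{Q}$ of closed $K_i$-orbits.
   Context: $n\ge1$. For $1\le i\le n+1$, $\mathfrak{g}_i\cong\mathfrak{gl}(i,\mathbb{C})$ is the subalgebra of $\mathfrak{g}$ of matrices supported in the upper left $i\times i$ corner, and $\pi_i:\mathfrak{g}\to\mathfrak{g}_i$ keeps the entries in the upper left $i\times i$ corner and sets the others to $0$. $\mathcal{B}_i$ is the flag variety (variety of Borel subalgebras) of $\mathfrak{g}_i$. $K_i=GL(i-1,\mathbb{C})\times GL(1,\mathbb{C})\subset GL(i,\mathbb{C})$ is the group of invertible block diagonal matrices with blocks of sizes $i-1$ and $1$ (the fixed group of conjugation by $\mathrm{diag}(1,\dots,1,-1)$), acting on $\mathcal{B}_i$ by conjugation with finitely many orbits; "closed" means Zariski closed in $\mathcal{B}_i$. The condition $\pi_i(\mathfrak{b})\in Q_i$ means that $\pi_i(\mathfrak{b})$ is a Borel subalgebra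 of $\mathfrak{g}_i$ belonging to $Q_i$. *)

theory Defs
  imports Complex_Main
begin

text \<open>Square complex matrices are modelled as functions nat => nat => complex.
  gl m is the set of matrices supported in the upper left m x m corner,
  i.e. gl(m,C) sitting inside gl(n+1,C) as the subalgebra g_m.\<close>

type_synonym cmat = "nat \<Rightarrow> nat \<Rightarrow> complex"

definition gl :: "nat \<Rightarrow> cmat set" where
  "gl m = {A. \<forall>a b. (m \<le> a \<or> m \<le> b) \<longrightarrow> A a b = 0}"

definition madd :: "cmat \<Rightarrow> cmat \<Rightarrow> cmat" where
  "madd A B = (\<lambda>a b. A a b + B a b)"

definition msmult :: "complex \<Rightarrow> cmat \<Rightarrow> cmat" where
  "msmult c A = (\<lambda>a b. c * A a b)"

definition mzero :: cmat where
  "mzero = (\<lambda>a b. 0)"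

definition mmul :: "nat \<Rightarrow> cmat \<Rightarrow> cmat \<Rightarrow> cmat" where
  "mmul m A B = (\<lambda>a b. \<Sum>k<m. A a k * B k b)"

definition idm :: "nat \<Rightarrow> cmat" where
  "idm m = (\<lambda>a b. if a = b \<and> a < m then 1 else 0)"

definition lie_br :: "nat \<Rightarrow> cmat \<Rightarrow> cmat \<Rightarrow> cmat" where
  "lie_br m A B = (\<lambda>a b. mmul m A B a b - mmul m B A a b)"

definition lin_subspace :: "cmat set \<Rightarrow> bool" where
  "lin_subspace V \<longleftrightarrow> mzero \<in> V \<and> (\<forall>x\<in>V. \<forall>y\<in>V. madd x y \<in> V)
     \<and> (\<forall>c. \<forall>x\<in>V. msmult c x \<in> V)"

definition lin_span :: "cmat set \<Rightarrow> cmat set" where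
  "lin_span S = \<Inter>{V. lin_subspace V \<and> S \<subseteq> V}"

definition lie_subalg :: "nat \<Rightarrow> cmat set \<Rightarrow> bool" where
  "lie_subalg m L \<longleftrightarrow> L \<subseteq> gl m \<and> lin_subspace L \<and> (\<forall>x\<in>L. \<forall>y\<in>L. lie_br m x y \<in> L)"

definition derived :: "nat \<Rightarrow> cmat set \<Rightarrow> cmat set" where
  "derived m L = lin_span {lie_br m x y | x y. x \<in> L \<and> y \<in> L}"

definition solvable :: "nat \<Rightarrow> cmat set \<Rightarrow> bool" where
  "solvable m L \<longleftrightarrow> (\<exists>k. (derived m ^^ k) L = {mzero})"

definition borel :: "nat \<Rightarrow> cmat set \<Rightarrow> bool" where
  "borel m b \<longleftrightarrow> lie_subalg m b \<and> solvable m b \<and>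
     (\<forall>b'. lie_subalg m b' \<and> solvable m b' \<and> b \<subseteq> b' \<longrightarrow> b' = b)"

definition flag :: "nat \<Rightarrow> cmat set set" where
  "flag m = {b. borel m b}"

definition proj :: "nat \<Rightarrow> cmat \<Rightarrow> cmat" where
  "proj i A = (\<lambda>a b. if a < i \<and> b < i then A a b else 0)"

text \<open>K_i = GL(i-1) x GL(1): invertible block diagonal i x i matrices.\<close>
definition blockdiag :: "nat \<Rightarrow> cmat \<Rightarrow> bool" where
  "blockdiag i A \<longleftrightarrow> A \<in> gl i \<and> (\<forall>a. a < i - 1 \<longrightarrow> A a (i - 1) = 0 \<and> A (i - 1) a = 0)"

definition Kgrp :: "nat \<Rightarrow> cmat set" where
  "Kgrp i = {k. blockdiag i k \<and> (\<exists>h \<in> gl i. mmul i k h = idm i \<and> mmul i h k = idm i)}"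

definition minv :: "nat \<Rightarrow> cmat \<Rightarrow> cmat" where
  "minv i k = (SOME h. h \<in> gl i \<and> mmul i k h = idm i \<and> mmul i h k = idm i)"

definition K_orbit :: "nat \<Rightarrow> cmat set \<Rightarrow> cmat set set" where
  "K_orbit i b = {(\<lambda>x. mmul i (mmul i k x) (minv i k)) ` b | k. k \<in> Kgrp i}"

definition is_K_orbit :: "nat \<Rightarrow> cmat set set \<Rightarrow> bool" where
  "is_K_orbit i Q \<longleftrightarrow> (\<exists>b \<in> flag i. Q = K_orbit i b)"

inductive poly_fn :: "(('v \<Rightarrow> complex) \<Rightarrow> complex) \<Rightarrow> bool" where
  pconst: "poly_fn (\<lambda>x. c)"
| pvar: "poly_fn (\<lambda>x. x v)"
| padd: "poly_fn p \<Longrightarrow> poly_fn q \<Longrightarrow> poly_fn (\<lambda>x. p x + q x)"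
| pmul: "poly_fn p \<Longrightarrow> poly_fn q \<Longrightarrow> poly_fn (\<lambda>x. p x * q x)"

definition aff :: "'v set \<Rightarrow> ('v \<Rightarrow> complex) set" where
  "aff I = {x. \<forall>v. v \<notin> I \<longrightarrow> x v = 0}"

definition zariski_closed_aff :: "'v set \<Rightarrow> ('v \<Rightarrow> complex) set \<Rightarrow> bool" where
  "zariski_closed_aff I Z \<longleftrightarrow>
     (\<exists>P. (\<forall>p\<in>P. poly_fn p) \<and> Z = {x \<in> aff I. \<forall>p\<in>P. p x = 0})"

definition tup :: "(nat \<times> nat \<times> nat \<Rightarrow> complex) \<Rightarrow> nat \<Rightarrow> cmat" where
  "tup X k = (\<lambda>a b. X (k, a, b))"

definition tup_coords :: "nat \<Rightarrow> nat \<Rightarrow> (nat \<times> nat \<times> nat) set" where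
  "tup_coords d i = {..<d} \<times> {..<i} \<times> {..<i}"

definition lin_indep_tup :: "nat \<Rightarrow> (nat \<Rightarrow> cmat) \<Rightarrow> bool" where
  "lin_indep_tup d xs \<longleftrightarrow>
     (\<forall>c. (\<lambda>a b. \<Sum>k<d. c k * xs k a b) = mzero \<longrightarrow> (\<forall>k<d. c k = 0))"

text \<open>Zariski topology on B_i, induced from the Grassmannian of subspaces of gl i
  (via its affine cones): S \<subseteq> B_i is closed iff for every d, the set of d-tuples
  in gl i that are linearly dependent or span a member of S is an algebraic
  subset of (gl i)^d.\<close>
definition zariski_closed_flag :: "nat \<Rightarrow> cmat set set \<Rightarrow> bool" where
  "zariski_closed_flag i S \<longleftrightarrow> S \<subseteq> flag i \<and>
     (\<forall>d. zariski_closed_aff (tup_coords d i)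
        {X \<in> aff (tup_coords d i). \<not> lin_indep_tup d (tup X) \<or>
             lin_span (tup X ` {..<d}) \<in> S})"

definition XQ :: "nat \<Rightarrow> (nat \<Rightarrow> cmat set set) \<Rightarrow> cmat set set" where
  "XQ n Q = {b \<in> flag (n + 1). \<forall>i \<in> {1..n+1}. proj i ` b \<in> Q i}"

definition diag_cartan :: "nat \<Rightarrow> cmat set" where
  "diag_cartan m = {A \<in> gl m. \<forall>a b. a \<noteq> b \<longrightarrow> A a b = 0}"

end

theory Submission
  imports "Jordan_Normal_Form.Determinant"
    "HOL-Computational_Algebra.Fundamental_Theorem_Algebra"
    "HOL-Library.Function_Algebras"
    Defs
begin

text \<open>Write \<open>e\<close> for the idempotent \<open>E\<^sub>i\<^sub>i\<close> at the last index \<open>i\<close> of \<open>gl(i)\<close>; it is fixed by \<open>K\<^sub>i\<close>. A closed \<open>K\<^sub>i\<close>-orbit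
  contains the limits of its points under \<open>diag(1, \<dots>, 1, t)\<close> as \<open>t \<rightarrow> 0\<close>. Such a limit is a Borel
  subalgebra normalised by \<open>e\<close>, hence contains \<open>e\<close>, and so does every member of the orbit. By Lie's
  theorem, applied to flags compatible with \<open>e\<close>, a Borel subalgebra containing \<open>e\<close> is \<open>K\<^sub>i\<close>-conjugate
  to the stabiliser of a coordinate flag that depends only on the position of the last basis
  vector. Therefore projection to \<open>gl(i - 1)\<close> maps each closed orbit bijectively onto the flag variety
  of \<open>gl(i - 1)\<close>, and an induction on \<open>i\<close> yields existence, uniqueness and the diagonal matrices.
  Conversely, the orbit of a Borel subalgebra containing \<open>e\<close> is cut out, among subspaces of the right
  dimension, by polynomial conditions: being a subalgebra, containing \<open>e\<close>, solvability of bounded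
  length, and \<open>e N\<^sup>r = 0\<close>, \<open>N\<^sup>s e = 0\<close> for the span \<open>N\<close> of all commutators.\<close>

subsection \<open>Matrices as a vector space\<close>

text \<open>Closedness is a condition on tuples of matrices, so a limit of subspaces has to be
  realised by a limit of bases, and the limiting tuple must stay independent, since dependent tuples
  satisfy the condition vacuously. This dictates a basis of \<open>b\<close> adapted to the weight
  filtration: after rescaling by powers of \<open>t\<close>, the leading components form a basis of
  the limit.

  Conversely, being maximal solvable is not visibly a polynomial condition. Fixing the dimension
  replaces maximality, and a fixed derived length replaces solvability. What remains is the position
  \<open>k\<close> of the last basis vector in the flag. Each commutator moves strictly along the
  flag, with \<open>M - k\<close> steps available on one side and \<open>k\<close> on the other;
  hence \<open>r = M + 1 - k\<close> and \<open>s = k + 1\<close> when \<open>i = M + 1\<close>, and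
  the two equations bound \<open>k\<close> from opposite sides.

  Lie's theorem is proved modulo an invariant subspace \<open>U\<close>, so that flags grow without
  quotient spaces, and an eigenvector of the idempotent modulo \<open>U\<close> lifts to a true one.
  That lift makes the conjugating matrix block diagonal.\<close>

interpretation cm: vector_space msmult
  by unfold_locales (auto simp: msmult_def fun_eq_iff algebra_simps)

interpretation cmp: vector_space_pair msmult msmult
  by unfold_locales

lemma mzero_eq: "mzero = 0"
  by (simp add: mzero_def fun_eq_iff)

lemma madd_eq: "madd A B = A + B"
  by (simp add: madd_def fun_eq_iff)

lemma lin_subspace_iff: "lin_subspace V \<longleftrightarrow> cm.subspace V"
  by (auto simp: lin_subspace_def cm.subspace_def mzero_eq madd_eq)

lemma lin_span_eq: "lin_span S = cm.span S"
proof -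
  have "cm.span S \<subseteq> V" if "lin_subspace V" "S \<subseteq> V" for V
    using that by (simp add: lin_subspace_iff cm.span_minimal)
  moreover have "lin_subspace (cm.span S)" "S \<subseteq> cm.span S"
    by (simp_all add: lin_subspace_iff cm.span_superset)
  ultimately show ?thesis unfolding lin_span_def by blast
qed

lemma lie_br_eq: "lie_br m A B = mmul m A B - mmul m B A"
  by (simp add: lie_br_def fun_eq_iff)

lemma mmul_add_left: "mmul m (A + B) C = mmul m A C + mmul m B C"
  by (simp add: mmul_def fun_eq_iff algebra_simps sum.distrib)

lemma mmul_add_right: "mmul m C (A + B) = mmul m C A + mmul m C B"
  by (simp add: mmul_def fun_eq_iff algebra_simps sum.distrib)

lemma mmul_diff_left: "mmul m (A - B) C = mmul m A C - mmul m B C"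
  by (simp add: mmul_def fun_eq_iff algebra_simps sum_subtractf)

lemma mmul_diff_right: "mmul m C (A - B) = mmul m C A - mmul m C B"
  by (simp add: mmul_def fun_eq_iff algebra_simps sum_subtractf)

lemma mmul_scale_left: "mmul m (msmult c A) B = msmult c (mmul m A B)"
  by (simp add: mmul_def msmult_def fun_eq_iff algebra_simps sum_distrib_left)

lemma mmul_scale_right: "mmul m A (msmult c B) = msmult c (mmul m A B)"
  by (simp add: mmul_def msmult_def fun_eq_iff algebra_simps sum_distrib_left)

lemma mmul_zero_left [simp]: "mmul m 0 B = 0"
  by (simp add: mmul_def fun_eq_iff)

lemma mmul_zero_right [simp]: "mmul m B 0 = 0"
  by (simp add: mmul_def fun_eq_iff)

lemma mmul_assoc: "mmul m (mmul m A B) C = mmul m A (mmul m B C)"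
proof -
  have "(\<Sum>k<m. (\<Sum>l<m. A a l * B l k) * C k b) = (\<Sum>l<m. A a l * (\<Sum>k<m. B l k * C k b))" for a b
    by (simp add: sum_distrib_left sum_distrib_right mult.assoc) (rule sum.swap)
  then show ?thesis by (simp add: mmul_def)
qed

lemmas mmul_simps = mmul_add_left mmul_add_right mmul_diff_left mmul_diff_right
  mmul_scale_left mmul_scale_right

lemma subspace_gl: "cm.subspace (gl m)"
  by (auto simp: cm.subspace_def gl_def msmult_def)

lemma mmul_gl: "A \<in> gl m \<Longrightarrow> B \<in> gl m \<Longrightarrow> mmul m A B \<in> gl m"
  by (auto simp: gl_def mmul_def)

lemma lie_br_gl: "A \<in> gl m \<Longrightarrow> B \<in> gl m \<Longrightarrow> lie_br m A B \<in> gl m"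
  by (simp add: lie_br_eq mmul_gl cm.subspace_diff[OF subspace_gl])

lemma idm_gl: "idm m \<in> gl m"
  by (auto simp: gl_def idm_def)

lemma idm_left: "A \<in> gl m \<Longrightarrow> mmul m (idm m) A = A"
proof -
  assume A: "A \<in> gl m"
  have "(\<Sum>k<m. idm m a k * A k b) = A a b" for a b
  proof -
    have "(\<Sum>k<m. idm m a k * A k b) = (\<Sum>k<m. if a = k then A a b else 0)"
      by (rule sum.cong) (auto simp: idm_def)
    also have "\<dots> = A a b" using A by (auto simp: gl_def)
    finally show ?thesis .
  qed
  then show ?thesis by (simp add: mmul_def)
qed

lemma idm_right: "A \<in> gl m \<Longrightarrow> mmul m A (idm m) = A"
proof -
  assume A: "A \<in> gl m"
  have "(\<Sum>k<m. A a k * idm m k b) = A a b" for a b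
  proof -
    have "(\<Sum>k<m. A a k * idm m k b) = (\<Sum>k<m. if k = b then A a b else 0)"
      by (rule sum.cong) (auto simp: idm_def)
    also have "\<dots> = A a b" using A by (auto simp: gl_def)
    finally show ?thesis .
  qed
  then show ?thesis by (simp add: mmul_def)
qed

section \<open>Matrix units and dimension in \<open>gl m\<close>\<close>

definition eu :: "nat \<Rightarrow> nat \<Rightarrow> cmat" where
  "eu a b = (\<lambda>i j. if i = a \<and> j = b then 1 else 0)"

lemma eu_gl: "a < m \<Longrightarrow> b < m \<Longrightarrow> eu a b \<in> gl m"
  by (auto simp: gl_def eu_def)

lemma eu_mmul: "a < m \<Longrightarrow> b < m \<Longrightarrow> mmul m (eu a b) A = (\<lambda>i j. if i = a then A b j else 0)"
proof -
  assume "a < m" "b < m"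
  have "(\<Sum>k<m. eu a b i k * A k j) = (\<Sum>k<m. if k = b then (if i = a then A b j else 0) else 0)" for i j
    by (rule sum.cong) (auto simp: eu_def)
  with \<open>b < m\<close> show ?thesis by (simp add: mmul_def)
qed

lemma mmul_eu: "a < m \<Longrightarrow> b < m \<Longrightarrow> mmul m A (eu a b) = (\<lambda>i j. if j = b then A i a else 0)"
proof -
  assume "a < m" "b < m"
  have "(\<Sum>k<m. A i k * eu a b k j) = (\<Sum>k<m. if k = a then (if j = b then A i a else 0) else 0)" for i j
    by (rule sum.cong) (auto simp: eu_def)
  with \<open>a < m\<close> show ?thesis by (simp add: mmul_def)
qed

lemma sum_apply:
  fixes f :: "'a \<Rightarrow> 'b \<Rightarrow> 'c::comm_monoid_add"
  shows "(\<Sum>k\<in>S. f k) i = (\<Sum>k\<in>S. f k i)"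
  by (induction S rule: infinite_finite_induct) auto

lemma gl_eq_sum_eu:
  assumes "A \<in> gl m"
  shows "A = (\<Sum>a<m. \<Sum>b<m. msmult (A a b) (eu a b))"
proof -
  have "A i j = (\<Sum>a<m. \<Sum>b<m. msmult (A a b) (eu a b)) i j" for i j
  proof -
    have "(\<Sum>a<m. \<Sum>b<m. msmult (A a b) (eu a b)) i j
        = (\<Sum>a<m. \<Sum>b<m. if b = j then (if a = i then A i j else 0) else 0)"
      unfolding sum_apply by (intro sum.cong) (auto simp: msmult_def eu_def)
    also have "\<dots> = A i j" using assms by (cases "j < m") (auto simp: gl_def)
    finally show ?thesis by simp
  qed
  then show ?thesis by blast
qed

definition eus :: "nat \<Rightarrow> cmat set" where
  "eus m = (\<lambda>(a, b). eu a b) ` ({..<m} \<times> {..<m})"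

lemma finite_eus: "finite (eus m)"
  by (simp add: eus_def)

lemma gl_span_eus: "gl m \<subseteq> cm.span (eus m)"
proof
  fix A assume "A \<in> gl m"
  show "A \<in> cm.span (eus m)"
    by (subst gl_eq_sum_eu[OF \<open>A \<in> gl m\<close>])
      (intro cm.span_sum cm.span_scale cm.span_base, auto simp: eus_def)
qed

text \<open>All matrices live in one infinite-dimensional function space; finiteness of independent
  sets, and with it a meaningful \<open>cm.dim\<close>, comes from the finite spanning set of matrix
  units.\<close>

lemma finite_indep_gl:
  assumes "B \<subseteq> gl m" "cm.independent B" shows "finite B"
  using cm.independent_span_bound[OF finite_eus assms(2)] gl_span_eus assms(1) by blast

lemma span_gl: "S \<subseteq> gl m \<Longrightarrow> cm.span S \<subseteq> gl m"
  by (rule cm.span_minimal[OF _ subspace_gl])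

text \<open>A basis of \<open>V\<close> together with a vector of \<open>W\<close> outside
  \<open>V\<close> would be larger than a basis of \<open>W\<close>. The bound by
  \<open>gl m\<close> keeps both cardinalities finite.\<close>

lemma subspace_eq_of_dim:
  assumes "cm.subspace V" "cm.subspace W" "V \<subseteq> W" "W \<subseteq> gl m" "cm.dim V = cm.dim W"
  shows "V = W"
proof -
  obtain B where B: "B \<subseteq> V" "cm.independent B" "V \<subseteq> cm.span B" "card B = cm.dim V"
    using cm.basis_exists by blast
  have "w \<in> cm.span B" if w: "w \<in> W" for w
  proof (rule ccontr)
    assume n: "w \<notin> cm.span B"
    have i: "cm.independent (insert w B)" using n B by (simp add: cm.independent_insertI)
    obtain C where C: "C \<subseteq> W" "cm.independent C" "W \<subseteq> cm.span C" "card C = cm.dim W"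
      using cm.basis_exists by blast
    have "finite C" using C assms finite_indep_gl by blast
    then have "card (insert w B) \<le> card C"
      using cm.independent_span_bound[OF \<open>finite C\<close> i] w B C assms by blast
    moreover have "finite B" using B assms finite_indep_gl by blast
    moreover have "w \<notin> B" using n cm.span_base by blast
    ultimately show False using C B assms by simp
  qed
  then show ?thesis using B assms cm.span_minimal[of B V] by blast
qed

subsection \<open>Solvable subalgebras\<close>

lemma lie_subalg_iff:
  "lie_subalg m L \<longleftrightarrow> L \<subseteq> gl m \<and> cm.subspace L \<and> (\<forall>x\<in>L. \<forall>y\<in>L. lie_br m x y \<in> L)"
  by (simp add: lie_subalg_def lin_subspace_iff)

lemma derived_eq: "derived m L = cm.span {lie_br m x y | x y. x \<in> L \<and> y \<in> L}"
  by (simp add: derived_def lin_span_eq)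

lemma derived_mono: "L \<subseteq> L' \<Longrightarrow> derived m L \<subseteq> derived m L'"
  unfolding derived_eq by (rule cm.span_mono) blast

lemma derived_subset:
  assumes "cm.subspace M" "\<And>x y. x \<in> L \<Longrightarrow> y \<in> L \<Longrightarrow> lie_br m x y \<in> M"
  shows "derived m L \<subseteq> M"
  unfolding derived_eq using assms by (intro cm.span_minimal) auto

lemma lie_br_derived: "x \<in> L \<Longrightarrow> y \<in> L \<Longrightarrow> lie_br m x y \<in> derived m L"
  unfolding derived_eq by (rule cm.span_base) blast

lemma subspace_derived: "cm.subspace (derived m L)"
  unfolding derived_eq by simp

lemma derived_pow_mono: "L \<subseteq> L' \<Longrightarrow> (derived m ^^ k) L \<subseteq> (derived m ^^ k) L'"
  by (induction k) (auto intro!: derived_mono)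

lemma subspace_derived_pow: "cm.subspace L \<Longrightarrow> cm.subspace ((derived m ^^ k) L)"
  by (cases k) (auto simp: subspace_derived)

lemma solvableI:
  assumes "cm.subspace L" "(derived m ^^ k) L \<subseteq> {0}"
  shows "solvable m L"
  using assms cm.subspace_0[OF subspace_derived_pow[OF assms(1)]]
  unfolding solvable_def mzero_eq by blast

lemma solvable_iff: "solvable m L \<longleftrightarrow> (\<exists>k. (derived m ^^ k) L = {0})"
  by (simp add: solvable_def mzero_eq)

text \<open>The derived series of \<open>L\<close>, shifted by one step, lies inside that of
  \<open>L'\<close>. A solvability proof may therefore stop after one commutator.\<close>

lemma solvable_derived_subset:
  assumes "cm.subspace L" "derived m L \<subseteq> L'" "solvable m L'"
  shows "solvable m L"
proof -
  obtain k where "(derived m ^^ k) L' = {0}" using assms by (auto simp: solvable_iff)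
  then have "(derived m ^^ Suc k) L \<subseteq> {0}"
    using derived_pow_mono[OF assms(2), of k m] by (simp add: funpow_swap1)
  then show ?thesis by (rule solvableI[OF assms(1)])
qed

lemma borelD:
  assumes "borel m b"
  shows "lie_subalg m b" "solvable m b" "b \<subseteq> gl m" "cm.subspace b"
    "\<And>x y. x \<in> b \<Longrightarrow> y \<in> b \<Longrightarrow> lie_br m x y \<in> b"
    "\<And>b'. lie_subalg m b' \<Longrightarrow> solvable m b' \<Longrightarrow> b \<subseteq> b' \<Longrightarrow> b' = b"
  using assms by (auto simp: borel_def lie_subalg_iff)

text \<open>Adjoining \<open>e\<close> to \<open>b\<close> produces no commutators outside
  \<open>b\<close>, because \<open>[e, e] = 0\<close> and \<open>[e, b]\<close> stays in
  \<open>b\<close>. The larger algebra is therefore solvable, and maximality absorbs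
  \<open>e\<close>.\<close>

lemma borel_contains_normalizer:
  assumes b: "borel m b" and e: "e \<in> gl m" "\<And>x. x \<in> b \<Longrightarrow> lie_br m e x \<in> b"
  shows "e \<in> b"
proof -
  let ?L = "cm.span (insert e b)"
  have sb: "cm.span b = b" using borelD(4)[OF b] by simp
  have br: "lie_br m x y \<in> b" if x: "x \<in> ?L" and y: "y \<in> ?L" for x y
  proof -
    obtain k where k: "x - msmult k e \<in> b" using x by (auto simp: cm.span_insert sb)
    obtain l where l: "y - msmult l e \<in> b" using y by (auto simp: cm.span_insert sb)
    define u where "u = x - msmult k e"
    define v where "v = y - msmult l e"
    have xy: "x = u + msmult k e" "y = v + msmult l e" by (auto simp: u_def v_def)
    have "lie_br m x y = lie_br m u v + (msmult k (lie_br m e v) - msmult l (lie_br m e u))"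
      unfolding xy lie_br_eq mmul_simps by (simp add: cm.scale_right_diff_distrib algebra_simps)
    also have "\<dots> \<in> b"
      using k l e(2) borelD(5)[OF b] unfolding u_def[symmetric] v_def[symmetric]
      by (intro cm.subspace_add cm.subspace_diff cm.subspace_scale borelD(4)[OF b]) auto
    finally show ?thesis .
  qed
  have sub: "b \<subseteq> ?L" using cm.span_superset by blast
  have "?L \<subseteq> gl m" using borelD(3)[OF b] e(1) by (intro span_gl) blast
  then have "lie_subalg m ?L"
    unfolding lie_subalg_iff using br sub by blast
  moreover have "solvable m ?L"
    using solvable_derived_subset[OF _ derived_subset borelD(2)[OF b]] br borelD(4)[OF b] by blast
  ultimately have "?L = b" using borelD(6)[OF b] sub by blast
  then show ?thesis using cm.span_base[of e "insert e b"] by simp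
qed

subsection \<open>Conjugation\<close>

text \<open>Carrying the inverse as an explicit partner avoids the choice operator in
  \<open>minv\<close>; \<open>minv_eq\<close> identifies the two later.\<close>

definition inv_pair :: "nat \<Rightarrow> cmat \<Rightarrow> cmat \<Rightarrow> bool" where
  "inv_pair m g h \<longleftrightarrow> g \<in> gl m \<and> h \<in> gl m \<and> mmul m g h = idm m \<and> mmul m h g = idm m"

definition cj :: "nat \<Rightarrow> cmat \<Rightarrow> cmat \<Rightarrow> cmat \<Rightarrow> cmat" where
  "cj m g h x = mmul m (mmul m g x) h"

lemma inv_pair_sym: "inv_pair m g h \<Longrightarrow> inv_pair m h g"
  by (auto simp: inv_pair_def)

lemma inv_pair_unique: "inv_pair m g h \<Longrightarrow> inv_pair m g h' \<Longrightarrow> h = h'"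
  unfolding inv_pair_def by (metis idm_left idm_right mmul_assoc)

lemma inv_pair_idm: "inv_pair m (idm m) (idm m)"
  by (simp add: inv_pair_def idm_gl idm_left)

lemma inv_pair_mmul:
  assumes "inv_pair m g h" "inv_pair m g' h'"
  shows "inv_pair m (mmul m g g') (mmul m h' h)"
  using assms unfolding inv_pair_def
  by (smt (verit, best) idm_left mmul_assoc mmul_gl)

lemma cj_add: "cj m g h (x + y) = cj m g h x + cj m g h y"
  by (simp add: cj_def mmul_simps)

lemma cj_scale: "cj m g h (msmult c x) = msmult c (cj m g h x)"
  by (simp add: cj_def mmul_simps)

lemma linear_cj: "Vector_Spaces.linear msmult msmult (cj m g h)"
  by (simp add: Vector_Spaces.linear_iff cm.vector_space_axioms cj_add cj_scale)

lemma cj_diff: "cj m g h (x - y) = cj m g h x - cj m g h y"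
  by (simp add: cj_def mmul_simps)

lemma cj_gl: "inv_pair m g h \<Longrightarrow> x \<in> gl m \<Longrightarrow> cj m g h x \<in> gl m"
  by (simp add: cj_def inv_pair_def mmul_gl)

lemma cj_mmul:
  assumes "inv_pair m g h" "x \<in> gl m" "y \<in> gl m"
  shows "cj m g h (mmul m x y) = mmul m (cj m g h x) (cj m g h y)"
proof -
  have "mmul m (cj m g h x) (cj m g h y) = mmul m g (mmul m x (mmul m (mmul m h g) (mmul m y h)))"
    by (simp add: cj_def mmul_assoc)
  also have "mmul m (mmul m h g) (mmul m y h) = mmul m y h"
    using assms by (simp add: inv_pair_def idm_left mmul_gl)
  finally show ?thesis by (simp add: cj_def mmul_assoc)
qed

lemma cj_lie_br:
  assumes "inv_pair m g h" "x \<in> gl m" "y \<in> gl m"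
  shows "cj m g h (lie_br m x y) = lie_br m (cj m g h x) (cj m g h y)"
  using assms by (simp add: lie_br_eq cj_diff cj_mmul)

lemma cj_cj: "cj m g h (cj m g' h' x) = cj m (mmul m g g') (mmul m h' h) x"
  by (simp add: cj_def mmul_assoc)

lemma cj_idm: "x \<in> gl m \<Longrightarrow> cj m (idm m) (idm m) x = x"
  by (simp add: cj_def idm_left idm_right)

lemma cj_inverse: "inv_pair m g h \<Longrightarrow> x \<in> gl m \<Longrightarrow> cj m h g (cj m g h x) = x"
  by (simp add: cj_cj cj_idm inv_pair_def)

lemma cj_image_inverse: "inv_pair m g h \<Longrightarrow> L \<subseteq> gl m \<Longrightarrow> cj m h g ` cj m g h ` L = L"
  by (force simp: cj_inverse image_iff)

lemma inj_on_cj: "inv_pair m g h \<Longrightarrow> inj_on (cj m g h) (gl m)"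
  by (metis cj_inverse inj_onI)

lemma cj_image_gl: "inv_pair m g h \<Longrightarrow> L \<subseteq> gl m \<Longrightarrow> cj m g h ` L \<subseteq> gl m"
  using cj_gl by blast

lemma subspace_cj: "cm.subspace L \<Longrightarrow> cm.subspace (cj m g h ` L)"
  by (rule cmp.linear_subspace_image[OF linear_cj])

lemma lie_subalg_cj:
  assumes "inv_pair m g h" "lie_subalg m L"
  shows "lie_subalg m (cj m g h ` L)"
  unfolding lie_subalg_iff
proof (intro conjI ballI)
  show "cj m g h ` L \<subseteq> gl m" "cm.subspace (cj m g h ` L)"
    using assms by (simp_all add: lie_subalg_iff cj_image_gl subspace_cj)
  fix u v assume "u \<in> cj m g h ` L" "v \<in> cj m g h ` L"
  then obtain x y where xy: "x \<in> L" "y \<in> L" "u = cj m g h x" "v = cj m g h y" by blast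
  then have "lie_br m u v = cj m g h (lie_br m x y)"
    using assms by (subst cj_lie_br) (auto simp: lie_subalg_iff)
  then show "lie_br m u v \<in> cj m g h ` L" using assms xy by (auto simp: lie_subalg_iff)
qed

lemma derived_gl: "L \<subseteq> gl m \<Longrightarrow> derived m L \<subseteq> gl m"
  by (intro derived_subset subspace_gl lie_br_gl) auto

lemma derived_cj:
  assumes "inv_pair m g h" "L \<subseteq> gl m"
  shows "derived m (cj m g h ` L) = cj m g h ` derived m L"
proof -
  have "{lie_br m u v | u v. u \<in> cj m g h ` L \<and> v \<in> cj m g h ` L}
      = cj m g h ` {lie_br m x y | x y. x \<in> L \<and> y \<in> L}" (is "?A = ?B")
  proof -
    have "?A = {lie_br m (cj m g h x) (cj m g h y) | x y. x \<in> L \<and> y \<in> L}" by blast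
    also have "\<dots> = {cj m g h (lie_br m x y) | x y. x \<in> L \<and> y \<in> L}"
      using assms by (metis (no_types, lifting) cj_lie_br subsetD)
    finally show ?thesis by blast
  qed
  then show ?thesis
    unfolding derived_eq by (simp add: cmp.linear_span_image[OF linear_cj])
qed

lemma derived_pow_gl: "L \<subseteq> gl m \<Longrightarrow> (derived m ^^ k) L \<subseteq> gl m"
  by (induction k) (auto intro!: derived_gl)

lemma derived_pow_cj:
  assumes "inv_pair m g h" "L \<subseteq> gl m"
  shows "(derived m ^^ k) (cj m g h ` L) = cj m g h ` (derived m ^^ k) L"
  using assms by (induction k) (simp_all add: derived_cj derived_pow_gl)

lemma cj_zero: "cj m g h 0 = 0"
  by (simp add: cj_def)

lemma solvable_cj:
  assumes "inv_pair m g h" "L \<subseteq> gl m" "solvable m L"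
  shows "solvable m (cj m g h ` L)"
proof -
  obtain k where "(derived m ^^ k) L = {0}" using assms(3) by (auto simp: solvable_iff)
  then have "(derived m ^^ k) (cj m g h ` L) = {0}" using assms by (simp add: derived_pow_cj cj_zero)
  then show ?thesis unfolding solvable_iff by blast
qed

lemma borel_cj:
  assumes g: "inv_pair m g h" and b: "borel m b"
  shows "borel m (cj m g h ` b)"
  unfolding borel_def
proof (intro conjI allI impI)
  show "lie_subalg m (cj m g h ` b)" using lie_subalg_cj g borelD(1)[OF b] .
  show "solvable m (cj m g h ` b)" using solvable_cj g borelD(3,2)[OF b] .
  fix b' assume b': "lie_subalg m b' \<and> solvable m b' \<and> cj m g h ` b \<subseteq> b'"
  then have gl: "b' \<subseteq> gl m" by (simp add: lie_subalg_iff)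
  have "cj m h g ` b' = b"
  proof (rule borelD(6)[OF b])
    show "lie_subalg m (cj m h g ` b')" using lie_subalg_cj[OF inv_pair_sym[OF g]] b' by blast
    show "solvable m (cj m h g ` b')" using solvable_cj[OF inv_pair_sym[OF g] gl] b' by blast
    have "cj m h g ` cj m g h ` b \<subseteq> cj m h g ` b'" using b' by blast
    then show "b \<subseteq> cj m h g ` b'" using cj_image_inverse[OF g borelD(3)[OF b]] by simp
  qed
  then show "b' = cj m g h ` b" using cj_image_inverse[OF inv_pair_sym[OF g] gl] by blast
qed

lemma dim_cj:
  assumes g: "inv_pair m g h" and L: "L \<subseteq> gl m" "cm.subspace L"
  shows "cm.dim (cj m g h ` L) = cm.dim L"
proof -
  obtain B where B: "B \<subseteq> L" "cm.independent B" "L \<subseteq> cm.span B" "card B = cm.dim L"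
    using cm.basis_exists by blast
  have sp: "cm.span B = L" using B L by (simp add: cm.span_subspace)
  have inj: "inj_on (cj m g h) (cm.span B)" using inj_on_cj[OF g] L sp by (metis inj_on_subset)
  have ind: "cm.independent (cj m g h ` B)"
    by (rule cmp.linear_independent_injective_image[OF linear_cj B(2) inj])
  have "cm.span (cj m g h ` B) = cj m g h ` L"
    by (simp add: cmp.linear_span_image[OF linear_cj] sp)
  then have "cm.dim (cj m g h ` L) = card (cj m g h ` B)"
    using cm.dim_span_eq_card_independent[OF ind] by simp
  also have "\<dots> = card B" using inj B sp by (metis card_image inj_on_subset)
  finally show ?thesis using B by simp
qed

subsection \<open>Column vectors and Krylov spaces\<close>

definition vscale :: "complex \<Rightarrow> (nat \<Rightarrow> complex) \<Rightarrow> nat \<Rightarrow> complex" where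
  "vscale c v = (\<lambda>a. c * v a)"

lemma vscale_apply: "vscale c v a = c * v a"
  by (simp add: vscale_def)

interpretation vs: vector_space vscale
  by unfold_locales (auto simp: vscale_def fun_eq_iff algebra_simps)

definition cvec :: "nat \<Rightarrow> (nat \<Rightarrow> complex) set" where
  "cvec m = {v. \<forall>a\<ge>m. v a = 0}"

definition mv :: "nat \<Rightarrow> cmat \<Rightarrow> (nat \<Rightarrow> complex) \<Rightarrow> nat \<Rightarrow> complex" where
  "mv m A v = (\<lambda>a. \<Sum>k<m. A a k * v k)"

definition ev :: "nat \<Rightarrow> nat \<Rightarrow> complex" where
  "ev a = (\<lambda>i. if i = a then 1 else 0)"

lemma mv_add_left: "mv m (A + B) v = mv m A v + mv m B v"
  by (simp add: mv_def fun_eq_iff algebra_simps sum.distrib)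

lemma mv_diff_left: "mv m (A - B) v = mv m A v - mv m B v"
  by (simp add: mv_def fun_eq_iff algebra_simps sum_subtractf)

lemma mv_add: "mv m A (v + w) = mv m A v + mv m A w"
  by (simp add: mv_def fun_eq_iff algebra_simps sum.distrib)

lemma mv_diff: "mv m A (v - w) = mv m A v - mv m A w"
  by (simp add: mv_def fun_eq_iff algebra_simps sum_subtractf)

lemma mv_scale_left: "mv m (msmult c A) v = vscale c (mv m A v)"
  by (simp add: mv_def vscale_def msmult_def fun_eq_iff algebra_simps sum_distrib_left)

lemma mv_scale: "mv m A (vscale c v) = vscale c (mv m A v)"
  by (simp add: mv_def vscale_def fun_eq_iff algebra_simps sum_distrib_left)

lemmas mv_simps = mv_add_left mv_diff_left mv_add mv_diff mv_scale_left mv_scale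

lemma mv_zero_left [simp]: "mv m 0 v = 0"
  by (simp add: mv_def fun_eq_iff)

lemma mv_zero [simp]: "mv m A 0 = 0"
  by (simp add: mv_def fun_eq_iff)

lemmas fun_apply = plus_fun_apply zero_fun_apply minus_apply uminus_apply

declare fun_apply [simp del]
  \<comment> \<open>on eta-expanded goals these rules would unfold the operations on functions pointwise\<close>

lemma mv_sum: "mv m A (\<Sum>i\<in>S. f i) = (\<Sum>i\<in>S. mv m A (f i))"
  by (induction S rule: infinite_finite_induct) (auto simp: mv_add)

lemma mv_mmul: "mv m (mmul m A B) v = mv m A (mv m B v)"
proof -
  have "(\<Sum>k<m. (\<Sum>l<m. A a l * B l k) * v k) = (\<Sum>l<m. A a l * (\<Sum>k<m. B l k * v k))" for a
    by (simp add: sum_distrib_left sum_distrib_right mult.assoc) (rule sum.swap)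
  then show ?thesis by (simp add: mmul_def mv_def)
qed

lemma mv_lie_br: "mv m (lie_br m A B) v = mv m A (mv m B v) - mv m B (mv m A v)"
  by (simp add: lie_br_eq mv_diff_left mv_mmul)

lemma mv_cvec: "A \<in> gl m \<Longrightarrow> mv m A v \<in> cvec m"
  by (auto simp: mv_def cvec_def gl_def)

lemma mv_idm: "v \<in> cvec m \<Longrightarrow> mv m (idm m) v = v"
proof -
  assume v: "v \<in> cvec m"
  have "(\<Sum>k<m. idm m a k * v k) = (\<Sum>k<m. if k = a then v a else 0)" for a
    by (rule sum.cong) (auto simp: idm_def)
  then show ?thesis using v by (auto simp: mv_def cvec_def fun_eq_iff)
qed

lemma mv_ev: "b < m \<Longrightarrow> mv m A (ev b) = (\<lambda>a. A a b)"
proof -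
  assume b: "b < m"
  have "(\<Sum>k<m. A a k * ev b k) = (\<Sum>k<m. if k = b then A a b else 0)" for a
    by (rule sum.cong) (auto simp: ev_def)
  then show ?thesis using b by (simp add: mv_def)
qed

lemma subspace_cvec: "vs.subspace (cvec m)"
  by (auto simp: vs.subspace_def cvec_def vscale_def fun_apply)

lemma ev_cvec: "a < m \<Longrightarrow> ev a \<in> cvec m"
  by (auto simp: ev_def cvec_def)

lemma cvec_eq_sum_ev:
  assumes "v \<in> cvec m"
  shows "v = (\<Sum>a<m. vscale (v a) (ev a))"
proof -
  have "(\<Sum>a<m. vscale (v a) (ev a) i) = (\<Sum>a<m. if a = i then v i else 0)" for i
    by (rule sum.cong) (auto simp: vscale_def ev_def)
  then show ?thesis using assms by (auto simp: fun_eq_iff sum_apply cvec_def fun_apply)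
qed

lemma cvec_span_ev: "cvec m \<subseteq> vs.span (ev ` {..<m})"
proof
  fix v assume "v \<in> cvec m"
  show "v \<in> vs.span (ev ` {..<m})"
    by (subst cvec_eq_sum_ev[OF \<open>v \<in> cvec m\<close>])
      (intro vs.span_sum vs.span_scale vs.span_base, auto)
qed

lemma card_indep_cvec:
  assumes "B \<subseteq> cvec m" "vs.independent B"
  shows "finite B" "card B \<le> m"
proof -
  have *: "finite B \<and> card B \<le> card (ev ` {..<m})"
    using vs.independent_span_bound[OF _ assms(2), of "ev ` {..<m}"] cvec_span_ev assms(1) by blast
  then show "finite B" by simp
  show "card B \<le> m" using * card_image_le[of "{..<m}" ev] by simp
qed

lemma inj_ev: "inj ev"
proof (rule injI)
  fix x y assume "ev x = ev y"
  then have "ev x x = ev y x" by simp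
  then show "x = y" by (auto simp: ev_def split: if_splits)
qed

text \<open>Each vector escapes the span of its predecessors. The set \<open>U\<close> serves Krylov
  sequences modulo a subspace; for flags it is empty.\<close>

lemma indep_chain:
  fixes v :: "nat \<Rightarrow> nat \<Rightarrow> complex"
  assumes "\<And>i. i < p \<Longrightarrow> v i \<notin> vs.span (U \<union> v ` {..<i})"
  shows "vs.independent (v ` {..<p}) \<and> inj_on v {..<p}"
  using assms
proof (induction p)
  case 0
  show ?case by (simp add: vs.independent_empty)
next
  case (Suc p)
  have n: "v p \<notin> vs.span (v ` {..<p})"
    using Suc.prems[of p] vs.span_mono[of "v ` {..<p}" "U \<union> v ` {..<p}"] by blast
  have n': "v p \<notin> v ` {..<p}" using n vs.span_base[of "v p" "v ` {..<p}"] by metis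
  have ih: "vs.independent (v ` {..<p})" "inj_on v {..<p}"
    using Suc.IH Suc.prems less_SucI by blast+
  have 1: "vs.independent (insert (v p) (v ` {..<p}))"
    by (rule vs.independent_insertI[OF n ih(1)])
  have 2: "inj_on v (insert p {..<p})"
    using ih(2) n' by (simp only: inj_on_insert) blast
  show ?case using 1 2 unfolding lessThan_Suc image_insert by blast
qed

text \<open>Otherwise \<open>m + 1\<close> vectors of \<open>cvec m\<close> would be
  independent.\<close>

lemma krylov_stop:
  fixes v :: "nat \<Rightarrow> nat \<Rightarrow> complex"
  assumes "\<And>i. v i \<in> cvec m"
  shows "\<exists>p. v p \<in> vs.span (U \<union> v ` {..<p})"
proof (rule ccontr)
  assume "\<nexists>p. v p \<in> vs.span (U \<union> v ` {..<p})"
  then have "vs.independent (v ` {..<Suc m}) \<and> inj_on v {..<Suc m}"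
    by (intro indep_chain) auto
  moreover have "v ` {..<Suc m} \<subseteq> cvec m" using assms by blast
  ultimately have "card (v ` {..<Suc m}) \<le> m" "card (v ` {..<Suc m}) = Suc m"
    using card_indep_cvec by (blast, simp add: card_image)
  then show False by simp
qed

lemma mv_pow_cvec: "A \<in> gl m \<Longrightarrow> w \<in> cvec m \<Longrightarrow> (mv m A ^^ j) w \<in> cvec m"
  by (cases j) (auto simp: mv_cvec)

lemma span_Un_sequence:
  fixes v :: "nat \<Rightarrow> nat \<Rightarrow> complex"
  assumes "vs.subspace U" "x \<in> vs.span (U \<union> v ` {..<p})"
  shows "\<exists>c. x - (\<Sum>j<p. vscale (c j) (v j)) \<in> U"
  using assms(2)
proof (induction p arbitrary: x)
  case 0
  have "x \<in> U \<Longrightarrow> \<exists>c. x - (\<Sum>j<0. vscale (c j) (v j)) \<in> U" for x by simp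
  moreover have "vs.span (U \<union> v ` {..<0}) = U" using assms(1) by simp
  ultimately show ?case using 0 by metis
next
  case (Suc p)
  have "x \<in> vs.span (insert (v p) (U \<union> v ` {..<p}))"
    using Suc.prems by (simp add: lessThan_Suc)
  then obtain k where "x - vscale k (v p) \<in> vs.span (U \<union> v ` {..<p})"
    by (auto simp: vs.span_insert)
  from Suc.IH[OF this] obtain c
    where c: "x - vscale k (v p) - (\<Sum>j<p. vscale (c j) (v j)) \<in> U" by blast
  have "(\<Sum>j<Suc p. vscale ((c(p := k)) j) (v j)) = (\<Sum>j<p. vscale (c j) (v j)) + vscale k (v p)"
    by simp
  then show ?case using c by (intro exI[of _ "c(p := k)"]) (simp only:, simp add: algebra_simps)
qed

subsection \<open>Lie's theorem\<close>

text \<open>Take a nonzero polynomial \<open>P\<close> of least degree with \<open>P(A) w\<close> in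
  \<open>U\<close> and split off a root, \<open>P = (x - \<mu>) R\<close>. Then
  \<open>R(A) w\<close> is outside \<open>U\<close> by minimality, while \<open>A - \<mu>\<close>
  sends it into \<open>U\<close>.\<close>

lemma relative_eigenvector:
  assumes U: "vs.subspace U" and A: "A \<in> gl m"
    and W: "vs.subspace W" "W \<subseteq> cvec m" "\<And>v. v \<in> W \<Longrightarrow> mv m A v \<in> W"
    and w: "w \<in> W" "w \<notin> U"
  shows "\<exists>v\<in>W. v \<notin> U \<and> (\<exists>\<mu>. mv m A v - vscale \<mu> v \<in> U)"
proof -
  let ?f = "mv m A"
  define v where "v j = (?f ^^ j) w" for j
  have vW: "v j \<in> W" for j
    unfolding v_def by (induction j) (auto simp: w W(3))
  have vS: "v (Suc j) = ?f (v j)" for j by (simp add: v_def)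
  \<comment> \<open>This is \<open>P(A) w\<close> truncated to the coefficients below
    \<open>n\<close>, hence the full value once \<open>n\<close> exceeds the degree.\<close>
  define act where "act n P = (\<Sum>j<n. vscale (coeff P j) (v j))" for n and P :: "complex poly"
  define Pr where "Pr P \<longleftrightarrow> P \<noteq> 0 \<and> act (Suc (degree P)) P \<in> U" for P
  obtain p where "v p \<in> vs.span (U \<union> v ` {..<p})"
    using krylov_stop[of v m U] vW W(2) by blast
  then obtain c where c: "v p - (\<Sum>j<p. vscale (c j) (v j)) \<in> U"
    using span_Un_sequence[OF U] by blast
  have "\<exists>P. Pr P"
  proof -
    define P where "P = monom 1 p - (\<Sum>j<p. monom (c j) j)"
    have cP: "coeff P j = (if j = p then 1 else if j < p then - c j else 0)" for j
      by (auto simp: P_def coeff_sum coeff_monom)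
    have d: "degree P = p"
      by (intro antisym degree_le le_degree) (auto simp: cP)
    have "act (Suc p) P = v p - (\<Sum>j<p. vscale (c j) (v j))"
      by (simp add: act_def cP vs.scale_minus_left sum_negf)
    then have "Pr P" using c d cP[of p] by (auto simp: Pr_def)
    then show ?thesis ..
  qed
  then obtain P where P: "Pr P" and min: "\<And>R. Pr R \<Longrightarrow> degree P \<le> degree R"
    using ex_has_least_nat[of Pr _ degree] by blast
  \<comment> \<open>A nonzero constant \<open>P\<close> would put \<open>w\<close> itself into
    \<open>U\<close>.\<close>
  have "degree P \<noteq> 0"
  proof
    assume "degree P = 0"
    then obtain a where a: "P = [:a:]" by (metis degree_eq_zeroE)
    then have "vscale a w \<in> U" "a \<noteq> 0" using P by (auto simp: Pr_def act_def v_def)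
    then have "vscale (inverse a) (vscale a w) \<in> U" using U vs.subspace_scale by blast
    then show False using \<open>a \<noteq> 0\<close> w by simp
  qed
  then have "\<not> constant (poly P)" by (simp add: constant_degree)
  then obtain \<mu> where "poly P \<mu> = 0" using fundamental_theorem_of_algebra by blast
  then obtain R where R: "P = [:- \<mu>, 1:] * R" by (metis dvdE poly_eq_0_iff_dvd)
  have R0: "R \<noteq> 0" using P R by (auto simp: Pr_def)
  then have dP: "degree P = Suc (degree R)"
    unfolding R by (subst degree_mult_eq) auto
  let ?v = "act (Suc (degree R)) R"
  have "?v \<notin> U" using min[of R] dP R0 by (auto simp: Pr_def)
  moreover have "?v \<in> W"
    unfolding act_def by (intro vs.subspace_sum vs.subspace_scale W vW)
  moreover have "?f ?v - vscale \<mu> ?v \<in> U"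
  proof -
    have PR: "P = pCons 0 R - smult \<mu> R" by (simp add: R)
    have "act (Suc (Suc (degree R))) P
        = act (Suc (Suc (degree R))) (pCons 0 R) - vscale \<mu> (act (Suc (Suc (degree R))) R)"
      by (simp add: act_def PR sum_subtractf vs.scale_left_diff_distrib vs.scale_sum_right del: sum.lessThan_Suc)
    also have "act (Suc (Suc (degree R))) R = ?v"
      by (simp add: act_def coeff_eq_0)
    also have "act (Suc (Suc (degree R))) (pCons 0 R) = ?f ?v"
      by (simp only: act_def sum.lessThan_Suc_shift[of _ "Suc (degree R)"])
        (simp add: mv_sum mv_add mv_scale vS)
    finally show ?thesis using P dP by (simp add: Pr_def)
  qed
  ultimately show ?thesis by blast
qed

text \<open>With \<open>y = [x, z]\<close>, the operator \<open>x\<close> sends \<open>z\<^sup>j w\<close> to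
  \<open>\<lambda>(x) z\<^sup>j w + j \<lambda>(y) z\<^sup>j\<^sup>-\<^sup>1 w\<close> modulo earlier terms. At the first linear relation among
  the \<open>z\<^sup>j w\<close> the second term has to vanish.\<close>

lemma weight_of_bracket_zero:
  assumes U: "vs.subspace U" and z: "z \<in> gl m"
    and zU: "\<And>u. u \<in> U \<Longrightarrow> mv m z u \<in> U"
    and MU: "\<And>x u. x \<in> M \<Longrightarrow> u \<in> U \<Longrightarrow> mv m x u \<in> U"
    and Mz: "\<And>x. x \<in> M \<Longrightarrow> lie_br m x z \<in> M"
    and w: "w \<in> cvec m" "w \<notin> U"
    and ew: "\<And>x. x \<in> M \<Longrightarrow> mv m x w - vscale (l x) w \<in> U"
    and x: "x \<in> M"
  shows "l (lie_br m x z) = 0"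
proof -
  define v where "v j = (mv m z ^^ j) w" for j
  define S where "S p = vs.span (U \<union> v ` {..<p})" for p
  have subS: "vs.subspace (S p)" for p by (simp add: S_def)
  have monoS: "p \<le> q \<Longrightarrow> S p \<subseteq> S q" for p q
    unfolding S_def by (intro vs.span_mono) auto
  have US: "U \<subseteq> S p" for p unfolding S_def using vs.span_superset by blast
  have vS: "j < p \<Longrightarrow> v j \<in> S p" for j p unfolding S_def by (intro vs.span_base) auto
  have S0: "S 0 = U" using U by (simp add: S_def)
  have vSuc: "v (Suc j) = mv m z (v j)" for j by (simp add: v_def)
  have zS: "mv m z s \<in> S (Suc p)" if "s \<in> S p" for s p
  proof -
    have "vs.subspace {s. mv m z s \<in> S (Suc p)}"
      using subS[of "Suc p"] by (auto simp: vs.subspace_def mv_simps)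
    moreover have "U \<union> v ` {..<p} \<subseteq> {s. mv m z s \<in> S (Suc p)}"
      using zU US vS vSuc[symmetric] by auto
    ultimately show ?thesis using that vs.span_minimal unfolding S_def[of p] by blast
  qed
  \<comment> \<open>The induction treats all of \<open>M\<close> at once, because the passage from
    \<open>j\<close> to \<open>Suc j\<close> applies the claim to \<open>[x, z]\<close> as well. At
    \<open>j = 0\<close> the truncated \<open>j - 1\<close> is harmless: its coefficient is
    zero.\<close>
  have key: "mv m x (v j) - vscale (l x) (v j)
      - vscale (of_nat j * l (lie_br m x z)) (v (j - 1)) \<in> S (j - 1)" if "x \<in> M" for x j
    using that
  proof (induction j arbitrary: x)
    case 0
    then show ?case using ew by (simp add: v_def S0)
  next
    case (Suc j)
    let ?y = "lie_br m x z"
    define r where "r = mv m x (v j) - vscale (l x) (v j) - vscale (of_nat j * l ?y) (v (j - 1))"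
    define t where "t = mv m ?y (v j) - vscale (l ?y) (v j)"
    have r: "r \<in> S (j - 1)" using Suc unfolding r_def by blast
    have t: "t \<in> S j"
    proof -
      have "t - vscale (of_nat j * l (lie_br m ?y z)) (v (j - 1)) \<in> S (j - 1)"
        using Suc.IH[OF Mz[OF Suc.prems]] by (simp add: t_def)
      then have "t - vscale (of_nat j * l (lie_br m ?y z)) (v (j - 1)) \<in> S j"
        using monoS[of "j - 1" j] by auto
      moreover have "vscale (of_nat j * l (lie_br m ?y z)) (v (j - 1)) \<in> S j"
        using vS[of "j - 1" j] subS[of j] by (cases j) (auto simp: vs.subspace_scale vs.subspace_0)
      ultimately show ?thesis using vs.subspace_add[OF subS] by fastforce
    qed
    have zr: "mv m z r \<in> S j" using zS[OF r] r zU by (cases j) (auto simp: S0)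
    have jz: "vscale (of_nat j * l ?y) (mv m z (v (j - 1))) = vscale (of_nat j * l ?y) (v j)"
      using vSuc[of "j - 1"] by (cases "j = 0") simp_all
    have "mv m x (v (Suc j)) = mv m z (mv m x (v j)) + mv m ?y (v j)"
      by (simp add: vSuc mv_lie_br)
    also have "mv m x (v j) = r + vscale (l x) (v j) + vscale (of_nat j * l ?y) (v (j - 1))"
      by (simp add: r_def)
    also have "mv m z \<dots> = mv m z r + vscale (l x) (v (Suc j)) + vscale (of_nat j * l ?y) (v j)"
      by (simp only: mv_simps jz vSuc)
    also have "mv m ?y (v j) = t + vscale (l ?y) (v j)" by (simp add: t_def)
    finally have "mv m x (v (Suc j)) - vscale (l x) (v (Suc j))
        - vscale (of_nat (Suc j) * l ?y) (v j) = mv m z r + t"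
      by (simp add: algebra_simps vs.scale_left_distrib)
    then show ?case using zr t vs.subspace_add[OF subS] by simp
  qed
  obtain p where p: "v p \<in> S p" and least: "\<And>q. v q \<in> S q \<Longrightarrow> p \<le> q"
  proof -
    have "\<exists>p. v p \<in> S p"
      unfolding S_def by (rule krylov_stop[of v m]) (auto simp: v_def mv_pow_cvec z w)
    then show thesis using that ex_has_least_nat[of "\<lambda>p. v p \<in> S p" _ id] by auto
  qed
  have "p \<noteq> 0"
  proof
    assume "p = 0"
    then show False using p w by (simp add: S0 v_def)
  qed
  then obtain q where q: "p = Suc q" by (cases p) auto
  have vq: "v q \<notin> S q" using least[of q] q by auto
  let ?y = "lie_br m x z"
  \<comment> \<open>On \<open>S p\<close> the operator \<open>x - l(x)\<close> drops one level.
    Since \<open>v p\<close> lies in \<open>S p\<close>, comparison with \<open>key\<close> at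
    \<open>p\<close> forces \<open>p * l([x, z])\<close> times \<open>v q\<close> into
    \<open>S q\<close>, although \<open>v q\<close> is outside \<open>S q\<close>.\<close>
  have low: "mv m x s - vscale (l x) s \<in> S q" if "s \<in> S p" for s
  proof -
    let ?V = "{s. mv m x s - vscale (l x) s \<in> S q}"
    have "vs.subspace ?V"
    proof (rule vs.subspaceI)
      show "0 \<in> ?V" by (simp add: vs.subspace_0[OF subS])
    next
      fix a b assume "a \<in> ?V" "b \<in> ?V"
      then have "(mv m x a - vscale (l x) a) + (mv m x b - vscale (l x) b) \<in> S q"
        using vs.subspace_add[OF subS] by blast
      then show "a + b \<in> ?V" by (simp add: mv_simps vs.scale_right_distrib algebra_simps)
    next
      fix c a assume "a \<in> ?V"
      then have "vscale c (mv m x a - vscale (l x) a) \<in> S q"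
        using vs.subspace_scale[OF subS] by blast
      then show "vscale c a \<in> ?V" by (simp add: mv_simps vs.scale_right_diff_distrib mult.commute)
    qed
    moreover have "U \<subseteq> ?V"
      using MU[OF x] U US[of q] vs.subspace_diff vs.subspace_scale by blast
    moreover have "v j \<in> ?V" if j: "j < p" for j
    proof -
      have "mv m x (v j) - vscale (l x) (v j)
        - vscale (of_nat j * l ?y) (v (j - 1)) \<in> S q"
        using key[OF x, of j] monoS[of "j - 1" q] j q by (meson diff_le_self le_trans less_Suc_eq_le subsetD)
      moreover have "vscale (of_nat j * l ?y) (v (j - 1)) \<in> S q"
        using j q vS[of "j - 1" q] subS[of q]
        by (cases j) (auto simp: vs.subspace_scale vs.subspace_0)
      ultimately have "mv m x (v j) - vscale (l x) (v j) \<in> S q"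
        using vs.subspace_add[OF subS] by fastforce
      then show ?thesis by simp
    qed
    ultimately have "vs.span (U \<union> v ` {..<p}) \<subseteq> ?V"
      by (intro vs.span_minimal) auto
    then show ?thesis using that unfolding S_def[of p] by blast
  qed
  have "mv m x (v p) - vscale (l x) (v p) \<in> S q" by (rule low[OF p])
  moreover have "mv m x (v p) - vscale (l x) (v p) - vscale (of_nat p * l ?y) (v q) \<in> S q"
    using key[OF x, of p] q by simp
  ultimately have "vscale (of_nat p * l ?y) (v q) \<in> S q"
    using vs.subspace_diff[OF subS] by fastforce
  then have "vscale (inverse (of_nat p * l ?y)) (vscale (of_nat p * l ?y) (v q)) \<in> S q"
    using vs.subspace_scale[OF subS] by blast
  moreover have "vscale (inverse c) (vscale c (v q)) = v q" if "c \<noteq> 0" for c using that by simp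
  ultimately have "of_nat p * l ?y = 0" using vq by metis
  then show ?thesis using \<open>p \<noteq> 0\<close> by simp
qed

text \<open>A joint eigenvector in the quotient by \<open>U\<close>, given by a
  representative.\<close>

definition common_ev :: "nat \<Rightarrow> (nat \<Rightarrow> complex) set \<Rightarrow> cmat set \<Rightarrow> bool" where
  "common_ev m U M \<longleftrightarrow> (\<exists>w\<in>cvec m. w \<notin> U \<and> (\<forall>x\<in>M. \<exists>c. mv m x w - vscale c w \<in> U))"

text \<open>The simultaneous weight space of \<open>M\<close> modulo \<open>U\<close> is stable
  under \<open>z\<close>, because the weight vanishes on all brackets \<open>[x, z]\<close> with
  \<open>x\<close> in \<open>M\<close>; so it contains an eigenvector of \<open>z\<close> modulo
  \<open>U\<close>.\<close>

lemma common_ev_insert: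
  assumes U: "vs.subspace U" and z: "z \<in> gl m"
    and zU: "\<And>u. u \<in> U \<Longrightarrow> mv m z u \<in> U"
    and MU: "\<And>x u. x \<in> M \<Longrightarrow> u \<in> U \<Longrightarrow> mv m x u \<in> U"
    and Mz: "\<And>x. x \<in> M \<Longrightarrow> lie_br m x z \<in> M"
    and M: "cm.subspace M" and ev: "common_ev m U M"
  shows "common_ev m U (cm.span (insert z M))"
proof -
  obtain w where w: "w \<in> cvec m" "w \<notin> U" "\<And>x. x \<in> M \<Longrightarrow> \<exists>c. mv m x w - vscale c w \<in> U"
    using ev unfolding common_ev_def by blast
  then obtain l where l: "\<And>x. x \<in> M \<Longrightarrow> mv m x w - vscale (l x) w \<in> U" by metis
  define W where "W = {v \<in> cvec m. \<forall>x\<in>M. mv m x v - vscale (l x) v \<in> U}"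
  have subW: "vs.subspace W"
  proof (rule vs.subspaceI)
    show "0 \<in> W" using U subspace_cvec by (auto simp: W_def vs.subspace_0)
  next
    fix a b assume ab: "a \<in> W" "b \<in> W"
    have "mv m x (a + b) - vscale (l x) (a + b) \<in> U" if "x \<in> M" for x
    proof -
      have "(mv m x a - vscale (l x) a) + (mv m x b - vscale (l x) b) \<in> U"
        using ab that vs.subspace_add[OF U] by (auto simp: W_def)
      then show ?thesis by (simp add: mv_simps vs.scale_right_distrib algebra_simps)
    qed
    then show "a + b \<in> W" using ab vs.subspace_add[OF subspace_cvec] by (auto simp: W_def)
  next
    fix c a assume a: "a \<in> W"
    have "mv m x (vscale c a) - vscale (l x) (vscale c a) \<in> U" if "x \<in> M" for x
    proof -
      have "vscale c (mv m x a - vscale (l x) a) \<in> U"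
        using a that vs.subspace_scale[OF U] by (auto simp: W_def)
      then show ?thesis by (simp add: mv_simps vs.scale_right_diff_distrib mult.commute)
    qed
    then show "vscale c a \<in> W" using a vs.subspace_scale[OF subspace_cvec] by (auto simp: W_def)
  qed
  have zW: "mv m z v \<in> W" if v: "v \<in> W" for v
  proof -
    have "mv m x (mv m z v) - vscale (l x) (mv m z v) \<in> U" if x: "x \<in> M" for x
    \<comment> \<open>\<open>W\<close> may contain vectors of \<open>U\<close>, whereas the
      vanishing of the weight is available only at a vector outside \<open>U\<close>.\<close>
    proof (cases "v \<in> U")
      case True
      then show ?thesis
        using zU MU x vs.subspace_diff[OF U] vs.subspace_scale[OF U] by blast
    next
      case False
      have ly: "l (lie_br m x z) = 0"
        by (rule weight_of_bracket_zero[OF U z zU MU Mz _ False _ x]) (use v in \<open>auto simp: W_def\<close>)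
      have "mv m (lie_br m x z) v - vscale (l (lie_br m x z)) v \<in> U"
        using v Mz[OF x] by (auto simp: W_def)
      then have 1: "mv m (lie_br m x z) v \<in> U" using ly by simp
      have 2: "mv m z (mv m x v - vscale (l x) v) \<in> U" using v x zU by (auto simp: W_def)
      have "mv m x (mv m z v) - vscale (l x) (mv m z v)
          = mv m (lie_br m x z) v + mv m z (mv m x v - vscale (l x) v)"
        by (simp add: mv_lie_br mv_simps)
      then show ?thesis using vs.subspace_add[OF U 1 2] by simp
    qed
    then show ?thesis using mv_cvec[OF z] by (auto simp: W_def)
  qed
  have wW: "w \<in> W" using w l by (auto simp: W_def)
  obtain v \<mu> where v: "v \<in> W" "v \<notin> U" "mv m z v - vscale \<mu> v \<in> U"
    using relative_eigenvector[OF U z subW _ zW wW w(2)] by (auto simp: W_def)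
  have "\<exists>c. mv m x v - vscale c v \<in> U" if "x \<in> cm.span (insert z M)" for x
  proof -
    have "cm.span M = M" using M by simp
    with that obtain k where k: "x - msmult k z \<in> M" unfolding cm.span_insert by auto
    define y where "y = x - msmult k z"
    have "mv m x v - vscale (l y + k * \<mu>) v
        = (mv m y v - vscale (l y) v) + vscale k (mv m z v - vscale \<mu> v)"
      by (simp add: y_def mv_simps vs.scale_left_distrib vs.scale_right_diff_distrib)
    also have "\<dots> \<in> U"
      using k v by (intro vs.subspace_add vs.subspace_scale U) (auto simp: W_def y_def)
    finally show ?thesis by blast
  qed
  then show ?thesis using v by (auto simp: common_ev_def W_def)
qed

text \<open>Induction on the derived length: the derived algebra has a joint eigenvector modulo
  \<open>U\<close>, and the elements of a basis of \<open>L\<close> are added one at a time. Every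
  span met on the way contains all commutators of \<open>L\<close>, so it is an ideal, as
  \<open>common_ev_insert\<close> demands.\<close>

theorem lie_theorem:
  assumes U: "vs.subspace U" and w: "w \<in> cvec m" "w \<notin> U"
    and LU: "\<And>x u. x \<in> L \<Longrightarrow> u \<in> U \<Longrightarrow> mv m x u \<in> U"
    and L: "lie_subalg m L" "solvable m L"
  shows "common_ev m U L"
proof -
  obtain k where "(derived m ^^ k) L = {0}" using L by (auto simp: solvable_iff)
  then show ?thesis using LU L(1)
  proof (induction k arbitrary: L)
    case 0
    then show ?case using U w
      by (auto simp: common_ev_def intro!: bexI[of _ w] exI[of _ 0] dest: vs.subspace_0)
  next
    case (Suc k)
    have gl: "L \<subseteq> gl m" and sub: "cm.subspace L" using Suc.prems by (auto simp: lie_subalg_iff)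
    have dL: "derived m L \<subseteq> L"
      using Suc.prems(3) by (intro derived_subset) (auto simp: lie_subalg_iff)
    have la: "lie_subalg m (derived m L)"
      unfolding lie_subalg_iff using dL gl lie_br_derived subspace_derived by blast
    have ev0: "common_ev m U (derived m L)"
      by (rule Suc.IH) (use Suc.prems dL la in \<open>auto simp: funpow_swap1\<close>)
    have step: "common_ev m U (cm.span (derived m L \<union> Z))" if "finite Z" "Z \<subseteq> L" for Z
      using that
    proof (induction Z)
      case empty
      have "cm.span (derived m L \<union> {}) = derived m L" using subspace_derived by simp
      then show ?case using ev0 by (rule ssubst)
    next
      case (insert z Z)
      let ?M = "cm.span (derived m L \<union> Z)"
      have MsubL: "?M \<subseteq> L" using insert dL by (intro cm.span_minimal sub) auto
      have "common_ev m U (cm.span (insert z ?M))"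
      proof (rule common_ev_insert[OF U])
        show "lie_br m x z \<in> ?M" if "x \<in> ?M" for x
          using that MsubL insert.prems lie_br_derived[of x L z m] by (intro cm.span_base) auto
      qed (use insert MsubL gl Suc.prems in auto)
      moreover have "cm.span (insert z ?M) = cm.span (derived m L \<union> insert z Z)"
        by (simp only: Un_insert_right cm.span_insert cm.span_span)
      ultimately show ?case by simp
    qed
    obtain B where B: "B \<subseteq> L" "cm.independent B" "L \<subseteq> cm.span B"
      using cm.maximal_independent_subset by blast
    then have "finite B" using finite_indep_gl gl by blast
    moreover have "cm.span (derived m L \<union> B) = L"
      using B dL sub cm.span_mono[of B "derived m L \<union> B"] by (intro antisym cm.span_minimal) auto
    ultimately show ?case using step[OF _ B(1)] by simp
  qed
qed

subsection \<open>Borel subalgebras attached to an ordering of the coordinates\<close>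

text \<open>For injective \<open>s\<close>, the case \<open>j = 0\<close> stabilises the flag that
  adds basis vectors by increasing \<open>s\<close>; positive \<open>j\<close> filter its strictly
  triangular part. The values of \<open>s\<close> may have gaps, since passing to a smaller corner
  skips the position of the removed vector.\<close>

definition tri :: "nat \<Rightarrow> (nat \<Rightarrow> nat) \<Rightarrow> nat \<Rightarrow> cmat set" where
  "tri m s j = {A \<in> gl m. \<forall>a b. A a b \<noteq> 0 \<longrightarrow> s a + j \<le> s b}"

lemma tri_gl: "tri m s j \<subseteq> gl m"
  by (auto simp: tri_def)

lemma gl_nonzeroD: "A \<in> gl m \<Longrightarrow> A a b \<noteq> 0 \<Longrightarrow> a < m \<and> b < m"
  unfolding gl_def by (metis (mono_tags, lifting) mem_Collect_eq not_le)

lemma glI: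
  assumes "\<And>a b. A a b \<noteq> 0 \<Longrightarrow> a < m \<and> b < m"
  shows "A \<in> gl m"
  unfolding gl_def using assms leD by blast

lemma subspace_tri: "cm.subspace (tri m s j)"
proof (rule cm.subspaceI)
  show "0 \<in> tri m s j" using cm.subspace_0[OF subspace_gl] by (auto simp: tri_def fun_apply)
next
  fix x y assume xy: "x \<in> tri m s j" "y \<in> tri m s j"
  then have "x + y \<in> gl m" using cm.subspace_add[OF subspace_gl] by (auto simp: tri_def)
  moreover have "s a + j \<le> s b" if "(x + y) a b \<noteq> 0" for a b
  proof -
    have "x a b \<noteq> 0 \<or> y a b \<noteq> 0" using that by (auto simp: fun_apply)
    then show ?thesis using xy by (auto simp: tri_def)
  qed
  ultimately show "x + y \<in> tri m s j" by (simp add: tri_def)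
next
  fix c x assume "x \<in> tri m s j"
  then show "msmult c x \<in> tri m s j"
    using cm.subspace_scale[OF subspace_gl] by (auto simp: tri_def msmult_def)
qed

lemma mmul_nonzeroD:
  assumes "mmul m A B a b \<noteq> 0"
  shows "\<exists>k<m. A a k \<noteq> 0 \<and> B k b \<noteq> 0"
proof -
  have "(\<Sum>k<m. A a k * B k b) \<noteq> 0" using assms by (simp add: mmul_def)
  then obtain k where "k \<in> {..<m}" "A a k * B k b \<noteq> 0"
    using sum.not_neutral_contains_not_neutral by blast
  then show ?thesis by auto
qed

lemma mmul_tri:
  assumes "A \<in> tri m s i" "B \<in> tri m s j"
  shows "mmul m A B \<in> tri m s (i + j)"
proof -
  have "s a + (i + j) \<le> s b" if nz: "mmul m A B a b \<noteq> 0" for a b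
  proof -
    obtain k where "A a k \<noteq> 0" "B k b \<noteq> 0" using mmul_nonzeroD[OF nz] by blast
    then have "s a + i \<le> s k" "s k + j \<le> s b" using assms by (auto simp: tri_def)
    then show ?thesis by linarith
  qed
  then show ?thesis using assms mmul_gl by (auto simp: tri_def)
qed

lemma lie_br_tri:
  assumes "A \<in> tri m s i" "B \<in> tri m s j"
  shows "lie_br m A B \<in> tri m s (i + j)"
  unfolding lie_br_eq using assms mmul_tri[of A m s i B j] mmul_tri[of B m s j A i]
  by (intro cm.subspace_diff[OF subspace_tri]) (auto simp: add.commute)

lemma mmul_tri_diag:
  assumes s: "inj_on s {..<m}" and "A \<in> tri m s 0" "B \<in> tri m s 0" and a: "a < m"
  shows "mmul m A B a a = A a a * B a a"
proof -
  have "A a k * B k a = (if k = a then A a a * B a a else 0)" if "k < m" for k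
  proof (cases "A a k * B k a = 0")
    case False
    then have "s a \<le> s k" "s k \<le> s a" using assms by (auto simp: tri_def)
    then have "k = a" using s a that by (auto simp: inj_on_def)
    then show ?thesis by simp
  qed auto
  then have "(\<Sum>k<m. A a k * B k a) = (\<Sum>k<m. if k = a then A a a * B a a else 0)"
    by (intro sum.cong) auto
  then show ?thesis using a by (simp add: mmul_def)
qed

text \<open>Diagonal entries of triangular matrices simply multiply, so a commutator has zero
  diagonal and, \<open>s\<close> being injective, gains one step.\<close>

lemma lie_br_tri0:
  assumes s: "inj_on s {..<m}" and A: "A \<in> tri m s 0" and B: "B \<in> tri m s 0"
  shows "lie_br m A B \<in> tri m s 1"
proof -
  have *: "lie_br m A B \<in> tri m s 0" using lie_br_tri[OF A B] by simp
  have "s a + 1 \<le> s b" if nz: "lie_br m A B a b \<noteq> 0" for a b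
  proof -
    have ab: "a < m" "b < m" using nz * gl_nonzeroD by (auto simp: tri_def)
    have "s a \<le> s b" using nz * by (auto simp: tri_def)
    moreover have "s a \<noteq> s b"
    proof
      assume "s a = s b"
      then have "a = b" using s ab by (auto simp: inj_on_def)
      then show False using nz mmul_tri_diag[OF s A B] mmul_tri_diag[OF s B A] ab
        by (simp add: lie_br_def)
    qed
    ultimately show ?thesis by linarith
  qed
  then show ?thesis using * by (simp add: tri_def)
qed

lemma tri_mono: "i \<le> j \<Longrightarrow> tri m s j \<subseteq> tri m s i"
  by (fastforce simp: tri_def)

lemma lie_subalg_tri: "lie_subalg m (tri m s 0)"
  using lie_br_tri[of _ m s 0 _ 0] by (auto simp: lie_subalg_iff tri_gl subspace_tri)

lemma derived_pow_tri:
  assumes s: "inj_on s {..<m}"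
  shows "(derived m ^^ Suc j) (tri m s 0) \<subseteq> tri m s (Suc j)"
proof (induction j)
  case 0
  have "derived m (tri m s 0) \<subseteq> tri m s 1"
    using lie_br_tri0[OF s] by (intro derived_subset subspace_tri) auto
  then show ?case by simp
next
  case (Suc j)
  have "derived m (tri m s (Suc j)) \<subseteq> tri m s (Suc j + Suc j)"
    using lie_br_tri[of _ m s "Suc j" _ "Suc j"] by (intro derived_subset subspace_tri) auto
  also have "\<dots> \<subseteq> tri m s (Suc (Suc j))" by (rule tri_mono) simp
  finally have "derived m (tri m s (Suc j)) \<subseteq> tri m s (Suc (Suc j))" .
  with derived_mono[OF Suc.IH, of m] have "derived m ((derived m ^^ Suc j) (tri m s 0)) \<subseteq> tri m s (Suc (Suc j))"
    by (rule subset_trans)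
  then show ?case by simp
qed

lemma tri_eq_zero:
  assumes "\<And>b. b < m \<Longrightarrow> s b < j"
  shows "tri m s j \<subseteq> {0}"
proof
  fix A assume A: "A \<in> tri m s j"
  have "A a b = 0" for a b
  proof (rule ccontr)
    assume "A a b \<noteq> 0"
    then have "b < m" "s a + j \<le> s b" using A gl_nonzeroD by (auto simp: tri_def)
    then show False using assms[of b] by simp
  qed
  then show "A \<in> {0}" by (simp add: fun_eq_iff fun_apply)
qed

lemma solvable_tri:
  assumes s: "inj_on s {..<m}"
  shows "solvable m (tri m s 0)"
proof -
  have "finite (s ` {..<m})" by simp
  then obtain N where N: "\<And>b. b < m \<Longrightarrow> s b \<le> N" using finite_nat_set_iff_bounded_le by auto
  then have "tri m s (Suc N) \<subseteq> {0}" by (intro tri_eq_zero) (simp add: less_Suc_eq_le)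
  then have "(derived m ^^ Suc N) (tri m s 0) \<subseteq> {0}"
    using derived_pow_tri[OF s, of N] by blast
  then show ?thesis by (rule solvableI[OF subspace_tri])
qed

lemma eu_mmul_eu: "b < m \<Longrightarrow> c < m \<Longrightarrow> mmul m (eu a b) (eu c d) = (if b = c then eu a d else 0)"
proof -
  assume bc: "b < m" "c < m"
  have "(\<Sum>k<m. eu a b i k * eu c d k j) = (\<Sum>k<m. if k = c then (if b = c then eu a d i j else 0) else 0)" for i j
    by (rule sum.cong) (auto simp: eu_def)
  then show ?thesis using bc by (auto simp: mmul_def fun_eq_iff fun_apply)
qed

lemma eu_nonzero: "eu a b \<noteq> 0"
proof
  assume "eu a b = 0"
  then have "eu a b a b = 0" by (simp add: fun_apply)
  then show False by (simp add: eu_def)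
qed

text \<open>A subalgebra containing opposite root vectors contains a copy of \<open>sl\<^sub>2\<close>, which is perfect.\<close>

lemma not_solvable_sl2:
  assumes L: "lie_subalg m L" and ab: "a < m" "b < m" "a \<noteq> b"
    and EF: "eu a b \<in> L" "eu b a \<in> L"
  shows "\<not> solvable m L"
proof -
  let ?H = "eu a a - eu b b"
  have H: "lie_br m (eu a b) (eu b a) = ?H" using ab by (simp add: lie_br_eq eu_mmul_eu)
  have HL: "?H \<in> L" using H EF L unfolding lie_subalg_iff by metis
  have E: "lie_br m ?H (eu a b) = msmult 2 (eu a b)"
    using ab by (simp add: lie_br_eq mmul_simps eu_mmul_eu)
      (simp add: msmult_def fun_eq_iff fun_apply)
  have F: "lie_br m ?H (eu b a) = msmult (- 2) (eu b a)"
    using ab by (simp add: lie_br_eq mmul_simps eu_mmul_eu)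
      (simp add: msmult_def fun_eq_iff fun_apply)
  have "eu a b \<in> (derived m ^^ k) L \<and> eu b a \<in> (derived m ^^ k) L \<and> ?H \<in> (derived m ^^ k) L" for k
  proof (induction k)
    case 0
    show ?case using EF HL by simp
  next
    case (Suc k)
    let ?D = "(derived m ^^ k) L"
    have "?H \<in> derived m ?D" using lie_br_derived[of "eu a b" ?D "eu b a" m] Suc.IH H by auto
    moreover have "msmult 2 (eu a b) \<in> derived m ?D"
      using lie_br_derived[of ?H ?D "eu a b" m] Suc.IH E by metis
    then have "msmult (1/2) (msmult 2 (eu a b)) \<in> derived m ?D"
      using cm.subspace_scale[OF subspace_derived] by blast
    moreover have "msmult (- 2) (eu b a) \<in> derived m ?D"
      using lie_br_derived[of ?H ?D "eu b a" m] Suc.IH F by metis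
    then have "msmult (- 1/2) (msmult (- 2) (eu b a)) \<in> derived m ?D"
      using cm.subspace_scale[OF subspace_derived] by blast
    ultimately show ?case by simp
  qed
  then show ?thesis using eu_nonzero[of a b] unfolding solvable_iff by blast
qed

lemma eu_tri: "a < m \<Longrightarrow> b < m \<Longrightarrow> s a \<le> s b \<Longrightarrow> eu a b \<in> tri m s 0"
  using eu_gl by (auto simp: tri_def eu_def)

text \<open>A larger subalgebra contains a matrix with a nonzero entry \<open>(a, b)\<close> against
  the ordering. Diagonal matrix units extract \<open>eu a b\<close> from it, and
  \<open>eu b a\<close> is already present, so a copy of \<open>sl2\<close> prevents
  solvability.\<close>

lemma borel_tri:
  assumes s: "inj_on s {..<m}"
  shows "borel m (tri m s 0)"
  unfolding borel_def
proof (intro conjI allI impI lie_subalg_tri solvable_tri[OF s])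
  fix b' assume b': "lie_subalg m b' \<and> solvable m b' \<and> tri m s 0 \<subseteq> b'"
  then have gl: "b' \<subseteq> gl m" and sub: "cm.subspace b'"
    and br: "\<And>x y. x \<in> b' \<Longrightarrow> y \<in> b' \<Longrightarrow> lie_br m x y \<in> b'" by (auto simp: lie_subalg_iff)
  have "x \<in> tri m s 0" if x: "x \<in> b'" for x
  proof (rule ccontr)
    assume "x \<notin> tri m s 0"
    then obtain a b where ab: "x a b \<noteq> 0" "\<not> s a \<le> s b" using x gl by (auto simp: tri_def)
    then have lt: "a < m" "b < m" using x gl gl_nonzeroD by blast+
    have ne: "a \<noteq> b" using ab by auto
    have F: "eu b a \<in> b'" and "eu a a \<in> b'" "eu b b \<in> b'" using eu_tri lt ab b' by auto
    then have z: "lie_br m (lie_br m (eu a a) x) (eu b b) \<in> b'" using br x by blast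
    \<comment> \<open>The two brackets retain exactly the entries at \<open>(a, b)\<close> and
      \<open>(b, a)\<close>; the second one respects the ordering and can be subtracted.\<close>
    have eq: "lie_br m (lie_br m (eu a a) x) (eu b b) = msmult (x a b) (eu a b) + msmult (x b a) (eu b a)"
      using lt ne
      by (simp add: lie_br_eq mmul_simps eu_mmul mmul_eu)
        (auto simp: fun_eq_iff msmult_def eu_def fun_apply)
    have "msmult (x a b) (eu a b) \<in> b'"
      using cm.subspace_diff[OF sub z cm.subspace_scale[OF sub F, of "x b a"]] by (simp add: eq)
    then have "msmult (inverse (x a b)) (msmult (x a b) (eu a b)) \<in> b'"
      using cm.subspace_scale[OF sub] by blast
    then have "eu a b \<in> b'" using ab by simp
    then show False using not_solvable_sl2[OF _ lt ne _ F] b' by blast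
  qed
  then show "b' = tri m s 0" using b' by blast
qed

text \<open>Compare the \<open>(a, b)\<close> and \<open>(b, b)\<close> entries of \<open>E\<^sub>b\<^sub>a p = p t\<close> at a position \<open>(a, b)\<close> where \<open>p\<close>
  violates the ordering, with \<open>s b\<close> minimal.\<close>

lemma tri_normalizer:
  assumes s: "inj_on s {..<m}" and p: "p \<in> gl m"
    and n: "\<And>x. x \<in> tri m s 0 \<Longrightarrow> \<exists>y\<in>tri m s 0. mmul m x p = mmul m p y"
  shows "p \<in> tri m s 0"
proof (rule ccontr)
  assume "p \<notin> tri m s 0"
  then have "\<exists>b a. p a b \<noteq> 0 \<and> s b < s a" using p by (auto simp: tri_def not_le)
  then obtain b where "\<exists>a. p a b \<noteq> 0 \<and> s b < s a"
    and min: "\<And>l. (\<exists>a. p a l \<noteq> 0 \<and> s l < s a) \<Longrightarrow> s b \<le> s l"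
    using ex_has_least_nat[of "\<lambda>b. \<exists>a. p a b \<noteq> 0 \<and> s b < s a" _ s] by blast
  then obtain a where a: "p a b \<noteq> 0" "s b < s a" by blast
  have lt: "a < m" "b < m" using gl_nonzeroD[OF p a(1)] by auto
  obtain t where t: "t \<in> tri m s 0" "mmul m (eu b a) p = mmul m p t"
    using n[OF eu_tri[of b m a s]] lt a by auto
  have zero: "p i l * t l b = 0" if "l < m" "l \<noteq> b" "s b \<le> s i" for i l
  proof (rule ccontr)
    assume nz: "p i l * t l b \<noteq> 0"
    then have "s l \<le> s b" using t by (auto simp: tri_def)
    moreover have "s l \<noteq> s b" using s that lt by (auto simp: inj_on_def)
    ultimately have "s l < s b" by simp
    then show False using min[of l] nz that by force
  qed
  have col: "mmul m p t i b = p i b * t b b" if "s b \<le> s i" for i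
  proof -
    have "(\<Sum>k<m. p i k * t k b) = (\<Sum>k<m. if k = b then p i b * t b b else 0)"
      by (rule sum.cong) (auto simp: zero that)
    then show ?thesis using lt by (simp add: mmul_def)
  qed
  have "mmul m (eu b a) p = (\<lambda>i j. if i = b then p a j else 0)" using eu_mmul lt by blast
  then have "p a b * t b b = 0" "p b b * t b b = p a b"
    using col[of a] col[of b] a t(2) by (auto simp: fun_eq_iff split: if_splits)
  then show False using a by auto
qed

subsection \<open>Flags and conjugacy\<close>

lemma indep_ev: "vs.independent (ev ` {..<m})"
proof -
  have "ev i \<notin> vs.span ({} \<union> ev ` {..<i})" for i
  proof -
    have "vs.span ({} \<union> ev ` {..<i}) \<subseteq> {v. v i = 0}"
      by (rule vs.span_minimal)
        (auto simp: ev_def vs.subspace_def vscale_def fun_apply)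
    then show ?thesis by (auto simp: ev_def)
  qed
  then show ?thesis using indep_chain[of m ev "{}"] by blast
qed

lemma cvec_not_subset_span:
  assumes "j < m"
  shows "\<exists>w\<in>cvec m. w \<notin> vs.span (v ` {..<j :: nat})"
proof (rule ccontr)
  assume "\<not> ?thesis"
  then have "ev ` {..<m} \<subseteq> vs.span (v ` {..<j})" using ev_cvec by blast
  then have "card (ev ` {..<m}) \<le> card (v ` {..<j})"
    using vs.independent_span_bound[OF _ indep_ev] by blast
  moreover have "card (ev ` {..<m}) = m" using card_image[OF inj_on_subset[OF inj_ev]] by auto
  moreover have "card (v ` {..<j}) \<le> j" using card_image_le[of "{..<j}" v] by simp
  ultimately show False using assms by simp
qed

text \<open>Lie's theorem modulo the span of the vectors found so far supplies the next one. If the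
  idempotent \<open>e\<close> lies in \<open>L\<close>, the new vector is corrected within its class
  modulo that span to a true eigenvector of \<open>e\<close>.\<close>

lemma flag_exists:
  assumes L: "lie_subalg m L" "solvable m L" and e: "e \<in> gl m" "mmul m e e = e" and "j \<le> m"
  shows "\<exists>v :: nat \<Rightarrow> nat \<Rightarrow> complex. \<forall>i<j. v i \<in> cvec m \<and> v i \<notin> vs.span (v ` {..<i}) \<and>
    (\<forall>x\<in>L. mv m x (v i) \<in> vs.span (v ` {..i})) \<and>
    (e \<in> L \<longrightarrow> mv m e (v i) = v i \<or> mv m e (v i) = 0)"
  using \<open>j \<le> m\<close>
proof (induction j)
  case 0
  show ?case by simp
next
  case (Suc j)
  then obtain v :: "nat \<Rightarrow> nat \<Rightarrow> complex" where v: "\<forall>i<j. v i \<in> cvec m \<and> v i \<notin> vs.span (v ` {..<i}) \<and>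
    (\<forall>x\<in>L. mv m x (v i) \<in> vs.span (v ` {..i})) \<and>
    (e \<in> L \<longrightarrow> mv m e (v i) = v i \<or> mv m e (v i) = 0)" by auto
  define U where "U = vs.span (v ` {..<j})"
  have subU: "vs.subspace U" by (simp add: U_def)
  have stab: "mv m x u \<in> U" if x: "x \<in> L" and u: "u \<in> U" for x u
  proof -
    have "vs.subspace {u. mv m x u \<in> U}"
      using subU by (auto simp: vs.subspace_def mv_simps)
    moreover have "mv m x (v i) \<in> U" if "i < j" for i
      using v that x vs.span_mono[of "v ` {..i}" "v ` {..<j}"] by (fastforce simp: U_def)
    ultimately have "U \<subseteq> {u. mv m x u \<in> U}"
      unfolding U_def by (intro vs.span_minimal) auto
    then show ?thesis using u by blast
  qed
  obtain w0 where "w0 \<in> cvec m" "w0 \<notin> U" using cvec_not_subset_span[of j m v] Suc.prems by (auto simp: U_def)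
  then have "common_ev m U L" using lie_theorem[OF subU _ _ stab L] by blast
  then obtain w where w: "w \<in> cvec m" "w \<notin> U" "\<And>x. x \<in> L \<Longrightarrow> \<exists>c. mv m x w - vscale c w \<in> U"
    unfolding common_ev_def by blast
  obtain w' where w': "w' \<in> cvec m" "w' - w \<in> U" "e \<in> L \<longrightarrow> mv m e w' = w' \<or> mv m e w' = 0"
  proof (cases "e \<in> L")
    case False
    then show thesis using that[of w] w subU by (auto simp: vs.subspace_0)
  next
    case True
    then obtain c where c: "mv m e w - vscale c w \<in> U" using w(3) by blast
    have ee: "mv m e (mv m e x) = mv m e x" for x using e(2) mv_mmul by metis
    define u where "u = mv m e w - vscale c w"
    have uU: "u \<in> U" using c by (simp add: u_def)
    have ew: "mv m e w = vscale c w + u" by (simp add: u_def)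
    \<comment> \<open>Idempotence puts \<open>(1 - c) * c\<close> times \<open>w\<close> into
      \<open>U\<close>, so the eigenvalue modulo \<open>U\<close> is \<open>0\<close> or
      \<open>1\<close>. The corrected vector is then \<open>w - e w\<close> or \<open>e w\<close>
      respectively.\<close>
    have "mv m e u = vscale (1 - c) (vscale c w + u)"
      unfolding ew[symmetric] by (simp add: u_def mv_simps ee vs.scale_left_diff_distrib)
    then have "vscale ((1 - c) * c) w = mv m e u - vscale (1 - c) u"
      by (simp add: vs.scale_right_distrib)
    also have "\<dots> \<in> U" using stab[OF True uU] uU subU vs.subspace_diff vs.subspace_scale by blast
    finally have "vscale (inverse ((1 - c) * c)) (vscale ((1 - c) * c) w) \<in> U"
      using subU vs.subspace_scale by blast
    moreover have "vscale (inverse d) (vscale d w) = w" if "d \<noteq> 0" for d using that by simp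
    ultimately have "(1 - c) * c = 0" using w(2) by metis
    then have "c = 1 \<or> c = 0" by auto
    then show thesis
    proof
      assume "c = 1"
      show thesis
      proof (rule that)
        show "mv m e w \<in> cvec m" by (rule mv_cvec[OF e(1)])
        show "mv m e w - w \<in> U" using uU ew \<open>c = 1\<close> by simp
        show "e \<in> L \<longrightarrow> mv m e (mv m e w) = mv m e w \<or> mv m e (mv m e w) = 0" using ee by blast
      qed
    next
      assume "c = 0"
      then have "mv m e w = u" using ew by simp
      moreover have "w - u - w = - u" by simp
      then have "w - u - w \<in> U" using uU subU vs.subspace_neg by metis
      moreover have "mv m e (w - u) = 0" using ee[of w] \<open>mv m e w = u\<close> by (simp add: mv_simps)
      moreover have "u \<in> cvec m" using \<open>mv m e w = u\<close> mv_cvec[OF e(1)] by metis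
      ultimately show thesis using that[of "w - u"] w vs.subspace_diff[OF subspace_cvec] by blast
    qed
  qed
  have w'U: "w' \<notin> U"
  proof
    assume "w' \<in> U"
    then have "w' - (w' - w) \<in> U" using w' subU vs.subspace_diff by blast
    then show False using w by simp
  qed
  have xw': "\<exists>c. mv m x w' - vscale c w' \<in> U" if x: "x \<in> L" for x
  proof -
    obtain c where c: "mv m x w - vscale c w \<in> U" using w(3)[OF x] by blast
    have "mv m x w' - vscale c w' = (mv m x w - vscale c w) + (mv m x (w' - w) - vscale c (w' - w))"
      by (simp add: mv_simps vs.scale_right_diff_distrib)
    also have "\<dots> \<in> U"
      using c stab[OF x w'(2)] w'(2) subU vs.subspace_add vs.subspace_diff vs.subspace_scale by blast
    finally show ?thesis by blast
  qed
  define v' where "v' = v(j := w')"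
  have im: "v' ` {..<i} = v ` {..<i}" if "i \<le> j" for i
    using that by (intro image_cong) (auto simp: v'_def)
  have im2: "v' ` {..i} = v ` {..i}" if "i < j" for i
    using that by (intro image_cong) (auto simp: v'_def)
  have "v' i \<in> cvec m \<and> v' i \<notin> vs.span (v' ` {..<i}) \<and>
    (\<forall>x\<in>L. mv m x (v' i) \<in> vs.span (v' ` {..i})) \<and>
    (e \<in> L \<longrightarrow> mv m e (v' i) = v' i \<or> mv m e (v' i) = 0)" if i: "i < Suc j" for i
  proof (cases "i = j")
    case False
    then have "i < j" using i by simp
    then show ?thesis using v im[of i] im2[of i] False by (simp add: v'_def)
  next
    case True
    have vj: "v' j = w'" by (simp add: v'_def)
    have "mv m x w' \<in> vs.span (v' ` {..j})" if x: "x \<in> L" for x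
    proof -
      obtain c where c: "mv m x w' - vscale c w' \<in> U" using xw'[OF x] by blast
      have "{..j} = insert j {..<j}" by auto
      then have "v' ` {..j} = insert w' (v ` {..<j})" using im[of j] vj by simp
      then show ?thesis using c by (auto simp: vs.span_insert U_def)
    qed
    then show ?thesis using True w' w'U im[of j] vj by (simp add: U_def)
  qed
  then show ?case by blast
qed

definition cols :: "nat \<Rightarrow> (nat \<Rightarrow> nat \<Rightarrow> complex) \<Rightarrow> cmat" where
  "cols m u = (\<lambda>a b. if b < m then u b a else 0)"

lemma indep_indexed:
  fixes u :: "nat \<Rightarrow> nat \<Rightarrow> complex"
  assumes "inj_on u {..<m}" "vs.independent (u ` {..<m})" "(\<Sum>k<m. vscale (c k) (u k)) = 0" "k < m"
  shows "c k = 0"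
proof -
  let ?c = "\<lambda>x. c (the_inv_into {..<m} u x)"
  have i: "the_inv_into {..<m} u (u k) = k" if "k < m" for k
    using assms(1) that by (simp add: the_inv_into_f_f)
  have "(\<Sum>x\<in>u ` {..<m}. vscale (?c x) x) = (\<Sum>k<m. vscale (?c (u k)) (u k))"
    using sum.reindex[OF assms(1), of "\<lambda>x. vscale (?c x) x"] by simp
  also have "\<dots> = (\<Sum>k<m. vscale (c k) (u k))" by (rule sum.cong) (auto simp: i)
  finally have "(\<Sum>x\<in>u ` {..<m}. vscale (?c x) x) = 0" using assms(3) by simp
  then have "?c (u k) = 0"
    using vs.independentD[OF assms(2), of "u ` {..<m}" ?c "u k"] assms(4) by simp
  then show ?thesis using i[OF assms(4)] by simp
qed

text \<open>The columns span, which gives a right inverse \<open>h\<close>. It is also a left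
  inverse: with \<open>g = cols m u\<close>, the equation \<open>g (h g - 1) = 0\<close> makes every
  column of \<open>h g - 1\<close> a linear relation among the independent columns of
  \<open>g\<close>.\<close>

lemma cols_inverse:
  fixes u :: "nat \<Rightarrow> nat \<Rightarrow> complex"
  assumes inj: "inj_on u {..<m}" and ind: "vs.independent (u ` {..<m})" and uv: "\<And>i. i < m \<Longrightarrow> u i \<in> cvec m"
  shows "\<exists>h. inv_pair m (cols m u) h"
proof -
  have sp: "x \<in> vs.span (u ` {..<m})" if x: "x \<in> cvec m" for x
  proof (rule ccontr)
    assume n: "x \<notin> vs.span (u ` {..<m})"
    then have "vs.independent (insert x (u ` {..<m}))" using ind by (rule vs.independent_insertI)
    moreover have "insert x (u ` {..<m}) \<subseteq> cvec m" using x uv by auto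
    ultimately have "card (insert x (u ` {..<m})) \<le> m" using card_indep_cvec by blast
    moreover have "x \<notin> u ` {..<m}" using n vs.span_base[of x "u ` {..<m}"] by metis
    ultimately show False using inj by (simp add: card_image)
  qed
  have "\<exists>c. \<forall>i. ev a i = (\<Sum>b<m. u b i * c b)" if "a < m" for a
  proof -
    have "ev a \<in> vs.span ({0} \<union> u ` {..<m})" using sp[OF ev_cvec[OF that]] by simp
    then obtain c where c: "ev a - (\<Sum>b<m. vscale (c b) (u b)) \<in> {0}"
      using span_Un_sequence[of "{0}"] vs.subspace_single_0 by blast
    have "ev a i = (\<Sum>b<m. u b i * c b)" for i
    proof -
      have "(ev a - (\<Sum>b<m. vscale (c b) (u b))) i = 0" using c by (simp add: fun_apply)
      then show ?thesis by (simp add: fun_apply sum_apply vscale_def mult.commute)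
    qed
    then show ?thesis by blast
  qed
  then obtain c where c: "\<And>a i. a < m \<Longrightarrow> ev a i = (\<Sum>b<m. u b i * c a b)" by metis
  define h :: cmat where "h = (\<lambda>b a. if a < m \<and> b < m then c a b else 0)"
  let ?g = "cols m u"
  have g: "?g \<in> gl m" using uv by (auto simp: cols_def gl_def cvec_def)
  have h: "h \<in> gl m" by (auto simp: h_def gl_def)
  have gh: "mmul m ?g h = idm m"
  proof (intro ext)
    fix i a
    show "mmul m ?g h i a = idm m i a"
    proof (cases "a < m")
      case True
      have "mmul m ?g h i a = (\<Sum>b<m. u b i * c a b)"
        unfolding mmul_def by (rule sum.cong) (auto simp: cols_def h_def True)
      then show ?thesis using c[OF True, of i] True by (auto simp: ev_def idm_def)
    next
      case False
      then show ?thesis by (simp add: mmul_def h_def idm_def)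
    qed
  qed
  define M where "M = mmul m h ?g - idm m"
  have "mmul m ?g M = 0"
    by (simp add: M_def mmul_diff_right mmul_assoc[symmetric] gh idm_left idm_right g)
  then have z: "(\<Sum>k<m. ?g i k * M k b) = 0" for i b
    by (simp add: mmul_def fun_eq_iff fun_apply)
  have Mgl: "M \<in> gl m" using mmul_gl[OF h g] idm_gl cm.subspace_diff[OF subspace_gl] by (simp add: M_def)
  have "M k b = 0" for k b
  proof (cases "k < m")
    case True
    have "(\<Sum>k<m. vscale (M k b) (u k)) i = (\<Sum>k<m. ?g i k * M k b)" for i
      unfolding sum_apply by (rule sum.cong) (auto simp: vscale_def cols_def mult.commute)
    then have "(\<Sum>k<m. vscale (M k b) (u k)) = 0" using z by (simp add: fun_eq_iff fun_apply)
    then show ?thesis using indep_indexed[OF inj ind, of "\<lambda>k. M k b"] True by blast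
  next
    case False
    then show ?thesis using Mgl by (simp add: gl_def)
  qed
  then have "M = 0" by (simp add: fun_eq_iff fun_apply)
  then have "mmul m h ?g = idm m" by (simp add: M_def)
  then show ?thesis using g h gh by (auto simp: inv_pair_def)
qed

lemma mv_cols_ev: "b < m \<Longrightarrow> mv m (cols m u) (ev b) = u b"
  by (simp add: mv_ev cols_def)

lemma cj_cols_tri:
  assumes g: "inv_pair m (cols m u) h" and x: "x \<in> gl m"
    and st: "\<And>b. b < m \<Longrightarrow> mv m x (u b) \<in> vs.span (u ` {a. a < m \<and> s a \<le> s b})"
  shows "cj m h (cols m u) x \<in> tri m s 0"
proof -
  let ?g = "cols m u"
  have hu: "mv m h (u a) = ev a" if "a < m" for a
    using mv_mmul[of m h ?g "ev a"] g that by (simp add: inv_pair_def mv_idm ev_cvec mv_cols_ev)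
  have "s a + 0 \<le> s b" if nz: "cj m h ?g x a b \<noteq> 0" for a b
  proof -
    have b: "b < m" using gl_nonzeroD[OF cj_gl[OF inv_pair_sym[OF g] x] nz] by simp
    let ?S = "{a. a < m \<and> s a \<le> s b}"
    let ?V = "{w. \<forall>a. a \<notin> ?S \<longrightarrow> mv m h w a = 0}"
    have "cj m h ?g x a b = mv m (cj m h ?g x) (ev b) a" using b by (simp add: mv_ev)
    also have "\<dots> = mv m h (mv m x (u b)) a" using b by (simp add: cj_def mv_mmul mv_cols_ev)
    finally have "mv m h (mv m x (u b)) a \<noteq> 0" using nz by simp
    moreover have "vs.span (u ` ?S) \<subseteq> ?V"
    proof (rule vs.span_minimal)
      show "u ` ?S \<subseteq> ?V" by (auto simp: hu ev_def)
      show "vs.subspace ?V"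
        by (rule vs.subspaceI) (auto simp: mv_simps vscale_apply fun_apply)
    qed
    ultimately have "a \<in> ?S" using st[OF b] by blast
    then show ?thesis by simp
  qed
  then show ?thesis using cj_gl[OF inv_pair_sym[OF g] x] by (auto simp: tri_def)
qed

lemma subset_cj_tri:
  assumes g: "inv_pair m (cols m u) h" and L: "L \<subseteq> gl m"
    and st: "\<And>x b. x \<in> L \<Longrightarrow> b < m \<Longrightarrow> mv m x (u b) \<in> vs.span (u ` {a. a < m \<and> s a \<le> s b})"
  shows "L \<subseteq> cj m (cols m u) h ` tri m s 0"
proof
  fix x assume x: "x \<in> L"
  have "cj m h (cols m u) x \<in> tri m s 0" using cj_cols_tri[OF g] x L st by blast
  moreover have "x = cj m (cols m u) h (cj m h (cols m u) x)"
    using cj_inverse[OF inv_pair_sym[OF g]] x L by auto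
  ultimately show "x \<in> cj m (cols m u) h ` tri m s 0" by blast
qed

lemma solvable_subset_conjugate:
  assumes L: "lie_subalg m L" "solvable m L"
  shows "\<exists>g h. inv_pair m g h \<and> L \<subseteq> cj m g h ` tri m (\<lambda>a. a) 0"
proof -
  obtain v :: "nat \<Rightarrow> nat \<Rightarrow> complex" where v: "\<And>i. i < m \<Longrightarrow> v i \<in> cvec m"
    "\<And>i. i < m \<Longrightarrow> v i \<notin> vs.span (v ` {..<i})"
    "\<And>i x. i < m \<Longrightarrow> x \<in> L \<Longrightarrow> mv m x (v i) \<in> vs.span (v ` {..i})"
    \<comment> \<open>With \<open>0\<close> as the idempotent, the eigenvector clause is
      trivial.\<close>
    using flag_exists[OF L cm.subspace_0[OF subspace_gl] mmul_zero_left order_refl] by auto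
  have "vs.independent (v ` {..<m}) \<and> inj_on v {..<m}"
    by (rule indep_chain[of _ _ "{}"]) (simp add: v)
  then obtain h where h: "inv_pair m (cols m v) h" using cols_inverse v(1) by blast
  have "{..i} = {a. a < m \<and> a \<le> i}" if "i < m" for i using that by auto
  then have "L \<subseteq> cj m (cols m v) h ` tri m (\<lambda>a. a) 0"
    using v(3) L by (intro subset_cj_tri[OF h]) (auto simp: lie_subalg_iff)
  then show ?thesis using h by blast
qed

lemma borel_eq_cj_tri:
  assumes b: "borel m b" and g: "inv_pair m g h" and s: "inj_on s {..<m}"
    and sub: "b \<subseteq> cj m g h ` tri m s 0"
  shows "b = cj m g h ` tri m s 0"
  using borelD(6)[OF b _ _ sub] borelD(1,2)[OF borel_cj[OF g borel_tri[OF s]]] by blast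

lemma borel_conjugate:
  assumes b: "borel m b"
  shows "\<exists>g h. inv_pair m g h \<and> b = cj m g h ` tri m (\<lambda>a. a) 0"
  using solvable_subset_conjugate[OF borelD(1,2)[OF b]] borel_eq_cj_tri[OF b] by (metis inj_on_id2)

subsection \<open>The group \<open>K\<close> and its orbits\<close>

text \<open>\<open>K\<close> for size \<open>Suc M\<close>, described as the centraliser of the last
  idempotent, with the inverse as partner. In this form closure under products and inverses is
  formal.\<close>

definition kpair :: "nat \<Rightarrow> cmat \<Rightarrow> cmat \<Rightarrow> bool" where
  "kpair M g h \<longleftrightarrow> inv_pair (Suc M) g h \<and> mmul (Suc M) (eu M M) g = mmul (Suc M) g (eu M M)"

lemma commutes_eu_iff:
  "mmul (Suc M) (eu M M) A = mmul (Suc M) A (eu M M) \<longleftrightarrow> (\<forall>a. a \<noteq> M \<longrightarrow> A a M = 0 \<and> A M a = 0)"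
proof -
  have 1: "mmul (Suc M) (eu M M) A = (\<lambda>i j. if i = M then A M j else 0)" by (rule eu_mmul) auto
  have 2: "mmul (Suc M) A (eu M M) = (\<lambda>i j. if j = M then A i M else 0)" by (rule mmul_eu) auto
  show ?thesis
  proof
    assume *: "mmul (Suc M) (eu M M) A = mmul (Suc M) A (eu M M)"
    show "\<forall>a. a \<noteq> M \<longrightarrow> A a M = 0 \<and> A M a = 0"
    proof (intro allI impI)
      fix a assume "a \<noteq> M"
      then show "A a M = 0 \<and> A M a = 0"
        using fun_cong[OF fun_cong[OF *[unfolded 1 2], of a], of M]
          fun_cong[OF fun_cong[OF *[unfolded 1 2], of M], of a] by simp
    qed
  qed (auto simp: 1 2 fun_eq_iff)
qed

lemma Kgrp_iff: "k \<in> Kgrp (Suc M) \<longleftrightarrow> (\<exists>h. kpair M k h)"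
proof -
  have "blockdiag (Suc M) k \<longleftrightarrow> k \<in> gl (Suc M) \<and> mmul (Suc M) (eu M M) k = mmul (Suc M) k (eu M M)"
  proof -
    have "(\<forall>a<M. k a M = 0 \<and> k M a = 0) \<longleftrightarrow> (\<forall>a. a \<noteq> M \<longrightarrow> k a M = 0 \<and> k M a = 0)" if "k \<in> gl (Suc M)"
      using that unfolding gl_def by (auto simp: Suc_le_eq) (metis linorder_neqE_nat)+
    then show ?thesis unfolding blockdiag_def commutes_eu_iff by auto
  qed
  then show ?thesis by (auto simp: Kgrp_def kpair_def inv_pair_def)
qed

lemma minv_eq: "inv_pair m k h \<Longrightarrow> minv m k = h"
  unfolding minv_def
  by (rule some_equality) (auto simp: inv_pair_def intro: inv_pair_unique[unfolded inv_pair_def])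

lemma K_orbit_eq: "K_orbit (Suc M) b = {cj (Suc M) g h ` b | g h. kpair M g h}"
proof -
  have "(\<lambda>x. mmul (Suc M) (mmul (Suc M) k x) (minv (Suc M) k)) = cj (Suc M) k h" if "kpair M k h" for k h
    using that by (auto simp: cj_def minv_eq kpair_def)
  then show ?thesis unfolding K_orbit_def Kgrp_iff by (safe; metis)
qed

lemma kpairD: "kpair M g h \<Longrightarrow> inv_pair (Suc M) g h"
  by (simp add: kpair_def)

lemma kpair_sym:
  assumes "kpair M g h" shows "kpair M h g"
proof -
  let ?e = "eu M M"
  have e: "?e \<in> gl (Suc M)" by (simp add: eu_gl)
  note i = assms[unfolded kpair_def inv_pair_def]
  have "mmul (Suc M) h ?e = mmul (Suc M) h (mmul (Suc M) ?e (mmul (Suc M) g h))"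
    using i e by (simp add: idm_right)
  also have "\<dots> = mmul (Suc M) h (mmul (Suc M) (mmul (Suc M) ?e g) h)" by (simp add: mmul_assoc)
  also have "\<dots> = mmul (Suc M) h (mmul (Suc M) (mmul (Suc M) g ?e) h)" using i by simp
  also have "\<dots> = mmul (Suc M) (mmul (Suc M) h g) (mmul (Suc M) ?e h)" by (simp only: mmul_assoc)
  also have "\<dots> = mmul (Suc M) ?e h" using i e by (simp add: idm_left mmul_gl)
  finally show ?thesis using i by (simp add: kpair_def inv_pair_def)
qed

lemma kpair_mmul:
  assumes "kpair M g h" "kpair M g' h'"
  shows "kpair M (mmul (Suc M) g g') (mmul (Suc M) h' h)"
  using assms inv_pair_mmul unfolding kpair_def by (metis mmul_assoc)

lemma kpair_idm: "kpair M (idm (Suc M)) (idm (Suc M))"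
  by (simp add: kpair_def inv_pair_idm idm_left idm_right eu_gl)

lemma cj_eu: "kpair M g h \<Longrightarrow> cj (Suc M) g h (eu M M) = eu M M"
  unfolding cj_def kpair_def inv_pair_def
  by (metis eu_gl idm_right lessI mmul_assoc)

lemma K_orbit_self: "b \<subseteq> gl (Suc M) \<Longrightarrow> b \<in> K_orbit (Suc M) b"
proof -
  assume b: "b \<subseteq> gl (Suc M)"
  have "cj (Suc M) (idm (Suc M)) (idm (Suc M)) ` b = b"
    using b by (force simp: cj_idm image_iff)
  then show ?thesis unfolding K_orbit_eq using kpair_idm by blast
qed

lemma K_orbit_cj:
  assumes k: "kpair M k k'" and b: "b \<subseteq> gl (Suc M)"
  shows "K_orbit (Suc M) (cj (Suc M) k k' ` b) = K_orbit (Suc M) b"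
proof -
  have sub: "K_orbit (Suc M) (cj (Suc M) g g' ` c) \<subseteq> K_orbit (Suc M) c" if "kpair M g g'" for g g' c
  proof
    fix c' assume "c' \<in> K_orbit (Suc M) (cj (Suc M) g g' ` c)"
    then obtain a a' where a: "kpair M a a'" "c' = cj (Suc M) a a' ` cj (Suc M) g g' ` c"
      unfolding K_orbit_eq by blast
    then have "c' = cj (Suc M) (mmul (Suc M) a g) (mmul (Suc M) g' a') ` c"
      by (simp add: image_image cj_cj)
    then show "c' \<in> K_orbit (Suc M) c" unfolding K_orbit_eq using kpair_mmul[OF a(1) that] by blast
  qed
  have "K_orbit (Suc M) (cj (Suc M) k' k ` cj (Suc M) k k' ` b) \<subseteq> K_orbit (Suc M) (cj (Suc M) k k' ` b)"
    by (rule sub[OF kpair_sym[OF k]])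
  then show ?thesis
    using sub[OF k, of b] cj_image_inverse[OF kpairD[OF k] b] by simp
qed

text \<open>The last basis vector is inserted at place \<open>k\<close> (counted from
  \<open>0\<close>) while the others keep their order. The algebras
  \<open>tri (Suc M) (pos M k) 0\<close> with \<open>k \<le> M\<close> represent all
  \<open>K\<close>-orbits of Borel subalgebras containing \<open>eu M M\<close>.\<close>

definition pos :: "nat \<Rightarrow> nat \<Rightarrow> nat \<Rightarrow> nat" where
  "pos M k a = (if a = M then k else if a < k then a else Suc a)"

lemma inj_pos: "k \<le> M \<Longrightarrow> inj_on (pos M k) {..<Suc M}"
  by (auto simp: inj_on_def pos_def split: if_splits)

lemma pos_less: "k \<le> M \<Longrightarrow> a < Suc M \<Longrightarrow> pos M k a < Suc M"
  by (auto simp: pos_def)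

lemma pos_surj: "k \<le> M \<Longrightarrow> i < Suc M \<Longrightarrow> \<exists>a<Suc M. pos M k a = i"
proof -
  assume k: "k \<le> M" "i < Suc M"
  show ?thesis
  proof (cases i k rule: linorder_cases)
    case less then show ?thesis using k by (intro exI[of _ i]) (auto simp: pos_def)
  next
    case equal then show ?thesis using k by (intro exI[of _ M]) (auto simp: pos_def)
  next
    case greater then show ?thesis using k by (intro exI[of _ "i - 1"]) (auto simp: pos_def)
  qed
qed

lemma inj_on_pos: "k \<le> M \<Longrightarrow> inj_on (pos M k) {..<M}"
  using inj_pos by (rule inj_on_subset) auto

lemma mv_eu_last: "mv (Suc M) (eu M M) v = (\<lambda>a. if a = M then v M else 0)"
proof -
  have "(\<Sum>k<Suc M. eu M M a k * v k) = (\<Sum>k<Suc M. if k = M then (if a = M then v M else 0) else 0)" for a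
    by (rule sum.cong) (auto simp: eu_def)
  then show ?thesis by (simp add: mv_def)
qed

text \<open>An invariant flag can be spanned by eigenvectors of \<open>eu M M\<close>, each of which
  is a multiple of \<open>ev M\<close> or has last coordinate zero. Exactly one is of the first
  kind, and its place in the flag is \<open>k\<close>.\<close>

lemma solvable_subset_K_conjugate:
  assumes L: "lie_subalg (Suc M) L" "solvable (Suc M) L" and e: "eu M M \<in> L"
  shows "\<exists>k g h. k \<le> M \<and> kpair M g h \<and> L \<subseteq> cj (Suc M) g h ` tri (Suc M) (pos M k) 0"
proof -
  let ?m = "Suc M"
  let ?e = "eu M M"
  obtain v :: "nat \<Rightarrow> nat \<Rightarrow> complex" where v: "\<And>i. i < ?m \<Longrightarrow> v i \<in> cvec ?m"
    "\<And>i. i < ?m \<Longrightarrow> v i \<notin> vs.span (v ` {..<i})"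
    "\<And>i x. i < ?m \<Longrightarrow> x \<in> L \<Longrightarrow> mv ?m x (v i) \<in> vs.span (v ` {..i})"
    "\<And>i. i < ?m \<Longrightarrow> mv ?m ?e (v i) = v i \<or> mv ?m ?e (v i) = 0"
    using flag_exists[OF L, of ?e ?m] e by (auto simp: eu_gl eu_mmul_eu)
  have iv: "vs.independent (v ` {..<?m})" "inj_on v {..<?m}"
    using indep_chain[of ?m v "{}"] v(2) by auto
  have cv: "(\<forall>a. a \<noteq> M \<longrightarrow> v i a = 0) \<or> v i M = 0" if "i < ?m" for i
    using v(4)[OF that] unfolding mv_eu_last by (auto simp: fun_eq_iff fun_apply split: if_splits)
  have nz: "v i \<noteq> 0" if "i < ?m" for i using v(2)[OF that] vs.span_zero by metis
  \<comment> \<open>Otherwise \<open>M + 1\<close> independent vectors would fit into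
    \<open>cvec M\<close>.\<close>
  have "\<exists>i<?m. v i M \<noteq> 0"
  proof (rule ccontr)
    assume "\<not> ?thesis"
    then have "v i \<in> cvec M" if "i < ?m" for i
      using v(1)[OF that] that by (auto simp: cvec_def) (metis le_antisym not_less_eq_eq)
    then have "v ` {..<?m} \<subseteq> cvec M" by blast
    then have "card (v ` {..<?m}) \<le> M" using card_indep_cvec iv by blast
    then show False using iv by (simp add: card_image)
  qed
  then obtain k where k: "k < ?m" "v k M \<noteq> 0" by blast
  have multiple: "v i \<in> vs.span {ev M}" if "i < ?m" "v i M \<noteq> 0" for i
  proof -
    have "v i = vscale (v i M) (ev M)" using cv[OF that(1)] that(2) by (auto simp: vscale_def ev_def fun_eq_iff)
    then show ?thesis by (metis vs.span_base vs.span_scale singletonI)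
  qed
  have uniq: "v i M = 0" if i: "i < ?m" "i \<noteq> k" for i
  proof (rule ccontr)
    assume "v i M \<noteq> 0"
    then have "{v i, v k} \<subseteq> vs.span {ev M}" using multiple i k by blast
    moreover have "vs.independent {v i, v k}" using vs.independent_mono[OF iv(1)] i k by auto
    ultimately have "card {v i, v k} \<le> card {ev M}" using vs.independent_span_bound[of "{ev M}"] by blast
    moreover have "v i \<noteq> v k" using iv(2) i k by (auto simp: inj_on_def)
    ultimately show False by simp
  qed
  have kM: "k \<le> M" using k by simp
  \<comment> \<open>Column \<open>M\<close> receives the multiple of \<open>ev M\<close>, and all
    other columns vanish in row \<open>M\<close>; this makes \<open>cols ?m u\<close> block
    diagonal.\<close>
  define u where "u a = v (pos M k a)" for a
  have uimg: "u ` {a. a < ?m \<and> pos M k a \<le> pos M k b} = v ` {..pos M k b}" if "b < ?m" for b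
  proof -
    have "pos M k ` {a. a < ?m \<and> pos M k a \<le> pos M k b} = {..pos M k b}"
      using pos_surj[OF kM] pos_less[OF kM that] by (auto simp: image_iff) (metis le_less_trans)
    then show ?thesis unfolding u_def by (metis image_image)
  qed
  have pimg: "pos M k ` {..<?m} = {..<?m}"
    using pos_surj[OF kM] pos_less[OF kM] by (fastforce simp: image_iff)
  then have uall: "u ` {..<?m} = v ` {..<?m}" unfolding u_def by (metis image_image)
  have inju: "inj_on u {..<?m}"
  proof -
    have "u = v \<circ> pos M k" by (simp add: u_def fun_eq_iff)
    then show ?thesis using comp_inj_on[OF inj_pos[OF kM], of v] iv(2) pimg by simp
  qed
  obtain h where h: "inv_pair ?m (cols ?m u) h"
    using cols_inverse[OF inju] uall iv(1) v(1) pos_less[OF kM] by (auto simp: u_def)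
  have "L \<subseteq> cj ?m (cols ?m u) h ` tri ?m (pos M k) 0"
  proof (rule subset_cj_tri[OF h])
    show "L \<subseteq> gl ?m" using L by (simp add: lie_subalg_iff)
    fix x b assume "x \<in> L" "b < ?m"
    then show "mv ?m x (u b) \<in> vs.span (u ` {a. a < ?m \<and> pos M k a \<le> pos M k b})"
      using v(3)[OF pos_less[OF kM]] uimg by (simp add: u_def)
  qed
  moreover have "cols ?m u a M = 0 \<and> cols ?m u M a = 0" if "a \<noteq> M" for a
  proof
    have "u M = v k" by (simp add: u_def pos_def)
    then show "cols ?m u a M = 0" using cv[OF k(1)] k(2) that by (simp add: cols_def)
    have "pos M k a \<noteq> k" using that by (auto simp: pos_def)
    then show "cols ?m u M a = 0" using uniq pos_less[OF kM] by (auto simp: cols_def u_def)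
  qed
  ultimately show ?thesis using h kM unfolding kpair_def commutes_eu_iff by blast
qed

lemma borel_K_conjugate:
  assumes b: "borel (Suc M) b" and e: "eu M M \<in> b"
  obtains k g h where "k \<le> M" "kpair M g h" "b = cj (Suc M) g h ` tri (Suc M) (pos M k) 0"
proof -
  obtain k g h where k: "k \<le> M" "kpair M g h" "b \<subseteq> cj (Suc M) g h ` tri (Suc M) (pos M k) 0"
    using solvable_subset_K_conjugate[OF borelD(1,2)[OF b] e] by blast
  then show thesis using that borel_eq_cj_tri[OF b kpairD[OF k(2)] inj_pos[OF k(1)]] by blast
qed

subsection \<open>Projection to the next smaller general linear algebra\<close>

lemma proj_gl: "proj M x \<in> gl M"
  by (auto simp: proj_def gl_def)

lemma proj_id: "x \<in> gl M \<Longrightarrow> proj M x = x"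
  by (auto simp: proj_def gl_def fun_eq_iff)

lemma gl_Suc: "gl M \<subseteq> gl (Suc M)"
  by (auto simp: gl_def)

text \<open>Cutting down to the corner loses only the term \<open>x a M * y M b\<close> of the
  product, and the hypothesis makes it vanish.\<close>

lemma proj_mmul:
  assumes "(\<forall>a. a \<noteq> M \<longrightarrow> x a M = 0) \<or> (\<forall>b. b \<noteq> M \<longrightarrow> y M b = 0)"
  shows "proj M (mmul (Suc M) x y) = mmul M (proj M x) (proj M y)"
proof (intro ext)
  fix a b
  show "proj M (mmul (Suc M) x y) a b = mmul M (proj M x) (proj M y) a b"
  proof (cases "a < M \<and> b < M")
    case True
    then have "x a M * y M b = 0" using assms by auto
    then show ?thesis using True by (simp add: proj_def mmul_def)
  next
    case False
    then show ?thesis by (auto simp: proj_def mmul_def)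
  qed
qed

lemma kpair_entries:
  assumes "kpair M g h" "a \<noteq> M"
  shows "g a M = 0" "g M a = 0" "h a M = 0" "h M a = 0"
  using assms kpair_sym[OF assms(1)] unfolding kpair_def commutes_eu_iff by blast+

lemma inv_pair_proj:
  assumes k: "kpair M g h"
  shows "inv_pair M (proj M g) (proj M h)"
proof -
  have "proj M (idm (Suc M)) = idm M" by (auto simp: proj_def idm_def fun_eq_iff)
  then show ?thesis
    using k proj_mmul[of M g h] proj_mmul[of M h g] kpair_entries[OF k]
    by (auto simp: inv_pair_def kpair_def proj_gl)
qed

lemma proj_cj:
  assumes k: "kpair M g h"
  shows "proj M (cj (Suc M) g h x) = cj M (proj M g) (proj M h) (proj M x)"
  using kpair_entries[OF k] by (simp add: cj_def proj_mmul)

lemma cj_gl_block: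
  assumes k: "kpair M g h" and x: "x \<in> gl M"
  shows "cj (Suc M) g h x \<in> gl M"
proof -
  have "a < M \<and> b < M" if nz: "cj (Suc M) g h x a b \<noteq> 0" for a b
  proof -
    obtain j where j: "mmul (Suc M) g x a j \<noteq> 0" "h j b \<noteq> 0"
      using mmul_nonzeroD nz unfolding cj_def by blast
    obtain i where i: "g a i \<noteq> 0" "x i j \<noteq> 0" using mmul_nonzeroD[OF j(1)] by blast
    have ij: "i < M" "j < M" using gl_nonzeroD[OF x i(2)] by auto
    have "x \<in> gl (Suc M)" using x gl_Suc by blast
    then have "a < Suc M" "b < Suc M"
      using gl_nonzeroD[OF cj_gl[OF kpairD[OF k]] nz] by blast+
    moreover have "a \<noteq> M" "b \<noteq> M" using kpair_entries[OF k] i(1) j(2) ij by auto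
    ultimately show ?thesis by simp
  qed
  then show ?thesis by (rule glI)
qed

lemma cj_block:
  assumes k: "kpair M g h" and x: "x \<in> gl M"
  shows "cj (Suc M) g h x = cj M (proj M g) (proj M h) x"
  using proj_cj[OF k, of x] proj_id[OF x] proj_id[OF cj_gl_block[OF k x]] by simp

lemma tri_Suc: "tri M s j \<subseteq> tri (Suc M) s j"
  using gl_Suc by (auto simp: tri_def)

lemma proj_tri_mem:
  assumes "x \<in> tri (Suc M) s j" shows "proj M x \<in> tri M s j"
proof -
  have "s a + j \<le> s b" if "proj M x a b \<noteq> 0" for a b
    using assms that by (auto simp: proj_def tri_def split: if_splits)
  then show ?thesis using proj_gl by (auto simp: tri_def)
qed

lemma proj_tri: "proj M ` tri (Suc M) s j = tri M s j"
proof
  show "proj M ` tri (Suc M) s j \<subseteq> tri M s j" using proj_tri_mem by blast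
  show "tri M s j \<subseteq> proj M ` tri (Suc M) s j"
  proof
    fix x assume x: "x \<in> tri M s j"
    then have "proj M x = x" using tri_gl by (intro proj_id) blast
    then show "x \<in> proj M ` tri (Suc M) s j" using x tri_Suc by force
  qed
qed

lemma proj_cj_tri:
  assumes "kpair M g h"
  shows "proj M ` cj (Suc M) g h ` tri (Suc M) s 0 = cj M (proj M g) (proj M h) ` tri M s 0"
proof -
  have "proj M ` cj (Suc M) g h ` tri (Suc M) s 0 = cj M (proj M g) (proj M h) ` proj M ` tri (Suc M) s 0"
    by (simp add: image_image proj_cj[OF assms])
  then show ?thesis by (simp add: proj_tri)
qed

lemma eu_mem_cj_tri: "kpair M g h \<Longrightarrow> eu M M \<in> cj (Suc M) g h ` tri (Suc M) s 0"
proof -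
  assume k: "kpair M g h"
  have "eu M M \<in> tri (Suc M) s 0" by (simp add: eu_tri)
  then have "cj (Suc M) g h (eu M M) \<in> cj (Suc M) g h ` tri (Suc M) s 0" by (rule imageI)
  then show ?thesis unfolding cj_eu[OF k] .
qed

lemma cj_mem_tri:
  "inv_pair m g h \<Longrightarrow> g \<in> tri m s 0 \<Longrightarrow> h \<in> tri m s 0 \<Longrightarrow> x \<in> tri m s 0 \<Longrightarrow> cj m g h x \<in> tri m s 0"
  using mmul_tri[OF mmul_tri, of g m s 0 x 0 h 0] by (simp add: cj_def)

lemma normalizer_tri:
  assumes s: "inj_on s {..<m}" and p: "inv_pair m p p'" and eq: "cj m p p' ` tri m s 0 = tri m s 0"
  shows "p \<in> tri m s 0"
proof (rule tri_normalizer[OF s])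
  show "p \<in> gl m" using p by (simp add: inv_pair_def)
  fix x assume "x \<in> tri m s 0"
  then obtain y where y: "y \<in> tri m s 0" "x = cj m p p' y" using eq by blast
  have "mmul m x p = mmul m (mmul m p y) (mmul m p' p)" by (simp add: y cj_def mmul_assoc)
  also have "\<dots> = mmul m p y"
    using p y tri_gl[of m s 0] by (auto simp: inv_pair_def idm_right mmul_gl)
  finally show "\<exists>y\<in>tri m s 0. mmul m x p = mmul m p y" using y by blast
qed

lemma mem_tri_of_proj:
  assumes "\<forall>a. a \<noteq> M \<longrightarrow> q a M = 0 \<and> q M a = 0" "q \<in> gl (Suc M)" "proj M q \<in> tri M s 0"
  shows "q \<in> tri (Suc M) s 0"
proof -
  have "s a + 0 \<le> s b" if nz: "q a b \<noteq> 0" for a b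
  proof (cases "a < M \<and> b < M")
    case True
    then have "proj M q a b \<noteq> 0" using nz by (simp add: proj_def)
    then show ?thesis using assms(3) by (auto simp: tri_def)
  next
    case False
    then have "a = M \<or> b = M" using gl_nonzeroD[OF assms(2) nz] by auto
    then have "a = b" using assms(1) nz by metis
    then show ?thesis by simp
  qed
  then show ?thesis using assms(2) by (simp add: tri_def)
qed

text \<open>The corner of \<open>h1 g2\<close> normalises the smaller triangular algebra and hence
  lies in it. As \<open>h1 g2\<close> is block diagonal, it lies in the large triangular algebra,
  and so does its inverse. Conjugation by it thus maps that algebra into itself, and maximality
  turns the resulting inclusion into equality.\<close>

lemma proj_inj_on_orbit:
  assumes k: "k \<le> M" and g: "kpair M g1 h1" "kpair M g2 h2"
    and eq: "proj M ` cj (Suc M) g1 h1 ` tri (Suc M) (pos M k) 0 = proj M ` cj (Suc M) g2 h2 ` tri (Suc M) (pos M k) 0"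
  shows "cj (Suc M) g1 h1 ` tri (Suc M) (pos M k) 0 = cj (Suc M) g2 h2 ` tri (Suc M) (pos M k) 0"
proof -
  let ?T = "tri (Suc M) (pos M k) 0"
  let ?T' = "tri M (pos M k) 0"
  have mem: "mmul (Suc M) h1 g2 \<in> ?T"
    if g: "kpair M g1 h1" "kpair M g2 h2" and eq: "proj M ` cj (Suc M) g1 h1 ` ?T = proj M ` cj (Suc M) g2 h2 ` ?T"
    for g1 h1 g2 h2
  proof (rule mem_tri_of_proj)
    have q: "kpair M (mmul (Suc M) h1 g2) (mmul (Suc M) h2 g1)" using kpair_mmul[OF kpair_sym[OF g(1)] g(2)] .
    show "\<forall>a. a \<noteq> M \<longrightarrow> mmul (Suc M) h1 g2 a M = 0 \<and> mmul (Suc M) h1 g2 M a = 0"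
      using kpair_entries[OF q] by blast
    show "mmul (Suc M) h1 g2 \<in> gl (Suc M)" using q by (simp add: kpair_def inv_pair_def)
    show "proj M (mmul (Suc M) h1 g2) \<in> ?T'"
    proof (rule normalizer_tri[OF inj_on_pos[OF k] inv_pair_proj[OF q]])
      have p: "proj M (mmul (Suc M) h1 g2) = mmul M (proj M h1) (proj M g2)"
        "proj M (mmul (Suc M) h2 g1) = mmul M (proj M h2) (proj M g1)"
        using kpair_entries[OF g(1)] kpair_entries[OF g(2)] by (simp_all add: proj_mmul)
      have "cj M (proj M (mmul (Suc M) h1 g2)) (proj M (mmul (Suc M) h2 g1)) ` ?T'
          = cj M (proj M h1) (proj M g1) ` cj M (proj M g2) (proj M h2) ` ?T'"
        by (simp add: image_image cj_cj p)
      also have "cj M (proj M g2) (proj M h2) ` ?T' = cj M (proj M g1) (proj M h1) ` ?T'"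
        using eq g by (simp add: proj_cj_tri)
      also have "cj M (proj M h1) (proj M g1) ` \<dots> = ?T'"
        by (rule cj_image_inverse[OF inv_pair_proj[OF g(1)] tri_gl])
      finally show "cj M (proj M (mmul (Suc M) h1 g2)) (proj M (mmul (Suc M) h2 g1)) ` ?T' = ?T'" .
    qed
  qed
  let ?q = "mmul (Suc M) h1 g2" and ?q' = "mmul (Suc M) h2 g1"
  have q: "?q \<in> ?T" "?q' \<in> ?T" using mem[OF g eq] mem[OF g(2,1) eq[symmetric]] by auto
  have qp: "inv_pair (Suc M) ?q ?q'"
    using inv_pair_mmul[OF inv_pair_sym[OF kpairD[OF g(1)]] kpairD[OF g(2)]] .
  have "cj (Suc M) ?q ?q' ` ?T \<subseteq> ?T" using cj_mem_tri[OF qp q] by blast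
  then have "cj (Suc M) g1 h1 ` cj (Suc M) ?q ?q' ` ?T \<subseteq> cj (Suc M) g1 h1 ` ?T" by blast
  moreover have "cj (Suc M) g1 h1 ` cj (Suc M) ?q ?q' ` ?T = cj (Suc M) g2 h2 ` ?T"
  proof -
    have "cj (Suc M) ?q ?q' ` ?T = cj (Suc M) h1 g1 ` cj (Suc M) g2 h2 ` ?T"
      by (simp add: image_image cj_cj)
    then show ?thesis
      using cj_image_inverse[OF inv_pair_sym[OF kpairD[OF g(1)]] cj_image_gl[OF kpairD[OF g(2)] tri_gl]] by simp
  qed
  ultimately have "cj (Suc M) g2 h2 ` ?T \<subseteq> cj (Suc M) g1 h1 ` ?T" by simp
  moreover have bb: "borel (Suc M) (cj (Suc M) g' h' ` ?T)" if "kpair M g' h'" for g' h'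
    using borel_cj[OF kpairD[OF that] borel_tri[OF inj_pos[OF k]]] .
  ultimately show ?thesis using borelD(6)[OF bb[OF g(2)] borelD(1,2)[OF bb[OF g(1)]]] by blast
qed

text \<open>The embedding of \<open>GL(M)\<close> into \<open>K\<close> with \<open>1\<close> in the
  last diagonal place.\<close>

lemma kpair_extend:
  assumes r: "inv_pair M r r'"
  shows "kpair M (r + eu M M) (r' + eu M M)" "proj M (r + eu M M) = r"
proof -
  have "mmul (Suc M) (x + eu M M) (y + eu M M) = idm (Suc M)" if "x \<in> gl M" "y \<in> gl M" "mmul M x y = idm M" for x y
  proof -
    have "mmul (Suc M) x y = mmul M x y" using that(1) by (simp add: mmul_def gl_def fun_eq_iff)
    moreover have "mmul (Suc M) x (eu M M) = 0" "mmul (Suc M) (eu M M) y = 0"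
      using that by (auto simp: mmul_eu eu_mmul gl_def fun_eq_iff fun_apply)
    moreover have "idm M + eu M M = idm (Suc M)" by (auto simp: idm_def eu_def fun_eq_iff fun_apply)
    ultimately show ?thesis using that by (simp add: mmul_add_left mmul_add_right eu_mmul_eu)
  qed
  moreover have "x + eu M M \<in> gl (Suc M)" if "x \<in> gl M" for x
    using that gl_Suc eu_gl[of M "Suc M" M] cm.subspace_add[OF subspace_gl] by blast
  ultimately show "kpair M (r + eu M M) (r' + eu M M)"
    using r unfolding kpair_def commutes_eu_iff inv_pair_def by (auto simp: gl_def eu_def fun_apply)
  show "proj M (r + eu M M) = r"
    using r by (auto simp: proj_def gl_def eu_def fun_eq_iff fun_apply inv_pair_def)
qed

lemma K_orbit_elem:
  assumes b: "borel (Suc M) b" "eu M M \<in> b"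
  obtains k where "k \<le> M" "K_orbit (Suc M) b = {cj (Suc M) g h ` tri (Suc M) (pos M k) 0 | g h. kpair M g h}"
proof -
  obtain k g h where k: "k \<le> M" "kpair M g h" "b = cj (Suc M) g h ` tri (Suc M) (pos M k) 0"
    using borel_K_conjugate[OF b] .
  then show thesis using that[OF k(1)] K_orbit_cj[OF k(2) tri_gl] by (simp add: K_orbit_eq)
qed

text \<open>On the corner, \<open>K\<close> acts through its \<open>GL(M)\<close> block, so
  surjectivity onto the Borel subalgebras of \<open>gl M\<close> is transitivity of
  \<open>GL(M)\<close>. The inclusion of the projection in \<open>b'\<close> later carries diagonal
  matrices up from the corner.\<close>

lemma proj_orbit:
  assumes b: "borel (Suc M) b" "eu M M \<in> b"
  shows "\<And>b'. b' \<in> K_orbit (Suc M) b \<Longrightarrow>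
      borel (Suc M) b' \<and> borel M (proj M ` b') \<and> proj M ` b' \<subseteq> b' \<and> eu M M \<in> b'"
    and "inj_on (\<lambda>b'. proj M ` b') (K_orbit (Suc M) b)"
    and "\<And>c. borel M c \<Longrightarrow> \<exists>b'\<in>K_orbit (Suc M) b. proj M ` b' = c"
proof -
  obtain k where k: "k \<le> M"
    and orb: "K_orbit (Suc M) b = {cj (Suc M) g h ` tri (Suc M) (pos M k) 0 | g h. kpair M g h}"
    using K_orbit_elem[OF b] .
  let ?T = "tri (Suc M) (pos M k) 0"
  let ?T' = "tri M (pos M k) 0"
  have bT': "borel M ?T'" using borel_tri[OF inj_on_pos[OF k]] .
  show "borel (Suc M) b' \<and> borel M (proj M ` b') \<and> proj M ` b' \<subseteq> b' \<and> eu M M \<in> b'"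
    if b': "b' \<in> K_orbit (Suc M) b" for b'
  proof -
    obtain g h where g: "kpair M g h" "b' = cj (Suc M) g h ` ?T" using b' orb by blast
    have p: "proj M ` b' = cj M (proj M g) (proj M h) ` ?T'" using proj_cj_tri[OF g(1)] g(2) by simp
    have "cj M (proj M g) (proj M h) x = cj (Suc M) g h x" if "x \<in> ?T'" for x
      using cj_block[OF g(1), of x] that tri_gl by fastforce
    then have "cj M (proj M g) (proj M h) ` ?T' = cj (Suc M) g h ` ?T'" by (intro image_cong) auto
    also have "\<dots> \<subseteq> b'" unfolding g(2) by (rule image_mono[OF tri_Suc])
    finally have "proj M ` b' \<subseteq> b'" unfolding p .
    then show ?thesis
      using g p borel_cj[OF kpairD[OF g(1)] borel_tri[OF inj_pos[OF k]]] borel_cj[OF inv_pair_proj[OF g(1)] bT']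
        eu_mem_cj_tri[OF g(1)] by simp
  qed
  show "inj_on (\<lambda>b'. proj M ` b') (K_orbit (Suc M) b)"
    unfolding orb by (rule inj_onI) (use proj_inj_on_orbit[OF k] in blast)
  show "\<exists>b'\<in>K_orbit (Suc M) b. proj M ` b' = c" if c: "borel M c" for c
  proof -
    obtain a a' where a: "inv_pair M a a'" "c = cj M a a' ` tri M (\<lambda>a. a) 0"
      using borel_conjugate[OF c] by blast
    obtain d d' where d: "inv_pair M d d'" "?T' = cj M d d' ` tri M (\<lambda>a. a) 0"
      using borel_conjugate[OF bT'] by blast
    have r: "inv_pair M (mmul M a d') (mmul M d a')" using inv_pair_mmul[OF a(1) inv_pair_sym[OF d(1)]] .
    have "cj M (mmul M a d') (mmul M d a') ` ?T' = cj M a a' ` cj M d' d ` cj M d d' ` tri M (\<lambda>a. a) 0"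
      unfolding d(2) by (simp add: image_image cj_cj mmul_assoc)
    also have "\<dots> = c" using cj_image_inverse[OF d(1) tri_gl] a(2) by simp
    finally have rc: "cj M (mmul M a d') (mmul M d a') ` ?T' = c" .
    note e = kpair_extend[OF r] kpair_extend(2)[OF inv_pair_sym[OF r]]
    have "proj M ` cj (Suc M) (mmul M a d' + eu M M) (mmul M d a' + eu M M) ` ?T = c"
      using proj_cj_tri[OF e(1)] e rc by simp
    then show ?thesis unfolding orb using e(1) by blast
  qed
qed

subsection \<open>Tuples of matrices\<close>

lemma lin_indep_tup_sum:
  "lin_indep_tup d xs \<longleftrightarrow> (\<forall>c. (\<Sum>k<d. msmult (c k) (xs k)) = 0 \<longrightarrow> (\<forall>k<d. c k = 0))"
proof -
  have "(\<lambda>a b. \<Sum>k<d. c k * xs k a b) = (\<Sum>k<d. msmult (c k) (xs k))" for c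
    by (simp add: fun_eq_iff sum_apply msmult_def)
  then show ?thesis unfolding lin_indep_tup_def mzero_eq by simp
qed

lemma sum_msmult_delta:
  fixes xs :: "nat \<Rightarrow> cmat"
  shows "i < d \<Longrightarrow> (\<Sum>k<d. msmult (if k = i then 1 else 0) (xs k)) = xs i"
proof -
  assume i: "i < d"
  have "(\<Sum>k<d. msmult (if k = i then 1 else 0) (xs k)) = (\<Sum>k<d. if k = i then xs i else 0)"
    by (rule sum.cong) auto
  then show ?thesis using i by simp
qed

lemma sum_image_the_inv:
  fixes xs :: "nat \<Rightarrow> cmat"
  assumes "inj_on xs A"
  shows "(\<Sum>x\<in>xs ` A. msmult (c (the_inv_into A xs x)) x) = (\<Sum>k\<in>A. msmult (c k) (xs k))"
proof -
  have "(\<Sum>x\<in>xs ` A. msmult (c (the_inv_into A xs x)) x)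
      = (\<Sum>k\<in>A. msmult (c (the_inv_into A xs (xs k))) (xs k))"
    by (simp add: sum.reindex[OF assms])
  also have "\<dots> = (\<Sum>k\<in>A. msmult (c k) (xs k))"
    by (rule sum.cong) (auto simp: the_inv_into_f_f[OF assms])
  finally show ?thesis .
qed

text \<open>A tuple may repeat a vector, which the image set hides; hence the injectivity.\<close>

lemma lin_indep_tup_iff:
  "lin_indep_tup d xs \<longleftrightarrow> inj_on xs {..<d} \<and> cm.independent (xs ` {..<d})"
proof
  assume L: "lin_indep_tup d xs"
  have inj: "inj_on xs {..<d}"
  proof (rule inj_onI, rule ccontr)
    fix i j assume ij: "i \<in> {..<d}" "j \<in> {..<d}" "xs i = xs j" "i \<noteq> j"
    define c :: "nat \<Rightarrow> complex" where "c k = (if k = i then 1 else 0) - (if k = j then 1 else 0)" for k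
    have "(\<Sum>k<d. msmult (c k) (xs k)) = xs i - xs j"
      using ij by (simp add: c_def cm.scale_left_diff_distrib sum_subtractf sum_msmult_delta)
    then have "c i = 0" using L ij unfolding lin_indep_tup_sum by auto
    then show False using ij by (simp add: c_def)
  qed
  moreover have "cm.independent (xs ` {..<d})"
  proof
    assume "cm.dependent (xs ` {..<d})"
    then obtain u where u: "\<exists>v\<in>xs ` {..<d}. u v \<noteq> 0" "(\<Sum>v\<in>xs ` {..<d}. msmult (u v) v) = 0"
      using cm.dependent_finite[of "xs ` {..<d}"] by auto
    have "(\<Sum>k<d. msmult (u (xs k)) (xs k)) = 0" using u(2) by (simp add: sum.reindex[OF inj])
    then have "\<forall>k<d. u (xs k) = 0" using L[unfolded lin_indep_tup_sum, rule_format, of "\<lambda>k. u (xs k)"] by blast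
    then show False using u(1) by auto
  qed
  ultimately show "inj_on xs {..<d} \<and> cm.independent (xs ` {..<d})" by blast
next
  assume I: "inj_on xs {..<d} \<and> cm.independent (xs ` {..<d})"
  show "lin_indep_tup d xs"
    unfolding lin_indep_tup_sum
  proof (intro allI impI)
    fix c k assume c: "(\<Sum>k<d. msmult (c k) (xs k)) = 0" and k: "k < d"
    let ?u = "\<lambda>x. c (the_inv_into {..<d} xs x)"
    have "(\<Sum>x\<in>xs ` {..<d}. msmult (?u x) x) = 0" using sum_image_the_inv[of xs "{..<d}" c] I c by simp
    then have "?u (xs k) = 0"
      using cm.independentD[of "xs ` {..<d}" "xs ` {..<d}" ?u "xs k"] I k by simp
    then show "c k = 0" using I k by (simp add: the_inv_into_f_f)
  qed
qed

lemma span_image_sum: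
  fixes xs :: "nat \<Rightarrow> cmat"
  assumes "finite A" "x \<in> cm.span (xs ` A)"
  shows "\<exists>c. x = (\<Sum>k\<in>A. msmult (c k) (xs k))"
  using assms
proof (induction A arbitrary: x)
  case empty
  then show ?case by simp
next
  case (insert i A)
  then obtain l where "x - msmult l (xs i) \<in> cm.span (xs ` A)" by (auto simp: cm.span_insert)
  from insert.IH[OF this] obtain c where c: "x - msmult l (xs i) = (\<Sum>k\<in>A. msmult (c k) (xs k))" by blast
  have "(\<Sum>k\<in>A. msmult ((c(i := l)) k) (xs k)) = (\<Sum>k\<in>A. msmult (c k) (xs k))"
    using insert.hyps by (intro sum.cong) auto
  then have "(\<Sum>k\<in>insert i A. msmult ((c(i := l)) k) (xs k)) = msmult l (xs i) + (x - msmult l (xs i))"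
    using insert.hyps c by simp
  then have "x = (\<Sum>k\<in>insert i A. msmult ((c(i := l)) k) (xs k))" by simp
  then show ?case by blast
qed

subsection \<open>Degeneration along the one-parameter group \<open>diag(1, \<dots>, 1, t)\<close>\<close>

definition dg :: "nat \<Rightarrow> complex \<Rightarrow> cmat" where
  "dg M t = (\<lambda>a b. if a = b \<and> a < Suc M then (if a = M then t else 1) else 0)"

text \<open>The exponent of \<open>t\<close> by which conjugation with \<open>dg M t\<close> scales
  an entry, raised by one to be a natural number.\<close>

definition wt :: "nat \<Rightarrow> nat \<Rightarrow> nat \<Rightarrow> nat" where
  "wt M a b = (if a = M \<and> b \<noteq> M then 2 else if a \<noteq> M \<and> b = M then 0 else 1)"

lemma dg_gl: "dg M t \<in> gl (Suc M)"
  by (auto simp: dg_def gl_def)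

lemma dg_mmul: "mmul (Suc M) (dg M t) A = (\<lambda>a b. if a < Suc M then (if a = M then t else 1) * A a b else 0)"
proof -
  have "(\<Sum>k<Suc M. dg M t a k * A k b)
      = (\<Sum>k<Suc M. if k = a then (if a < Suc M then (if a = M then t else 1) * A a b else 0) else 0)" for a b
    by (rule sum.cong) (auto simp: dg_def)
  then show ?thesis unfolding mmul_def by (auto simp: fun_eq_iff simp del: sum.lessThan_Suc)
qed

lemma mmul_dg: "mmul (Suc M) A (dg M t) = (\<lambda>a b. if b < Suc M then (if b = M then t else 1) * A a b else 0)"
proof -
  have "(\<Sum>k<Suc M. A a k * dg M t k b)
      = (\<Sum>k<Suc M. if k = b then (if b < Suc M then (if b = M then t else 1) * A a b else 0) else 0)" for a b
    by (rule sum.cong) (auto simp: dg_def)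
  then show ?thesis unfolding mmul_def by (auto simp: fun_eq_iff simp del: sum.lessThan_Suc)
qed

lemma kpair_dg:
  assumes t: "t \<noteq> 0" shows "kpair M (dg M t) (dg M (inverse t))"
proof -
  have "mmul (Suc M) (dg M t) (dg M (inverse t)) = idm (Suc M)" if "t \<noteq> 0" for t
    unfolding dg_mmul using that by (auto simp: dg_def idm_def fun_eq_iff)
  from this[OF t] this[of "inverse t"] t
  have "inv_pair (Suc M) (dg M t) (dg M (inverse t))" by (simp add: inv_pair_def dg_gl)
  then show ?thesis unfolding kpair_def commutes_eu_iff by (auto simp: dg_def)
qed

lemma cj_dg:
  assumes "x \<in> gl (Suc M)" "t \<noteq> 0"
  shows "t * cj (Suc M) (dg M t) (dg M (inverse t)) x a b = t ^ wt M a b * x a b"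
proof (cases "a < Suc M \<and> b < Suc M")
  case True
  then show ?thesis using assms(2)
    by (auto simp: cj_def dg_mmul mmul_dg wt_def power2_eq_square)
next
  case False
  then have "x a b = 0" using gl_nonzeroD[OF assms(1)] by blast
  then show ?thesis by (auto simp: cj_def dg_mmul mmul_dg)
qed

text \<open>Matrices whose expansion in \<open>t\<close> under this conjugation starts at order
  \<open>r\<close> or later, in the shifted count.\<close>

definition filt :: "nat \<Rightarrow> nat \<Rightarrow> cmat set" where
  "filt M r = {x. \<forall>a b. wt M a b < r \<longrightarrow> x a b = 0}"

text \<open>The natural subtraction in the exponent is harmless: \<open>x a b = 0\<close> for \<open>x \<in> filt M r\<close>
  and \<open>wt M a b < r\<close>.\<close>

definition curve :: "nat \<Rightarrow> nat \<Rightarrow> complex \<Rightarrow> cmat \<Rightarrow> cmat" where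
  "curve M r t x = (\<lambda>a b. t ^ (wt M a b - r) * x a b)"

lemma subspace_filt: "cm.subspace (filt M r)"
  by (auto simp: cm.subspace_def filt_def msmult_def fun_apply)

lemma filt_3: "3 \<le> r \<Longrightarrow> filt M r \<subseteq> {0}"
proof
  fix x assume r: "3 \<le> r" and x: "x \<in> filt M r"
  have "wt M a b < r" for a b using r by (simp add: wt_def)
  then show "x \<in> {0}" using x by (simp add: filt_def fun_eq_iff fun_apply)
qed

text \<open>For nonzero \<open>t\<close> the curve is a nonzero multiple of a conjugate of
  \<open>x\<close>, although unlike the conjugate it extends to \<open>t = 0\<close>.\<close>

lemma curve_eq:
  assumes "x \<in> gl (Suc M)" "x \<in> filt M r" "t \<noteq> 0"
  shows "msmult (t ^ r) (curve M r t x) = msmult t (cj (Suc M) (dg M t) (dg M (inverse t)) x)"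
proof (intro ext)
  fix a b
  have "t ^ r * (t ^ (wt M a b - r) * x a b) = t ^ wt M a b * x a b"
  proof (cases "wt M a b < r")
    case True
    then show ?thesis using assms(2) by (simp add: filt_def)
  next
    case False
    then show ?thesis by (simp add: power_add[symmetric])
  qed
  then show "msmult (t ^ r) (curve M r t x) a b = msmult t (cj (Suc M) (dg M t) (dg M (inverse t)) x) a b"
    using cj_dg[OF assms(1,3)] by (simp add: msmult_def curve_def)
qed

lemma curve_0:
  assumes "x \<in> filt M r"
  shows "curve M r 0 x a b = (if wt M a b = r then x a b else 0)"
proof (cases "wt M a b" r rule: linorder_cases)
  case less
  then show ?thesis using assms by (simp add: curve_def filt_def)
next
  case equal
  then show ?thesis by (simp add: curve_def)
next
  case greater
  then have "0 < wt M a b - r" by simp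
  then show ?thesis using greater by (simp add: curve_def zero_power)
qed

text \<open>A basis of \<open>b\<close> obtained by extending successively from weight at least
  \<open>2\<close> to weight at least \<open>1\<close> to everything. Its purpose is that the
  leading components remain independent.\<close>

lemma adapted_basis:
  assumes b: "cm.subspace b" "b \<subseteq> gl m"
  shows "\<exists>d xs rk. lin_indep_tup d xs \<and> cm.span (xs ` {..<d}) = b \<and>
    (\<forall>k<d. xs k \<in> b \<and> xs k \<in> filt M (rk k)) \<and>
    (\<forall>s. b \<inter> filt M s \<subseteq> cm.span (xs ` {k. k < d \<and> s \<le> rk k}))"
proof -
  obtain B2 where B2: "B2 \<subseteq> b \<inter> filt M 2" "cm.independent B2" "b \<inter> filt M 2 \<subseteq> cm.span B2"
    using cm.maximal_independent_subset by blast
  have "filt M 2 \<subseteq> filt M 1" by (auto simp: filt_def)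
  then have "B2 \<subseteq> b \<inter> filt M 1" using B2 by blast
  then obtain B1 where B1: "B2 \<subseteq> B1" "B1 \<subseteq> b \<inter> filt M 1" "cm.independent B1" "b \<inter> filt M 1 \<subseteq> cm.span B1"
    using cm.maximal_independent_subset_extend[OF _ B2(2)] by metis
  then have "B1 \<subseteq> b" by blast
  then obtain B where B: "B1 \<subseteq> B" "B \<subseteq> b" "cm.independent B" "b \<subseteq> cm.span B"
    using cm.maximal_independent_subset_extend[OF _ B1(3)] by metis
  have "finite B" using finite_indep_gl B b by blast
  then obtain xs where xs: "bij_betw xs {0..<card B} B" using ex_bij_betw_nat_finite by blast
  define d where "d = card B"
  have xsd: "xs ` {..<d} = B" "inj_on xs {..<d}"
    using xs by (auto simp: bij_betw_def d_def lessThan_atLeast0)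
  define rk where "rk k = (if xs k \<in> B2 then 2 else if xs k \<in> B1 then 1 else 0 :: nat)" for k
  have "lin_indep_tup d xs" using lin_indep_tup_iff xsd B by simp
  moreover have "cm.span (xs ` {..<d}) = b" using xsd B b by (simp add: cm.span_subspace)
  moreover have "xs k \<in> b \<and> xs k \<in> filt M (rk k)" if "k < d" for k
    using that xsd B B1 B2 by (auto simp: rk_def filt_def)
  moreover have "b \<inter> filt M s \<subseteq> cm.span (xs ` {k. k < d \<and> s \<le> rk k})" for s
  proof -
    consider "s = 0" | "s = 1" | "s = 2" | "3 \<le> s" by linarith
    then show ?thesis
    proof cases
      case 1
      have "{k. k < d \<and> s \<le> rk k} = {..<d}" using 1 by auto
      then show ?thesis using xsd B by auto
    next
      case 2
      have "B1 \<subseteq> xs ` {k. k < d \<and> s \<le> rk k}"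
      proof
        fix x assume x: "x \<in> B1"
        then obtain k where "k < d" "x = xs k" using xsd B by blast
        then show "x \<in> xs ` {k. k < d \<and> s \<le> rk k}" using x 2 by (auto simp: rk_def)
      qed
      then show ?thesis using cm.span_mono B1(4) 2 by blast
    next
      case 3
      have "B2 \<subseteq> xs ` {k. k < d \<and> s \<le> rk k}"
      proof
        fix x assume x: "x \<in> B2"
        then obtain k where "k < d" "x = xs k" using xsd B B1 by blast
        then show "x \<in> xs ` {k. k < d \<and> s \<le> rk k}" using x 3 by (auto simp: rk_def)
      qed
      then show ?thesis using cm.span_mono B2(3) 3 by blast
    next
      case 4
      then show ?thesis using filt_3[OF 4, of M] cm.span_zero by blast
    qed
  qed
  ultimately show ?thesis by blast
qed

lemma poly_fn_isCont:
  fixes X :: "complex \<Rightarrow> 'v \<Rightarrow> complex"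
  assumes "poly_fn p" "\<And>v. isCont (\<lambda>t. X t v) t0"
  shows "isCont (\<lambda>t. p (X t)) t0"
  using assms by (induction rule: poly_fn.induct) auto

lemma isCont_zero:
  fixes f :: "complex \<Rightarrow> complex"
  assumes "isCont f 0" "\<And>t. t \<noteq> 0 \<Longrightarrow> f t = 0"
  shows "f 0 = 0"
proof -
  have "(f \<longlongrightarrow> f 0) (at 0)" using assms(1) by (simp add: isCont_def)
  moreover have "(f \<longlongrightarrow> 0) (at 0)"
    by (rule tendsto_eventually) (auto simp: eventually_at_filter assms(2))
  ultimately show ?thesis by (rule LIM_unique)
qed

text \<open>The polynomial equations of the closed set hold along a curve of tuples for
  \<open>t \<noteq> 0\<close>, hence by continuity at \<open>t = 0\<close>. Since the limiting tuple
  is independent, its span belongs to the orbit itself.\<close>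

lemma closed_orbit_contains_eu:
  assumes b: "borel (Suc M) b" and cl: "zariski_closed_flag (Suc M) (K_orbit (Suc M) b)"
  shows "eu M M \<in> b"
proof -
  let ?m = "Suc M"
  let ?S = "K_orbit ?m b"
  have bgl: "b \<subseteq> gl ?m" using borelD(3)[OF b] .
  obtain d xs rk where ind: "lin_indep_tup d xs" and sp: "cm.span (xs ` {..<d}) = b"
    and xb: "\<And>k. k < d \<Longrightarrow> xs k \<in> b" and xf: "\<And>k. k < d \<Longrightarrow> xs k \<in> filt M (rk k)"
    and fs: "\<And>s. b \<inter> filt M s \<subseteq> cm.span (xs ` {k. k < d \<and> s \<le> rk k})"
  proof -
    obtain d xs rk where *: "lin_indep_tup d xs \<and> cm.span (xs ` {..<d}) = b \<and>
      (\<forall>k<d. xs k \<in> b \<and> xs k \<in> filt M (rk k)) \<and>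
      (\<forall>s. b \<inter> filt M s \<subseteq> cm.span (xs ` {k. k < d \<and> s \<le> rk k}))"
      using adapted_basis[OF borelD(4,3)[OF b]] by blast
    show thesis by (rule that[of d xs rk]) (use * in simp_all)
  qed
  define Y where "Y t k = curve M (rk k) t (xs k)" for t k
  \<comment> \<open>Entries with index at least \<open>d\<close> are set to zero so that
    \<open>X t\<close> lies in the affine space where closedness is formulated.\<close>
  define X where "X t = (\<lambda>(k, a, b). if k < d then Y t k a b else 0)" for t
  have tX: "tup (X t) k = Y t k" if "k < d" for t k using that by (simp add: tup_def X_def)
  have Xaff: "X t \<in> aff (tup_coords d ?m)" for t
  proof -
    have "xs k a c = 0" if "k < d" "\<not> (a < ?m \<and> c < ?m)" for k a c
      using that xb bgl gl_nonzeroD by blast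
    then show ?thesis by (auto simp: aff_def tup_coords_def X_def Y_def curve_def)
  qed
  let ?Z = "{X \<in> aff (tup_coords d ?m). \<not> lin_indep_tup d (tup X) \<or> lin_span (tup X ` {..<d}) \<in> ?S}"
  have "zariski_closed_aff (tup_coords d ?m) ?Z"
    using cl unfolding zariski_closed_flag_def by blast
  then obtain P where P: "\<forall>p\<in>P. poly_fn p" "?Z = {x \<in> aff (tup_coords d ?m). \<forall>p\<in>P. p x = 0}"
    unfolding zariski_closed_aff_def by (elim exE conjE) (rule that)
  \<comment> \<open>Each vector is here a nonzero multiple of a conjugate of a basis vector, so the
    tuple spans a point of the orbit.\<close>
  have XZ: "X t \<in> ?Z" if t: "t \<noteq> 0" for t
  proof -
    let ?c = "cj ?m (dg M t) (dg M (inverse t))"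
    have Yc: "msmult (t ^ rk k) (Y t k) = msmult t (?c (xs k))" if "k < d" for k
      unfolding Y_def using curve_eq xb[OF that] xf[OF that] bgl t by blast
    have 1: "Y t k = msmult (inverse (t ^ rk k) * t) (?c (xs k))" if "k < d" for k
    proof -
      have "msmult (inverse (t ^ rk k)) (msmult (t ^ rk k) (Y t k)) = Y t k" using t by simp
      then show ?thesis using Yc[OF that] by simp
    qed
    have 2: "?c (xs k) = msmult (inverse t * t ^ rk k) (Y t k)" if "k < d" for k
    proof -
      have "msmult (inverse t) (msmult t (?c (xs k))) = ?c (xs k)" using t by simp
      then show ?thesis using Yc[OF that, symmetric] by simp
    qed
    have im: "tup (X t) ` {..<d} = Y t ` {..<d}" using tX by (intro image_cong) auto
    have "cm.span (Y t ` {..<d}) = cm.span ((\<lambda>k. ?c (xs k)) ` {..<d})"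
      unfolding cm.span_eq
    proof (intro conjI image_subsetI)
      fix k assume k: "k \<in> {..<d}"
      then have kd: "k < d" by simp
      show "Y t k \<in> cm.span ((\<lambda>k. ?c (xs k)) ` {..<d})"
        by (subst 1[OF kd]) (rule cm.span_scale, rule cm.span_base, rule imageI, rule k)
      show "?c (xs k) \<in> cm.span (Y t ` {..<d})"
        by (subst 2[OF kd]) (rule cm.span_scale, rule cm.span_base, rule imageI, rule k)
    qed
    also have "(\<lambda>k. ?c (xs k)) ` {..<d} = ?c ` xs ` {..<d}" by (simp add: image_image)
    also have "cm.span (?c ` xs ` {..<d}) = ?c ` b"
      using cmp.linear_span_image[OF linear_cj] sp by metis
    finally have "lin_span (tup (X t) ` {..<d}) = ?c ` b" by (simp add: lin_span_eq im)
    then have "lin_span (tup (X t) ` {..<d}) \<in> ?S" unfolding K_orbit_eq using kpair_dg[OF t] by blast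
    then show ?thesis using Xaff by blast
  qed
  have cont: "isCont (\<lambda>t. X t v) 0" for v
    by (cases v; cases "fst v < d") (auto simp: X_def Y_def curve_def)
  have "p (X 0) = 0" if p: "p \<in> P" for p
  proof (rule isCont_zero)
    show "isCont (\<lambda>t. p (X t)) 0" using poly_fn_isCont P p cont by blast
    show "p (X t) = 0" if "t \<noteq> 0" for t using XZ[OF that] P(2) p by blast
  qed
  then have X0: "X 0 \<in> ?Z" using P(2) Xaff by blast
  have Y0: "Y 0 k a c = (if wt M a c = rk k then xs k a c else 0)" if "k < d" for k a c
    unfolding Y_def using curve_0[OF xf[OF that]] .
  have "lin_indep_tup d (tup (X 0))"
    unfolding lin_indep_tup_sum
  proof (intro allI impI)
    fix c k0 assume "(\<Sum>k<d. msmult (c k) (tup (X 0) k)) = 0" and k0: "k0 < d"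
    then have z: "(\<Sum>k<d. c k * Y 0 k a e) = 0" for a e
    proof -
      have "(\<Sum>k<d. msmult (c k) (tup (X 0) k)) a e = (\<Sum>k<d. c k * Y 0 k a e)"
        unfolding sum_apply by (rule sum.cong) (auto simp: msmult_def tX)
      then show ?thesis using \<open>_ = 0\<close> by (simp add: fun_apply)
    qed
    \<comment> \<open>In a relation among leading components, the basis vectors of rank
      \<open>?r\<close> combine to a \<open>v\<close> whose part of weight \<open>?r\<close> is
      zero. Then \<open>v\<close> lies in the next filtration step, hence in the span of the basis
      vectors of higher rank, and independence of the whole basis kills the coefficients.\<close>
    let ?r = "rk k0"
    let ?A = "{k. k < d \<and> rk k = ?r}"
    let ?A' = "{k. k < d \<and> Suc ?r \<le> rk k}"
    define v where "v = (\<Sum>k\<in>?A. msmult (c k) (xs k))"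
    have "v \<in> b" unfolding v_def using xb
      by (intro cm.subspace_sum borelD(4)[OF b] cm.subspace_scale) auto
    moreover have "v \<in> filt M (Suc ?r)"
    proof -
      have "xs k \<in> filt M ?r" if "k \<in> ?A" for k using that xf[of k] by simp
      then have vr: "v \<in> filt M ?r" unfolding v_def
        by (intro cm.subspace_sum subspace_filt cm.subspace_scale)
      have "v a e = 0" if w: "wt M a e = ?r" for a e
      proof -
        have "v a e = (\<Sum>k\<in>?A. c k * xs k a e)" by (simp add: v_def sum_apply msmult_def)
        also have "\<dots> = (\<Sum>k<d. c k * Y 0 k a e)"
          by (rule sum.mono_neutral_cong_left) (auto simp: Y0 w)
        finally show ?thesis using z by simp
      qed
      then show ?thesis using vr by (auto simp: filt_def less_Suc_eq)
    qed
    ultimately have "v \<in> cm.span (xs ` ?A')" using fs by blast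
    then obtain c' where c': "v = (\<Sum>k\<in>?A'. msmult (c' k) (xs k))"
      using span_image_sum[of ?A' v xs] by auto
    define u where "u k = (if rk k = ?r then c k else if Suc ?r \<le> rk k then - c' k else 0)" for k
    have "(\<Sum>k<d. msmult (u k) (xs k)) = (\<Sum>k\<in>?A. msmult (u k) (xs k)) + (\<Sum>k\<in>?A'. msmult (u k) (xs k))"
      by (subst sum.union_disjoint[symmetric])
        (auto intro!: sum.mono_neutral_right simp: u_def)
    also have "(\<Sum>k\<in>?A. msmult (u k) (xs k)) = v" unfolding v_def by (rule sum.cong) (auto simp: u_def)
    also have "(\<Sum>k\<in>?A'. msmult (u k) (xs k)) = (\<Sum>k\<in>?A'. - msmult (c' k) (xs k))"
      by (rule sum.cong) (auto simp: u_def)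
    also have "\<dots> = - v" using c' by (simp add: sum_negf)
    finally have "u k0 = 0" using ind k0 unfolding lin_indep_tup_sum by auto
    then show "c k0 = 0" by (simp add: u_def)
  qed
  moreover have "tup (X 0) ` {..<d} = Y 0 ` {..<d}" using tX by (intro image_cong) auto
  ultimately have L0: "cm.span (Y 0 ` {..<d}) \<in> ?S" using X0 by (simp add: lin_span_eq)
  define L where "L = cm.span (Y 0 ` {..<d})"
  obtain g h where g: "kpair M g h" "L = cj ?m g h ` b" using L0 unfolding K_orbit_eq L_def by blast
  have bL: "borel ?m L" using borel_cj[OF kpairD[OF g(1)] b] g(2) by simp
  have e: "eu M M \<in> gl ?m" by (simp add: eu_gl)
  have "lie_br ?m (eu M M) x \<in> L" if "x \<in> L" for x
  proof -
    \<comment> \<open>The leading components are eigenvectors of the bracket with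
      \<open>eu M M\<close>; the \<open>- 1\<close> undoes the shift in \<open>wt\<close>.\<close>
    have brY: "lie_br ?m (eu M M) (Y 0 k) = msmult (of_nat (rk k) - 1) (Y 0 k)" if "k < d" for k
      using that by (auto simp: lie_br_eq eu_mmul mmul_eu fun_eq_iff fun_apply msmult_def Y0 wt_def)
    have "cm.subspace {x. lie_br ?m (eu M M) x \<in> L}"
    proof (rule cm.subspaceI)
      have s: "cm.subspace L" by (simp add: L_def)
      show "0 \<in> {x. lie_br ?m (eu M M) x \<in> L}" using cm.subspace_0[OF s] by (simp add: lie_br_eq)
      fix x y assume "x \<in> {x. lie_br ?m (eu M M) x \<in> L}" "y \<in> {x. lie_br ?m (eu M M) x \<in> L}"
      then have "lie_br ?m (eu M M) x + lie_br ?m (eu M M) y \<in> L" using cm.subspace_add[OF s] by blast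
      then show "x + y \<in> {x. lie_br ?m (eu M M) x \<in> L}"
        by (simp add: lie_br_eq mmul_simps algebra_simps)
    next
      have s: "cm.subspace L" by (simp add: L_def)
      fix c x assume "x \<in> {x. lie_br ?m (eu M M) x \<in> L}"
      then have "msmult c (lie_br ?m (eu M M) x) \<in> L" using cm.subspace_scale[OF s] by blast
      then show "msmult c x \<in> {x. lie_br ?m (eu M M) x \<in> L}"
        by (simp add: lie_br_eq mmul_simps cm.scale_right_diff_distrib)
    qed
    moreover have "Y 0 ` {..<d} \<subseteq> {x. lie_br ?m (eu M M) x \<in> L}"
    proof (rule image_subsetI)
      fix k assume k: "k \<in> {..<d}"
      then have "lie_br ?m (eu M M) (Y 0 k) = msmult (of_nat (rk k) - 1) (Y 0 k)" using brY by simp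
      also have "\<dots> \<in> L" unfolding L_def by (rule cm.span_scale, rule cm.span_base, rule imageI, rule k)
      finally show "Y 0 k \<in> {x. lie_br ?m (eu M M) x \<in> L}" by simp
    qed
    ultimately have "L \<subseteq> {x. lie_br ?m (eu M M) x \<in> L}"
      using cm.span_minimal[of "Y 0 ` {..<d}"] L_def by blast
    then show ?thesis using that by blast
  qed
  then have "eu M M \<in> L" using borel_contains_normalizer[OF bL e] by blast
  then have "cj ?m h g (eu M M) \<in> cj ?m h g ` cj ?m g h ` b" using g(2) by blast
  then show ?thesis using cj_image_inverse[OF kpairD[OF g(1)] bgl] cj_eu[OF kpair_sym[OF g(1)]] by simp
qed

subsection \<open>Zariski closed conditions\<close>

text \<open>Closedness of a condition instead of a set, so that it can be assembled along the
  logical connectives.\<close>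

definition zcl :: "'v set \<Rightarrow> (('v \<Rightarrow> complex) \<Rightarrow> bool) \<Rightarrow> bool" where
  "zcl I Q \<longleftrightarrow> zariski_closed_aff I {X \<in> aff I. Q X}"

lemma zclI:
  assumes "\<forall>p\<in>P. poly_fn p" "\<And>X. X \<in> aff I \<Longrightarrow> Q X \<longleftrightarrow> (\<forall>p\<in>P. p X = 0)"
  shows "zcl I Q"
  unfolding zcl_def zariski_closed_aff_def using assms by blast

lemma zclE:
  assumes "zcl I Q"
  obtains P where "\<forall>p\<in>P. poly_fn p" "\<And>X. X \<in> aff I \<Longrightarrow> Q X \<longleftrightarrow> (\<forall>p\<in>P. p X = 0)"
proof -
  obtain P where "\<forall>p\<in>P. poly_fn p" "{X \<in> aff I. Q X} = {X \<in> aff I. \<forall>p\<in>P. p X = 0}"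
    using assms unfolding zcl_def zariski_closed_aff_def by (elim exE conjE) (rule that)
  then show thesis by (intro that[of P]) blast+
qed

lemma zcl_poly: "poly_fn p \<Longrightarrow> zcl I (\<lambda>X. p X = 0)"
  by (rule zclI[of "{p}"]) auto

lemma zcl_ball:
  assumes "\<And>i. i \<in> J \<Longrightarrow> zcl I (Q i)"
  shows "zcl I (\<lambda>X. \<forall>i\<in>J. Q i X)"
proof -
  have "\<exists>P. (\<forall>p\<in>P. poly_fn p) \<and> (\<forall>X\<in>aff I. Q i X \<longleftrightarrow> (\<forall>p\<in>P. p X = 0))" if "i \<in> J" for i
    using assms[OF that] by (elim zclE) blast
  then obtain P where P: "\<And>i. i \<in> J \<Longrightarrow> (\<forall>p\<in>P i. poly_fn p) \<and> (\<forall>X\<in>aff I. Q i X \<longleftrightarrow> (\<forall>p\<in>P i. p X = 0))"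
    by metis
  show ?thesis by (rule zclI[of "\<Union>i\<in>J. P i"]) (use P in blast)+
qed

lemma zcl_conj:
  assumes "zcl I Q" "zcl I R"
  shows "zcl I (\<lambda>X. Q X \<and> R X)"
proof -
  have "zcl I (\<lambda>X. \<forall>i\<in>{True, False}. (if i then Q else R) X)"
    by (rule zcl_ball) (auto simp: assms)
  then show ?thesis by (simp add: ex_bool_eq)
qed

text \<open>A union is cut out by all products of an equation from one side with an equation from
  the other.\<close>

lemma zcl_disj:
  assumes "zcl I Q" "zcl I R"
  shows "zcl I (\<lambda>X. Q X \<or> R X)"
proof -
  obtain P where P: "\<forall>p\<in>P. poly_fn p" "\<And>X. X \<in> aff I \<Longrightarrow> Q X \<longleftrightarrow> (\<forall>p\<in>P. p X = 0)"
    by (rule zclE[OF assms(1)]) (rule that; blast)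
  obtain P' where P': "\<forall>p\<in>P'. poly_fn p" "\<And>X. X \<in> aff I \<Longrightarrow> R X \<longleftrightarrow> (\<forall>p\<in>P'. p X = 0)"
    by (rule zclE[OF assms(2)]) (rule that; blast)
  show ?thesis
  proof (rule zclI)
    let ?B = "(\<lambda>(p, q) x. p x * q x) ` (P \<times> P')"
    show "\<forall>p\<in>?B. poly_fn p" using P P' by (auto intro: pmul)
    fix X assume X: "X \<in> aff I"
    have "(\<forall>r\<in>?B. r X = 0) \<longleftrightarrow> (\<forall>p\<in>P. \<forall>q\<in>P'. p X * q X = 0)" by simp
    then show "Q X \<or> R X \<longleftrightarrow> (\<forall>r\<in>?B. r X = 0)"
      unfolding P(2)[OF X] P'(2)[OF X] by auto
  qed
qed

lemma zcl_cong: "(\<And>X. X \<in> aff I \<Longrightarrow> Q X \<longleftrightarrow> R X) \<Longrightarrow> zcl I Q \<Longrightarrow> zcl I R"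
  unfolding zcl_def by (metis (mono_tags, lifting) Collect_cong)

lemma poly_fn_sum: "finite S \<Longrightarrow> (\<And>i. i \<in> S \<Longrightarrow> poly_fn (f i)) \<Longrightarrow> poly_fn (\<lambda>x. \<Sum>i\<in>S. f i x)"
  by (induction S rule: finite_induct) (auto intro: poly_fn.intros)

lemma poly_fn_prod: "finite S \<Longrightarrow> (\<And>i. i \<in> S \<Longrightarrow> poly_fn (f i)) \<Longrightarrow> poly_fn (\<lambda>x. \<Prod>i\<in>S. f i x)"
  by (induction S rule: finite_induct) (auto intro: poly_fn.intros)

section \<open>Polynomial matrix-valued maps\<close>

definition polym :: "(('v \<Rightarrow> complex) \<Rightarrow> cmat) \<Rightarrow> bool" where
  "polym f \<longleftrightarrow> (\<forall>a b. poly_fn (\<lambda>X. f X a b))"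

lemma polym_const: "polym (\<lambda>X. A)"
  by (simp add: polym_def pconst)

lemma polym_tup: "polym (\<lambda>X. tup X k)"
  by (simp add: polym_def tup_def pvar)

lemma polym_mmul: "polym f \<Longrightarrow> polym g \<Longrightarrow> polym (\<lambda>X. mmul m (f X) (g X))"
  by (auto simp: polym_def mmul_def intro!: poly_fn_sum pmul)

lemma polym_diff:
  assumes "polym f" "polym g" shows "polym (\<lambda>X. f X - g X)"
proof -
  have "poly_fn (\<lambda>X. f X a b + (- 1) * g X a b)" for a b
    using assms by (intro padd pmul pconst) (auto simp: polym_def)
  then show ?thesis by (simp add: polym_def fun_apply)
qed

lemma polym_lie_br: "polym f \<Longrightarrow> polym g \<Longrightarrow> polym (\<lambda>X. lie_br m (f X) (g X))"
  unfolding lie_br_eq by (intro polym_diff polym_mmul)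

lemma zcl_polym: "polym f \<Longrightarrow> zcl I (\<lambda>X. f X = 0)"
proof -
  assume f: "polym f"
  have "zcl I (\<lambda>X. \<forall>ab\<in>UNIV. f X (fst ab) (snd ab) = 0)"
    using f by (intro zcl_ball zcl_poly) (simp add: polym_def)
  then show ?thesis by (simp add: fun_eq_iff fun_apply)
qed

interpretation cmc: vector_space_pair msmult "(*) :: complex \<Rightarrow> complex \<Rightarrow> complex"
  by unfold_locales (auto simp: algebra_simps)

lemma linear_functional_gl:
  fixes g :: "cmat \<Rightarrow> complex"
  assumes g: "Vector_Spaces.linear msmult (*) g" and A: "A \<in> gl m"
  shows "g A = (\<Sum>a<m. \<Sum>b<m. A a b * g (eu a b))"
proof -
  have "g A = g (\<Sum>a<m. \<Sum>b<m. msmult (A a b) (eu a b))" using gl_eq_sum_eu[OF A] by simp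
  also have "\<dots> = (\<Sum>a<m. \<Sum>b<m. A a b * g (eu a b))"
    by (simp add: cmc.linear_sum[OF g] cmc.linear_scale[OF g])
  finally show ?thesis .
qed

text \<open>At a point where the tuple is independent, the matrix of dual functionals evaluated on the
  tuple has determinant \<open>1\<close> there and determinant \<open>0\<close> at all points where the tuple is dependent.\<close>

lemma zcl_dependent:
  assumes F: "\<And>k. k < d \<Longrightarrow> polym (F k)" and Fgl: "\<And>k X. k < d \<Longrightarrow> X \<in> aff I \<Longrightarrow> F k X \<in> gl m"
  shows "zcl I (\<lambda>X. \<not> lin_indep_tup d (\<lambda>k. F k X))"
proof (rule zclI)
  \<comment> \<open>The equations are all polynomials that vanish at dependent tuples; it remains to
    find one that is nonzero at a given independent tuple.\<close>
  let ?P = "{p. poly_fn p \<and> (\<forall>X\<in>aff I. \<not> lin_indep_tup d (\<lambda>k. F k X) \<longrightarrow> p X = 0)}"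
  show "\<forall>p\<in>?P. poly_fn p" by blast
  fix X0 assume X0: "X0 \<in> aff I"
  have "\<exists>p\<in>?P. p X0 \<noteq> 0" if L: "lin_indep_tup d (\<lambda>k. F k X0)"
  proof -
    have inj: "inj_on (\<lambda>k. F k X0) {..<d}" and ind: "cm.independent ((\<lambda>k. F k X0) ` {..<d})"
      using L lin_indep_tup_iff by auto
    have "\<exists>g. Vector_Spaces.linear msmult (*) g \<and>
        (\<forall>x\<in>(\<lambda>k. F k X0) ` {..<d}. g x = (if x = F i X0 then 1 else 0 :: complex))" for i
      by (rule cmc.linear_independent_extend[OF ind])
    then obtain g where g: "\<And>i. Vector_Spaces.linear msmult (*) (g i :: cmat \<Rightarrow> complex)"
      "\<And>i x. x \<in> (\<lambda>k. F k X0) ` {..<d} \<Longrightarrow> g i x = (if x = F i X0 then 1 else 0)" by metis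
    \<comment> \<open>Expanding \<open>g i\<close> in matrix units makes \<open>q i j\<close>
      visibly polynomial everywhere; it equals \<open>g i (F j X)\<close> on \<open>aff I\<close>,
      where \<open>F j X\<close> lies in \<open>gl m\<close>. The functionals stay fixed while
      \<open>X\<close> varies.\<close>
    define q where "q i j X = (\<Sum>a<m. \<Sum>b<m. F j X a b * g i (eu a b))" for i j X
    have q: "q i j X = g i (F j X)" if "j < d" "X \<in> aff I" for i j X
      unfolding q_def using linear_functional_gl[OF g(1) Fgl[OF that]] by simp
    define A where "A X = Matrix.mat d d (\<lambda>(i, j). q i j X)" for X
    have carr: "A X \<in> carrier_mat d d" for X by (simp add: A_def)
    have "poly_fn (\<lambda>X. det (A X))"
    proof -
      have eq: "det (A X) = (\<Sum>p\<in>{p. p permutes {0..<d}}. signof p * (\<Prod>i = 0..<d. q i (p i) X))" for X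
      proof -
        have "(\<Prod>i = 0..<d. A X $$ (i, p i)) = (\<Prod>i = 0..<d. q i (p i) X)" if "p permutes {0..<d}" for p
          using permutes_in_image[OF that] by (intro prod.cong) (auto simp: A_def)
        then show ?thesis unfolding det_def'[OF carr] by (intro sum.cong) auto
      qed
      have "poly_fn (q i (p i))" if "i < d" "p permutes {0..<d}" for i p
      proof -
        have "p i < d" using permutes_in_image[OF that(2), of i] that(1) by simp
        then have "poly_fn (\<lambda>X. F (p i) X a b * g i (eu a b))" for a b
          using F by (intro pmul pconst) (auto simp: polym_def)
        then show ?thesis unfolding q_def by (intro poly_fn_sum) auto
      qed
      then show ?thesis unfolding eq
        by (intro poly_fn_sum pmul pconst poly_fn_prod) (auto simp: finite_permutations)
    qed
    moreover have "det (A X) = 0" if X: "X \<in> aff I" and dep: "\<not> lin_indep_tup d (\<lambda>k. F k X)" for X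
    proof -
      obtain c k0 where c: "(\<Sum>k<d. msmult (c k) (F k X)) = 0" "k0 < d" "c k0 \<noteq> 0"
        using dep unfolding lin_indep_tup_sum by blast
      define v where "v = Matrix.vec d c"
      have "A X *\<^sub>v v = 0\<^sub>v d"
      proof
        fix i assume i: "i < dim_vec (0\<^sub>v d :: complex Matrix.vec)"
        then have "(A X *\<^sub>v v) $ i = (\<Sum>j = 0..<d. q i j X * c j)"
          by (simp add: A_def v_def scalar_prod_def)
        also have "\<dots> = (\<Sum>j<d. c j * g i (F j X))"
          by (rule sum.cong) (auto simp: q X lessThan_atLeast0)
        also have "\<dots> = g i (\<Sum>k<d. msmult (c k) (F k X))"
          by (simp add: cmc.linear_sum[OF g(1)] cmc.linear_scale[OF g(1)])
        also have "\<dots> = 0" unfolding c(1) by (rule cmc.linear_0[OF g(1)])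
        finally show "(A X *\<^sub>v v) $ i = 0\<^sub>v d $ i" using i by simp
      qed (simp add: A_def)
      moreover have "v \<noteq> 0\<^sub>v d"
      proof
        assume "v = 0\<^sub>v d"
        then have "v $ k0 = 0" using c(2) by simp
        then show False using c by (simp add: v_def)
      qed
      moreover have "v \<in> carrier_vec d" by (simp add: v_def)
      ultimately show ?thesis unfolding det_0_iff_vec_prod_zero_field[OF carr] by blast
    qed
    moreover have "det (A X0) \<noteq> 0"
    proof -
      have "A X0 = 1\<^sub>m d"
      proof (rule eq_matI)
        fix i j assume ij: "i < dim_row (1\<^sub>m d :: complex Matrix.mat)" "j < dim_col (1\<^sub>m d :: complex Matrix.mat)"
        then have "F j X0 = F i X0 \<longleftrightarrow> j = i" using inj by (auto simp: inj_on_def)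
        then show "A X0 $$ (i, j) = 1\<^sub>m d $$ (i, j)" using ij by (auto simp: A_def q X0 g(2))
      qed (auto simp: A_def)
      then show ?thesis by simp
    qed
    ultimately show ?thesis by (intro bexI[of _ "\<lambda>X. det (A X)"] CollectI conjI ballI impI) auto
  qed
  then show "\<not> lin_indep_tup d (\<lambda>k. F k X0) \<longleftrightarrow> (\<forall>p\<in>?P. p X0 = 0)" using X0 by blast
qed

text \<open>Turns membership in a span into dependence of a longer tuple, to which
  \<open>zcl_dependent\<close> applies.\<close>

lemma in_span_iff_dependent:
  fixes xs :: "nat \<Rightarrow> cmat"
  assumes "lin_indep_tup d xs"
  shows "y \<in> cm.span (xs ` {..<d}) \<longleftrightarrow> \<not> lin_indep_tup (Suc d) (\<lambda>k. if k < d then xs k else y)"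
proof -
  let ?z = "\<lambda>k. if k < d then xs k else y"
  have im: "?z ` {..<d} = xs ` {..<d}" by (intro image_cong) auto
  then have im': "?z ` {..<Suc d} = insert y (xs ` {..<d})"
    unfolding lessThan_Suc image_insert by simp
  have ind: "inj_on xs {..<d}" "cm.independent (xs ` {..<d})" using assms lin_indep_tup_iff by auto
  have inj: "inj_on ?z {..<d}" using ind(1) by (simp add: inj_on_def)
  have "inj_on ?z {..<Suc d} \<longleftrightarrow> y \<notin> xs ` {..<d}"
    using inj im by (simp add: lessThan_Suc inj_on_insert)
  moreover have "y \<notin> cm.span (xs ` {..<d}) \<longleftrightarrow> y \<notin> xs ` {..<d} \<and> cm.independent (insert y (xs ` {..<d}))"
    using ind(2) cm.independent_insert[of y "xs ` {..<d}"] cm.span_base[of y "xs ` {..<d}"] by auto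
  ultimately show ?thesis unfolding lin_indep_tup_iff im' by blast
qed

subsection \<open>Multilinear conditions\<close>

lemma span_bilinear:
  assumes l: "\<And>y. Vector_Spaces.linear msmult msmult (\<lambda>x. B x y)"
    and r: "\<And>x. Vector_Spaces.linear msmult msmult (B x)"
    and x: "x \<in> cm.span S" and y: "y \<in> cm.span S'"
  shows "B x y \<in> cm.span {B x y | x y. x \<in> S \<and> y \<in> S'}" (is "_ \<in> cm.span ?R")
proof -
  have 1: "B x y \<in> cm.span ?R" if "y \<in> S'" for y
  proof -
    have "B x y \<in> (\<lambda>x. B x y) ` cm.span S" using x by blast
    also have "\<dots> = cm.span ((\<lambda>x. B x y) ` S)" using cmp.linear_span_image[OF l] by metis
    also have "\<dots> \<subseteq> cm.span ?R" using that by (intro cm.span_mono) blast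
    finally show ?thesis .
  qed
  have "B x y \<in> B x ` cm.span S'" using y by blast
  also have "\<dots> = cm.span (B x ` S')" using cmp.linear_span_image[OF r] by metis
  also have "\<dots> \<subseteq> cm.span ?R" using 1 by (intro cm.span_minimal) auto
  finally show ?thesis .
qed

lemma linear_mmul: "Vector_Spaces.linear msmult msmult (\<lambda>x. mmul m x y)"
  "Vector_Spaces.linear msmult msmult (mmul m x)"
  by (simp_all add: Vector_Spaces.linear_iff cm.vector_space_axioms mmul_simps)

lemma linear_lie_br: "Vector_Spaces.linear msmult msmult (\<lambda>x. lie_br m x y)"
  "Vector_Spaces.linear msmult msmult (lie_br m x)"
  by (simp_all add: Vector_Spaces.linear_iff cm.vector_space_axioms lie_br_eq mmul_simps
      cm.scale_right_diff_distrib)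

text \<open>Unlike in \<open>derived\<close>, no span is taken: the iterates on a generating tuple
  remain explicit polynomial expressions, and by \<open>derived_pow_span\<close> they still span the
  derived series.\<close>

definition brs :: "nat \<Rightarrow> cmat set \<Rightarrow> cmat set" where
  "brs m S = {lie_br m x y | x y. x \<in> S \<and> y \<in> S}"

definition prods :: "nat \<Rightarrow> cmat set \<Rightarrow> cmat set \<Rightarrow> cmat set" where
  "prods m S S' = {mmul m x y | x y. x \<in> S \<and> y \<in> S'}"

lemma brs_span: "brs m (cm.span S) \<subseteq> cm.span (brs m S)"
  unfolding brs_def using span_bilinear[OF linear_lie_br] by blast

lemma prods_span: "prods m (cm.span S) (cm.span S') \<subseteq> cm.span (prods m S S')"
  unfolding prods_def using span_bilinear[OF linear_mmul] by blast

lemma brs_mono: "S \<subseteq> S' \<Longrightarrow> brs m S \<subseteq> brs m S'"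
  unfolding brs_def by blast

lemma prods_mono: "S \<subseteq> S' \<Longrightarrow> R \<subseteq> R' \<Longrightarrow> prods m S R \<subseteq> prods m S' R'"
  unfolding prods_def by blast

lemma derived_brs: "derived m L = cm.span (brs m L)"
  by (simp add: derived_eq brs_def)

lemma derived_pow_span: "(derived m ^^ r) (cm.span S) = cm.span ((brs m ^^ r) S)"
proof (induction r)
  case 0
  show ?case by simp
next
  case (Suc r)
  let ?S = "(brs m ^^ r) S"
  have "cm.span (brs m (cm.span ?S)) \<subseteq> cm.span (brs m ?S)"
    by (rule cm.span_minimal[OF brs_span]) simp
  moreover have "cm.span (brs m ?S) \<subseteq> cm.span (brs m (cm.span ?S))"
    by (intro cm.span_mono brs_mono cm.span_superset)
  ultimately show ?case using Suc.IH by (simp add: derived_brs)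
qed

text \<open>The generators of \<open>e N^r\<close>: the idempotent followed by \<open>r\<close>
  commutators. \<open>lch\<close> is the mirror image for \<open>N^r e\<close>. They measure how far
  the flag extends on either side of the distinguished vector.\<close>

definition rch :: "nat \<Rightarrow> nat \<Rightarrow> cmat set \<Rightarrow> nat \<Rightarrow> cmat set" where
  "rch m a S r = ((\<lambda>R. prods m R (brs m S)) ^^ r) {eu a a}"

definition lch :: "nat \<Rightarrow> nat \<Rightarrow> cmat set \<Rightarrow> nat \<Rightarrow> cmat set" where
  "lch m a S r = ((\<lambda>R. prods m (brs m S) R) ^^ r) {eu a a}"

lemma rch_simps: "rch m a S 0 = {eu a a}" "rch m a S (Suc r) = prods m (rch m a S r) (brs m S)"
  by (simp_all add: rch_def)

lemma lch_simps: "lch m a S 0 = {eu a a}" "lch m a S (Suc r) = prods m (brs m S) (lch m a S r)"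
  by (simp_all add: lch_def)

lemma rch_mono: "S \<subseteq> S' \<Longrightarrow> rch m a S r \<subseteq> rch m a S' r"
  by (induction r) (simp_all only: rch_simps prods_mono brs_mono subset_refl)

lemma lch_mono: "S \<subseteq> S' \<Longrightarrow> lch m a S r \<subseteq> lch m a S' r"
  by (induction r) (simp_all only: lch_simps prods_mono brs_mono subset_refl)

lemma rch_span: "rch m a (cm.span S) r \<subseteq> cm.span (rch m a S r)"
proof (induction r)
  case 0
  show ?case by (simp add: rch_simps cm.span_base)
next
  case (Suc r)
  have "rch m a (cm.span S) (Suc r) \<subseteq> prods m (cm.span (rch m a S r)) (cm.span (brs m S))"
    unfolding rch_simps by (rule prods_mono[OF Suc.IH brs_span])
  then show ?case using prods_span unfolding rch_simps by blast
qed

lemma lch_span: "lch m a (cm.span S) r \<subseteq> cm.span (lch m a S r)"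
proof (induction r)
  case 0
  show ?case by (simp add: lch_simps cm.span_base)
next
  case (Suc r)
  have "lch m a (cm.span S) (Suc r) \<subseteq> prods m (cm.span (brs m S)) (cm.span (lch m a S r))"
    unfolding lch_simps by (rule prods_mono[OF brs_span Suc.IH])
  then show ?case using prods_span unfolding lch_simps by blast
qed

text \<open>The family \<open>Fam\<close> does not depend on the point \<open>X\<close>; this makes
  the vanishing of the whole set a fixed system of polynomial equations.\<close>

definition polyset :: "(('v \<Rightarrow> complex) \<Rightarrow> cmat set) \<Rightarrow> bool" where
  "polyset S \<longleftrightarrow> (\<exists>Fam. (\<forall>f\<in>Fam. polym f) \<and> (\<forall>X. S X = (\<lambda>f. f X) ` Fam))"

lemma polysetI:
  "\<forall>f\<in>Fam. polym f \<Longrightarrow> (\<And>X. S X = (\<lambda>f. f X) ` Fam) \<Longrightarrow> polyset S"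
  unfolding polyset_def by (intro exI[of _ Fam]) simp

lemma polysetE:
  assumes "polyset S"
  obtains Fam where "\<forall>f\<in>Fam. polym f" "\<And>X. S X = (\<lambda>f. f X) ` Fam"
  using assms unfolding polyset_def by (elim exE conjE) (rule that, auto)

lemma polyset_image:
  assumes "\<And>k. k \<in> A \<Longrightarrow> polym (F k)"
  shows "polyset (\<lambda>X. (\<lambda>k. F k X) ` A)"
  unfolding polyset_def using assms by (intro exI[of _ "F ` A"]) (auto simp: image_image)

lemma polyset_brs: assumes "polyset S" shows "polyset (\<lambda>X. brs m (S X))"
proof -
  obtain Fam where Fam: "\<forall>f\<in>Fam. polym f" "\<And>X. S X = (\<lambda>f. f X) ` Fam"
    by (rule polysetE[OF assms]) (rule that; blast)
  let ?B = "(\<lambda>(f, g) X. lie_br m (f X) (g X)) ` (Fam \<times> Fam)"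
  have "brs m (S X) = (\<lambda>f. f X) ` ?B" for X
    unfolding brs_def Fam(2) image_image by force
  moreover have "\<forall>f\<in>?B. polym f"
  proof
    fix f assume "f \<in> ?B"
    then obtain g h where "g \<in> Fam" "h \<in> Fam" and f: "f = (\<lambda>X. lie_br m (g X) (h X))" by auto
    then have "polym g" "polym h" using Fam(1) by auto
    then show "polym f" unfolding f by (rule polym_lie_br)
  qed
  ultimately show ?thesis by (rule polysetI[rotated])
qed

lemma polyset_prods:
  assumes "polyset S" "polyset R" shows "polyset (\<lambda>X. prods m (S X) (R X))"
proof -
  obtain Fam where Fam: "\<forall>f\<in>Fam. polym f" "\<And>X. S X = (\<lambda>f. f X) ` Fam"
    by (rule polysetE[OF assms(1)]) (rule that; blast)
  obtain Gam where Gam: "\<forall>f\<in>Gam. polym f" "\<And>X. R X = (\<lambda>f. f X) ` Gam"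
    by (rule polysetE[OF assms(2)]) (rule that; blast)
  let ?B = "(\<lambda>(f, g) X. mmul m (f X) (g X)) ` (Fam \<times> Gam)"
  have "prods m (S X) (R X) = (\<lambda>f. f X) ` ?B" for X
    unfolding prods_def Fam(2) Gam(2) image_image by force
  moreover have "\<forall>f\<in>?B. polym f"
  proof
    fix f assume "f \<in> ?B"
    then obtain g h where "g \<in> Fam" "h \<in> Gam" and f: "f = (\<lambda>X. mmul m (g X) (h X))" by auto
    then have "polym g" "polym h" using Fam(1) Gam(1) by auto
    then show "polym f" unfolding f by (rule polym_mmul)
  qed
  ultimately show ?thesis by (rule polysetI[rotated])
qed

lemma polyset_const: "polyset (\<lambda>X. {A})"
  unfolding polyset_def by (intro exI[of _ "{\<lambda>X. A}"]) (auto simp: polym_const)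

lemma polyset_brs_pow: "polyset S \<Longrightarrow> polyset (\<lambda>X. (brs m ^^ r) (S X))"
  by (induction r) (auto intro: polyset_brs)

lemma polyset_rch: "polyset S \<Longrightarrow> polyset (\<lambda>X. rch m a (S X) r)"
  by (induction r) (auto simp: rch_simps intro: polyset_prods polyset_const polyset_brs)

lemma polyset_lch: "polyset S \<Longrightarrow> polyset (\<lambda>X. lch m a (S X) r)"
  by (induction r) (auto simp: lch_simps intro: polyset_prods polyset_const polyset_brs)

lemma zcl_polyset:
  assumes "polyset S" shows "zcl I (\<lambda>X. S X \<subseteq> {0})"
proof -
  obtain Fam where Fam: "\<forall>f\<in>Fam. polym f" "\<And>X. S X = (\<lambda>f. f X) ` Fam"
    by (rule polysetE[OF assms]) (rule that; blast)
  have "zcl I (\<lambda>X. \<forall>f\<in>Fam. f X = 0)" using Fam(1) by (intro zcl_ball zcl_polym) blast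
  then show ?thesis unfolding Fam(2) by (simp add: image_subset_iff)
qed

subsection \<open>Orbits of Borel subalgebras containing the last idempotent are closed\<close>

lemma dim_borel:
  assumes "borel m b" "borel m b'"
  shows "cm.dim b = cm.dim b'"
proof -
  have "cm.dim c = cm.dim (tri m (\<lambda>a. a) 0)" if "borel m c" for c
    using borel_conjugate[OF that] dim_cj[OF _ tri_gl subspace_tri] by auto
  then show ?thesis using assms by metis
qed

section \<open>Compatibility of commutators and products with conjugation\<close>

lemma brs_cj:
  assumes "inv_pair m g h" "S \<subseteq> gl m"
  shows "brs m (cj m g h ` S) = cj m g h ` brs m S"
proof -
  have "brs m (cj m g h ` S) = {lie_br m (cj m g h x) (cj m g h y) | x y. x \<in> S \<and> y \<in> S}"
    unfolding brs_def by blast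
  also have "\<dots> = {cj m g h (lie_br m x y) | x y. x \<in> S \<and> y \<in> S}"
    using assms by (metis (no_types, lifting) cj_lie_br subsetD)
  finally show ?thesis unfolding brs_def by blast
qed

lemma prods_cj:
  assumes "inv_pair m g h" "S \<subseteq> gl m" "R \<subseteq> gl m"
  shows "prods m (cj m g h ` S) (cj m g h ` R) = cj m g h ` prods m S R"
proof -
  have "prods m (cj m g h ` S) (cj m g h ` R) = {mmul m (cj m g h x) (cj m g h y) | x y. x \<in> S \<and> y \<in> R}"
    unfolding prods_def by blast
  also have "\<dots> = {cj m g h (mmul m x y) | x y. x \<in> S \<and> y \<in> R}"
    using assms by (metis (no_types, lifting) cj_mmul subsetD)
  finally show ?thesis unfolding prods_def by blast
qed

lemma brs_gl: "S \<subseteq> gl m \<Longrightarrow> brs m S \<subseteq> gl m"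
  unfolding brs_def using lie_br_gl by blast

lemma prods_gl: "S \<subseteq> gl m \<Longrightarrow> R \<subseteq> gl m \<Longrightarrow> prods m S R \<subseteq> gl m"
  unfolding prods_def using mmul_gl by blast

lemma rch_gl: "S \<subseteq> gl (Suc M) \<Longrightarrow> rch (Suc M) M S r \<subseteq> gl (Suc M)"
  by (induction r) (simp_all add: rch_simps eu_gl prods_gl brs_gl)

lemma lch_gl: "S \<subseteq> gl (Suc M) \<Longrightarrow> lch (Suc M) M S r \<subseteq> gl (Suc M)"
  by (induction r) (simp_all add: lch_simps eu_gl prods_gl brs_gl)

lemma rch_cj:
  assumes "kpair M g h" "S \<subseteq> gl (Suc M)"
  shows "rch (Suc M) M (cj (Suc M) g h ` S) r = cj (Suc M) g h ` rch (Suc M) M S r"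
  using assms by (induction r)
    (simp_all add: rch_simps cj_eu prods_cj[OF kpairD] brs_cj[OF kpairD] rch_gl brs_gl)

lemma lch_cj:
  assumes "kpair M g h" "S \<subseteq> gl (Suc M)"
  shows "lch (Suc M) M (cj (Suc M) g h ` S) r = cj (Suc M) g h ` lch (Suc M) M S r"
  using assms by (induction r)
    (simp_all add: lch_simps cj_eu prods_cj[OF kpairD] brs_cj[OF kpairD] lch_gl brs_gl)

section \<open>Length of commutator chains in coordinate Borel subalgebras\<close>

lemma pos_last: "pos M k M = k"
  by (simp add: pos_def)

text \<open>Every commutator of triangular matrices raises the position by at least one, while the
  row index stays at \<open>M\<close>.\<close>

lemma rch_tri_nonzero:
  assumes s: "inj_on s {..<Suc M}" and a: "a \<in> rch (Suc M) M (tri (Suc M) s 0) r" and nz: "a i j \<noteq> 0"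
  shows "i = M \<and> s M + r \<le> s j"
  using a nz
proof (induction r arbitrary: a j)
  case 0
  then show ?case by (auto simp: rch_simps eu_def split: if_splits)
next
  case (Suc r)
  then obtain x y z where x: "x \<in> rch (Suc M) M (tri (Suc M) s 0) r" "y \<in> tri (Suc M) s 0" "z \<in> tri (Suc M) s 0"
    "a = mmul (Suc M) x (lie_br (Suc M) y z)" by (auto simp: rch_simps prods_def brs_def)
  then obtain l where l: "x i l \<noteq> 0" "lie_br (Suc M) y z l j \<noteq> 0"
    using mmul_nonzeroD[of "Suc M" x "lie_br (Suc M) y z" i j] Suc.prems by blast
  have "i = M \<and> s M + r \<le> s l" using Suc.IH[OF x(1) l(1)] .
  moreover have "s l + 1 \<le> s j" using lie_br_tri0[OF s x(2,3)] l(2) by (auto simp: tri_def)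
  ultimately show ?case by simp
qed

lemma lch_tri_nonzero:
  assumes s: "inj_on s {..<Suc M}" and a: "a \<in> lch (Suc M) M (tri (Suc M) s 0) r" and nz: "a i j \<noteq> 0"
  shows "j = M \<and> s i + r \<le> s M"
  using a nz
proof (induction r arbitrary: a i)
  case 0
  then show ?case by (auto simp: lch_simps eu_def split: if_splits)
next
  case (Suc r)
  then obtain x y z where x: "x \<in> lch (Suc M) M (tri (Suc M) s 0) r" "y \<in> tri (Suc M) s 0" "z \<in> tri (Suc M) s 0"
    "a = mmul (Suc M) (lie_br (Suc M) y z) x" by (auto simp: lch_simps prods_def brs_def)
  then obtain l where l: "x l j \<noteq> 0" "lie_br (Suc M) y z i l \<noteq> 0"
    using mmul_nonzeroD[of "Suc M" "lie_br (Suc M) y z" x i j] Suc.prems by blast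
  have "j = M \<and> s l + r \<le> s M" using Suc.IH[OF x(1) l(1)] .
  moreover have "s i + 1 \<le> s l" using lie_br_tri0[OF s x(2,3)] l(2) by (auto simp: tri_def)
  ultimately show ?case by simp
qed

lemma zero_matrixI: "(\<And>i j. a i j = 0) \<Longrightarrow> (a :: cmat) = 0"
  by (simp add: fun_eq_iff fun_apply)

text \<open>Positions end at \<open>M\<close>, so a chain starting at \<open>k\<close> is exhausted
  after \<open>M - k\<close> steps.\<close>

lemma rch_tri_zero:
  assumes "k \<le> M"
  shows "rch (Suc M) M (tri (Suc M) (pos M k) 0) (Suc M - k) \<subseteq> {0}"
proof
  fix a assume a: "a \<in> rch (Suc M) M (tri (Suc M) (pos M k) 0) (Suc M - k)"
  have "a i j = 0" for i j
  proof (rule ccontr)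
    assume nz: "a i j \<noteq> 0"
    have "k + (Suc M - k) \<le> pos M k j"
      using rch_tri_nonzero[OF inj_pos[OF assms] a nz] unfolding pos_last by blast
    moreover have "j < Suc M"
    proof -
      have "a \<in> gl (Suc M)" using rch_gl[OF tri_gl] a by blast
      then show ?thesis using gl_nonzeroD nz by blast
    qed
    ultimately show False using pos_less[OF assms, of j] assms by simp
  qed
  then show "a \<in> {0}" using zero_matrixI by blast
qed

text \<open>Positions start at \<open>0\<close>, so at most \<open>k\<close> steps down from
  \<open>k\<close> are possible.\<close>

lemma lch_tri_zero:
  assumes "k \<le> M"
  shows "lch (Suc M) M (tri (Suc M) (pos M k) 0) (Suc k) \<subseteq> {0}"
proof
  fix a assume a: "a \<in> lch (Suc M) M (tri (Suc M) (pos M k) 0) (Suc k)"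
  have "a i j = 0" for i j
    using lch_tri_nonzero[OF inj_pos[OF assms] a, of i j] by (force simp: pos_last)
  then show "a \<in> {0}" using zero_matrixI by blast
qed

lemma eu_step:
  assumes "c < m" "c' < m" "s c < (s c' :: nat)"
  shows "eu c c' \<in> brs m (tri m s 0)"
proof -
  have "eu c c' = lie_br m (eu c c) (eu c c')"
    using assms by (auto simp: lie_br_eq eu_mmul_eu)
  then show ?thesis unfolding brs_def using eu_tri[of c m c s] eu_tri[of c m c' s] assms by auto
qed

text \<open>Sharpness of the vanishing exponent: moving one position at a time by matrix units
  yields a nonzero chain as long as there is room.\<close>

lemma rch_tri_mem:
  assumes "k \<le> M" "k + r \<le> M"
  shows "\<exists>c<Suc M. pos M k c = k + r \<and> eu M c \<in> rch (Suc M) M (tri (Suc M) (pos M k) 0) r"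
  using assms(2)
proof (induction r)
  case 0
  show ?case by (intro exI[of _ M]) (simp add: rch_simps pos_last)
next
  case (Suc r)
  then obtain c where c: "c < Suc M" "pos M k c = k + r" "eu M c \<in> rch (Suc M) M (tri (Suc M) (pos M k) 0) r"
    by auto
  obtain c' where c': "c' < Suc M" "pos M k c' = k + Suc r" using pos_surj[OF assms(1), of "k + Suc r"] Suc.prems by auto
  have "eu c c' \<in> brs (Suc M) (tri (Suc M) (pos M k) 0)" using eu_step c c' by simp
  moreover have "eu M c' = mmul (Suc M) (eu M c) (eu c c')" using c(1) by (simp add: eu_mmul_eu)
  ultimately have "eu M c' \<in> rch (Suc M) M (tri (Suc M) (pos M k) 0) (Suc r)"
    unfolding rch_simps prods_def using c(3) by blast
  then show ?case using c' by blast
qed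

lemma lch_tri_mem:
  assumes "k \<le> M" "r \<le> k"
  shows "\<exists>c<Suc M. pos M k c = k - r \<and> eu c M \<in> lch (Suc M) M (tri (Suc M) (pos M k) 0) r"
  using assms(2)
proof (induction r)
  case 0
  show ?case by (intro exI[of _ M]) (simp add: lch_simps pos_last)
next
  case (Suc r)
  then obtain c where c: "c < Suc M" "pos M k c = k - r" "eu c M \<in> lch (Suc M) M (tri (Suc M) (pos M k) 0) r"
    by auto
  obtain c' where c': "c' < Suc M" "pos M k c' = k - Suc r"
    using pos_surj[OF assms(1), of "k - Suc r"] assms(1) by (metis diff_le_self le_imp_less_Suc le_trans)
  have "eu c' c \<in> brs (Suc M) (tri (Suc M) (pos M k) 0)" using eu_step c c' Suc.prems by simp
  moreover have "eu c' M = mmul (Suc M) (eu c' c) (eu c M)" using c(1) by (simp add: eu_mmul_eu)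
  ultimately have "eu c' M \<in> lch (Suc M) M (tri (Suc M) (pos M k) 0) (Suc r)"
    unfolding lch_simps prods_def using c(3) by blast
  then show ?case using c' by blast
qed

text \<open>The two vanishing conditions bound the position of the line spanned by the last basis vector
  in the flag of \<open>L\<close> from below and from above.\<close>

lemma orbit_member_iff:
  assumes k: "k \<le> M" and L: "cm.subspace L" "L \<subseteq> gl (Suc M)" "cm.dim L = cm.dim (tri (Suc M) (pos M k) 0)"
    and N: "(derived (Suc M) ^^ N) (tri (Suc M) (pos M k) 0) = {0}"
  shows "(\<exists>g h. kpair M g h \<and> L = cj (Suc M) g h ` tri (Suc M) (pos M k) 0) \<longleftrightarrow>
    (\<forall>x\<in>L. \<forall>y\<in>L. lie_br (Suc M) x y \<in> L) \<and> eu M M \<in> L \<and> (derived (Suc M) ^^ N) L \<subseteq> {0} \<and>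
    rch (Suc M) M L (Suc M - k) \<subseteq> {0} \<and> lch (Suc M) M L (Suc k) \<subseteq> {0}"
    (is "?O \<longleftrightarrow> ?C")
proof
  let ?T = "tri (Suc M) (pos M k) 0"
  assume ?O
  then obtain g h where g: "kpair M g h" and L': "L = cj (Suc M) g h ` ?T" by blast
  have la: "lie_subalg (Suc M) L" unfolding L' by (rule lie_subalg_cj[OF kpairD[OF g] lie_subalg_tri])
  have "(derived (Suc M) ^^ N) L \<subseteq> {0}"
    unfolding L' derived_pow_cj[OF kpairD[OF g] tri_gl] N by (simp add: cj_zero)
  moreover have "rch (Suc M) M L (Suc M - k) \<subseteq> {0}"
    unfolding L' rch_cj[OF g tri_gl] using rch_tri_zero[OF k] cj_zero by blast
  moreover have "lch (Suc M) M L (Suc k) \<subseteq> {0}"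
    unfolding L' lch_cj[OF g tri_gl] using lch_tri_zero[OF k] cj_zero by blast
  moreover have "eu M M \<in> L" unfolding L' by (rule eu_mem_cj_tri[OF g])
  ultimately show ?C using la by (simp add: lie_subalg_iff)
next
  let ?T = "tri (Suc M) (pos M k) 0"
  assume C: ?C
  then have la: "lie_subalg (Suc M) L" using L by (simp add: lie_subalg_iff)
  have "solvable (Suc M) L" using C solvableI[OF L(1)] by blast
  then obtain j g h where j: "j \<le> M" "kpair M g h" and sub: "L \<subseteq> cj (Suc M) g h ` tri (Suc M) (pos M j) 0"
    using solvable_subset_K_conjugate[OF la] C by blast
  let ?Tj = "tri (Suc M) (pos M j) 0"
  note ip = kpairD[OF j(2)]
  \<comment> \<open>Only an inclusion in a Borel subalgebra is known so far; the prescribed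
    dimension turns it into equality.\<close>
  have "cm.dim (cj (Suc M) g h ` ?Tj) = cm.dim ?Tj" by (rule dim_cj[OF ip tri_gl subspace_tri])
  also have "\<dots> = cm.dim ?T" by (rule dim_borel[OF borel_tri[OF inj_pos[OF j(1)]] borel_tri[OF inj_pos[OF k]]])
  finally have L': "L = cj (Suc M) g h ` ?Tj"
    using L by (intro subspace_eq_of_dim[OF L(1) subspace_cj[OF subspace_tri] sub cj_image_gl[OF ip tri_gl]]) simp
  have inj0: "x = 0" if "x \<in> gl (Suc M)" "cj (Suc M) g h x = 0" for x
    using cj_inverse[OF ip that(1)] that(2) by (simp add: cj_zero)
  have R: "rch (Suc M) M ?Tj (Suc M - k) \<subseteq> {0}"
  proof
    fix x assume x: "x \<in> rch (Suc M) M ?Tj (Suc M - k)"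
    have "rch (Suc M) M L (Suc M - k) \<subseteq> {0}" using C by blast
    then have "cj (Suc M) g h ` rch (Suc M) M ?Tj (Suc M - k) \<subseteq> {0}" unfolding L' rch_cj[OF j(2) tri_gl] .
    then have "cj (Suc M) g h x = 0" using x by blast
    then show "x \<in> {0}" using inj0 rch_gl[OF tri_gl] x by blast
  qed
  have Lc: "lch (Suc M) M ?Tj (Suc k) \<subseteq> {0}"
  proof
    fix x assume x: "x \<in> lch (Suc M) M ?Tj (Suc k)"
    have "lch (Suc M) M L (Suc k) \<subseteq> {0}" using C by blast
    then have "cj (Suc M) g h ` lch (Suc M) M ?Tj (Suc k) \<subseteq> {0}" unfolding L' lch_cj[OF j(2) tri_gl] .
    then have "cj (Suc M) g h x = 0" using x by blast
    then show "x \<in> {0}" using inj0 lch_gl[OF tri_gl] x by blast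
  qed
  \<comment> \<open>The first exclusion rules out \<open>j < k\<close>, the second
    \<open>k < j\<close>.\<close>
  have "\<not> j + (Suc M - k) \<le> M" using rch_tri_mem[OF j(1)] R eu_nonzero by blast
  moreover have "\<not> Suc k \<le> j" using lch_tri_mem[OF j(1)] Lc eu_nonzero by blast
  ultimately have "j = k" using k by simp
  then show ?O using j(2) L' by blast
qed

text \<open>Only tuples whose length is the common dimension of Borel subalgebras can be independent
  and span a member. For them the conditions of \<open>orbit_member_iff\<close> are rewritten on
  generators.\<close>

lemma orbit_closed:
  assumes b: "borel (Suc M) b" "eu M M \<in> b"
  shows "zariski_closed_flag (Suc M) (K_orbit (Suc M) b)"
  unfolding zariski_closed_flag_def
proof (intro conjI allI)
  let ?m = "Suc M"
  let ?S = "K_orbit ?m b"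
  show "?S \<subseteq> flag ?m" using proj_orbit(1)[OF b] by (auto simp: flag_def)
  fix d
  let ?I = "tup_coords d ?m"
  obtain k where k: "k \<le> M" and orb: "?S = {cj ?m g h ` tri ?m (pos M k) 0 | g h. kpair M g h}"
    using K_orbit_elem[OF b] .
  let ?T = "tri ?m (pos M k) 0"
  \<comment> \<open>One derived length serves the whole orbit, because conjugation preserves it;
    this makes solvability a polynomial condition.\<close>
  obtain N where N: "(derived ?m ^^ N) ?T = {0}"
    using solvable_tri[OF inj_pos[OF k]] unfolding solvable_iff by blast
  have tgl: "tup X i \<in> gl ?m" if "X \<in> aff ?I" for X i
  proof -
    have "X (i, a, c) = 0" if "?m \<le> a \<or> ?m \<le> c" for a c
      using \<open>X \<in> aff ?I\<close> that by (auto simp: aff_def tup_coords_def)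
    then show ?thesis by (simp add: gl_def tup_def)
  qed
  have dimS: "cm.dim L = cm.dim ?T" if "L \<in> ?S" for L
    using that orb dim_cj[OF kpairD tri_gl subspace_tri] by auto
  have dimX: "cm.dim (cm.span (tup X ` {..<d})) = d" if "lin_indep_tup d (tup X)" for X
    using that unfolding lin_indep_tup_iff by (metis card_image card_lessThan cm.dim_span_eq_card_independent)
  have dep: "zcl ?I (\<lambda>X. \<not> lin_indep_tup d (tup X))"
    using zcl_dependent[of d "\<lambda>k X. tup X k" ?I ?m] polym_tup tgl by simp
  have "zcl ?I (\<lambda>X. \<not> lin_indep_tup d (tup X) \<or> lin_span (tup X ` {..<d}) \<in> ?S)"
  proof (cases "d = cm.dim ?T")
    case False
    have "(\<not> lin_indep_tup d (tup X)) \<longleftrightarrow> (\<not> lin_indep_tup d (tup X) \<or> lin_span (tup X ` {..<d}) \<in> ?S)" for X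
      using dimS dimX False unfolding lin_span_eq by metis
    then show ?thesis using dep by simp
  next
    case True
    have zs: "zcl ?I (\<lambda>X. \<not> lin_indep_tup (Suc d) (\<lambda>k. if k < d then tup X k else f X))"
      if "polym f" "\<And>X. X \<in> aff ?I \<Longrightarrow> f X \<in> gl ?m" for f
    proof (rule zcl_dependent[of "Suc d" "\<lambda>k X. if k < d then tup X k else f X" ?I ?m])
      show "polym (\<lambda>X. if i < d then tup X i else f X)" for i
        using polym_tup that(1) by (cases "i < d") auto
      show "(if i < d then tup X i else f X) \<in> gl ?m" if "X \<in> aff ?I" for i X
        using tgl \<open>\<And>X. X \<in> aff ?I \<Longrightarrow> f X \<in> gl ?m\<close> that by auto
    qed
    let ?C = "\<lambda>X. (\<forall>i\<in>{..<d}. \<forall>j\<in>{..<d}. \<not> lin_indep_tup (Suc d) (\<lambda>k. if k < d then tup X k else lie_br ?m (tup X i) (tup X j)))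
      \<and> \<not> lin_indep_tup (Suc d) (\<lambda>k. if k < d then tup X k else eu M M)
      \<and> (brs ?m ^^ N) (tup X ` {..<d}) \<subseteq> {0}
      \<and> rch ?m M (tup X ` {..<d}) (Suc M - k) \<subseteq> {0} \<and> lch ?m M (tup X ` {..<d}) (Suc k) \<subseteq> {0}"
    have ps: "polyset (\<lambda>X. tup X ` {..<d})"
      using polyset_image[of "{..<d}" "\<lambda>k X. tup X k"] polym_tup by simp
    have C: "zcl ?I ?C"
      by (intro zcl_conj zcl_ball zs zcl_polyset polyset_brs_pow polyset_rch polyset_lch ps
          polym_lie_br polym_tup polym_const lie_br_gl tgl) (auto simp: eu_gl)
    have "\<not> lin_indep_tup d (tup X) \<or> ?C X \<longleftrightarrow>
        \<not> lin_indep_tup d (tup X) \<or> lin_span (tup X ` {..<d}) \<in> ?S" if X: "X \<in> aff ?I" for X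
    proof (cases "lin_indep_tup d (tup X)")
      case ind: True
      let ?A = "tup X ` {..<d}"
      let ?L = "cm.span ?A"
      have Lgl: "?L \<subseteq> gl ?m" using tgl[OF X] by (intro span_gl) auto
      have "lin_span ?A \<in> ?S \<longleftrightarrow> (\<exists>g h. kpair M g h \<and> ?L = cj ?m g h ` ?T)"
        unfolding orb lin_span_eq by blast
      also have "\<dots> \<longleftrightarrow> (\<forall>x\<in>?L. \<forall>y\<in>?L. lie_br ?m x y \<in> ?L) \<and> eu M M \<in> ?L \<and> (derived ?m ^^ N) ?L \<subseteq> {0} \<and>
          rch ?m M ?L (Suc M - k) \<subseteq> {0} \<and> lch ?m M ?L (Suc k) \<subseteq> {0}"
        using dimX[OF ind] True by (intro orbit_member_iff[OF k _ Lgl _ N]) auto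
      also have "(\<forall>x\<in>?L. \<forall>y\<in>?L. lie_br ?m x y \<in> ?L) \<longleftrightarrow> (\<forall>i\<in>{..<d}. \<forall>j\<in>{..<d}. lie_br ?m (tup X i) (tup X j) \<in> ?L)"
      proof
        assume "\<forall>x\<in>?L. \<forall>y\<in>?L. lie_br ?m x y \<in> ?L"
        then show "\<forall>i\<in>{..<d}. \<forall>j\<in>{..<d}. lie_br ?m (tup X i) (tup X j) \<in> ?L"
          using cm.span_superset[of ?A] by blast
      next
        assume *: "\<forall>i\<in>{..<d}. \<forall>j\<in>{..<d}. lie_br ?m (tup X i) (tup X j) \<in> ?L"
        then have "brs ?m ?A \<subseteq> ?L" unfolding brs_def by blast
        then have "cm.span (brs ?m ?A) \<subseteq> ?L" by (intro cm.span_minimal) auto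
        then have "brs ?m ?L \<subseteq> ?L" using brs_span[of ?m ?A] by blast
        then show "\<forall>x\<in>?L. \<forall>y\<in>?L. lie_br ?m x y \<in> ?L" unfolding brs_def by blast
      qed
      also have "(derived ?m ^^ N) ?L \<subseteq> {0} \<longleftrightarrow> (brs ?m ^^ N) ?A \<subseteq> {0}"
        unfolding derived_pow_span
        using cm.span_superset[of "(brs ?m ^^ N) ?A"] cm.span_minimal[of "(brs ?m ^^ N) ?A" "{0}"] cm.subspace_single_0
        by blast
      also have "rch ?m M ?L (Suc M - k) \<subseteq> {0} \<longleftrightarrow> rch ?m M ?A (Suc M - k) \<subseteq> {0}"
        using rch_mono[OF cm.span_superset[of ?A], of ?m M "Suc M - k"] rch_span[of ?m M ?A "Suc M - k"]
          cm.span_minimal[of "rch ?m M ?A (Suc M - k)" "{0}"] cm.subspace_single_0 by blast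
      also have "lch ?m M ?L (Suc k) \<subseteq> {0} \<longleftrightarrow> lch ?m M ?A (Suc k) \<subseteq> {0}"
        using lch_mono[OF cm.span_superset[of ?A], of ?m M "Suc k"] lch_span[of ?m M ?A "Suc k"]
          cm.span_minimal[of "lch ?m M ?A (Suc k)" "{0}"] cm.subspace_single_0 by blast
      finally show ?thesis using ind unfolding in_span_iff_dependent[OF ind] by simp
    qed simp
    then show ?thesis by (rule zcl_cong) (assumption, rule zcl_disj[OF dep C])
  qed
  then show "zariski_closed_aff ?I {X \<in> aff ?I. \<not> lin_indep_tup d (tup X) \<or> lin_span (tup X ` {..<d}) \<in> ?S}"
    unfolding zcl_def .
qed

subsection \<open>Chains of closed orbits\<close>

lemma closed_orbit_base:
  assumes "is_K_orbit (Suc M) Q" "zariski_closed_flag (Suc M) Q"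
  obtains b where "borel (Suc M) b" "eu M M \<in> b" "Q = K_orbit (Suc M) b"
  using assms closed_orbit_contains_eu unfolding is_K_orbit_def flag_def by blast

lemma proj_proj: "i \<le> j \<Longrightarrow> proj i ` proj j ` b = proj i ` b"
proof -
  assume "i \<le> j"
  then have "proj i (proj j x) = proj i x" for x by (auto simp: proj_def fun_eq_iff)
  then show ?thesis by (simp add: image_image)
qed

lemma proj_id_image: "b \<subseteq> gl m \<Longrightarrow> proj m ` b = b"
  using proj_id by (force simp: image_iff)

lemma gl_0: "gl 0 = {0}"
  by (auto simp: gl_def fun_eq_iff fun_apply)

text \<open>Anchors the induction at size \<open>0\<close>, where the flag variety is a point and no
  orbit is prescribed.\<close>

lemma borel_0: "borel 0 b \<longleftrightarrow> b = {0}"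
proof
  assume b: "borel 0 b"
  then show "b = {0}" using borelD(3)[OF b] cm.subspace_0[OF borelD(4)[OF b]] gl_0 by blast
next
  have "tri 0 (\<lambda>a. a) 0 = {0}" using tri_gl[of 0 "\<lambda>a. a" 0] cm.subspace_0[OF subspace_tri] gl_0 by blast
  then show "borel 0 b" if "b = {0}" using borel_tri[of "\<lambda>a. a" 0] that by simp
qed

text \<open>A diagonal matrix is its corner plus a multiple of the last idempotent, and both
  summands lie in \<open>b\<close>.\<close>

lemma diag_cartan_Suc:
  assumes "cm.subspace b" "proj M ` b \<subseteq> b" "eu M M \<in> b" "diag_cartan M \<subseteq> proj M ` b"
  shows "diag_cartan (Suc M) \<subseteq> b"
proof
  fix A assume A: "A \<in> diag_cartan (Suc M)"
  have "proj M A \<in> diag_cartan M" using A proj_gl by (auto simp: diag_cartan_def proj_def)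
  then have "proj M A \<in> b" using assms by blast
  then have "proj M A + msmult (A M M) (eu M M) \<in> b"
    using assms cm.subspace_add cm.subspace_scale by blast
  moreover have "A = proj M A + msmult (A M M) (eu M M)"
  proof (intro ext)
    fix a b
    show "A a b = (proj M A + msmult (A M M) (eu M M)) a b"
    proof (cases "A a b = 0")
      case True
      then show ?thesis by (auto simp: proj_def msmult_def eu_def fun_apply)
    next
      case False
      then have "a = b" "a < Suc M" using A gl_nonzeroD by (auto simp: diag_cartan_def)
      then show ?thesis by (auto simp: proj_def msmult_def eu_def fun_apply less_Suc_eq)
    qed
  qed
  ultimately show "A \<in> b" by simp
qed

lemma closed_orbit_chain:
  assumes "\<forall>i\<in>{1..N}. is_K_orbit i (Q i) \<and> zariski_closed_flag i (Q i)"
  shows "\<exists>b. {b \<in> flag N. \<forall>i\<in>{1..N}. proj i ` b \<in> Q i} = {b} \<and> diag_cartan N \<subseteq> b"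
  using assms
proof (induction N)
  case 0
  have "diag_cartan 0 \<subseteq> {0}" using gl_0 by (auto simp: diag_cartan_def)
  then show ?case by (auto simp: flag_def borel_0)
next
  case (Suc M)
  then obtain c where c: "{b \<in> flag M. \<forall>i\<in>{1..M}. proj i ` b \<in> Q i} = {c}" "diag_cartan M \<subseteq> c" by auto
  have "is_K_orbit (Suc M) (Q (Suc M))" "zariski_closed_flag (Suc M) (Q (Suc M))" using Suc.prems by auto
  then obtain b0 where b0: "borel (Suc M) b0" "eu M M \<in> b0" "Q (Suc M) = K_orbit (Suc M) b0"
    by (rule closed_orbit_base)
  note po = proj_orbit[OF b0(1,2), folded b0(3)]
  have "borel M c" using c by (auto simp: flag_def)
  then obtain b where b: "b \<in> Q (Suc M)" "proj M ` b = c" using po(3) by blast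
  \<comment> \<open>The conditions of index at most \<open>M\<close> see \<open>b'\<close> only
    through its corner, so they reduce to the smaller problem.\<close>
  have split: "(\<forall>i\<in>{1..Suc M}. proj i ` b' \<in> Q i) \<longleftrightarrow> b' \<in> Q (Suc M) \<and> (\<forall>i\<in>{1..M}. proj i ` proj M ` b' \<in> Q i)"
    if "b' \<subseteq> gl (Suc M)" for b'
  proof -
    have "{1..Suc M} = insert (Suc M) {1..M}" by auto
    moreover have "\<forall>i\<in>{1..M}. proj i ` proj M ` b' = proj i ` b'" using proj_proj by auto
    ultimately show ?thesis using proj_id_image[OF that] by auto
  qed
  have uniq: "b' \<in> flag (Suc M) \<and> (\<forall>i\<in>{1..Suc M}. proj i ` b' \<in> Q i) \<longleftrightarrow> b' = b" for b'
  proof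
    assume l: "b' \<in> flag (Suc M) \<and> (\<forall>i\<in>{1..Suc M}. proj i ` b' \<in> Q i)"
    then have gl: "b' \<subseteq> gl (Suc M)" using borelD(3) by (auto simp: flag_def)
    then have b': "b' \<in> Q (Suc M)" "\<forall>i\<in>{1..M}. proj i ` proj M ` b' \<in> Q i" using l split by auto
    then have "proj M ` b' \<in> {c}" using po(1) unfolding c(1)[symmetric] by (auto simp: flag_def)
    then show "b' = b" using po(2) b b'(1) by (auto dest: inj_onD)
  next
    assume "b' = b"
    moreover have "borel (Suc M) b" using po(1) b(1) by blast
    moreover have "\<forall>i\<in>{1..M}. proj i ` c \<in> Q i" using c(1) by auto
    ultimately show "b' \<in> flag (Suc M) \<and> (\<forall>i\<in>{1..Suc M}. proj i ` b' \<in> Q i)"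
      using split[of b] borelD(3) b by (auto simp: flag_def)
  qed
  have "diag_cartan (Suc M) \<subseteq> b"
    using diag_cartan_Suc[of b M] po(1)[OF b(1)] borelD(4) b(2) c(2) by blast
  then show ?case using uniq by (intro exI[of _ b]) auto
qed

section \<open>Borel subalgebras containing the diagonal matrices\<close>

lemma eu_diag_cartan: "a < m \<Longrightarrow> eu a a \<in> diag_cartan m"
  using eu_gl by (auto simp: diag_cartan_def eu_def)

text \<open>Descending induction: a Borel subalgebra containing the diagonal matrices contains the
  last idempotent, so \<open>proj_orbit\<close> applied to its own orbit shows that the next corner
  is again Borel.\<close>

lemma borel_proj_descend:
  assumes "borel N b" "diag_cartan N \<subseteq> b" "i \<le> N"
  shows "borel i (proj i ` b) \<and> diag_cartan i \<subseteq> proj i ` b"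
  using assms(3)
proof (induction rule: inc_induct)
  case base
  then show ?case using assms proj_id_image borelD(3) by metis
next
  case (step i)
  let ?c = "proj (Suc i) ` b"
  have c: "borel (Suc i) ?c" "diag_cartan (Suc i) \<subseteq> ?c" using step.IH by auto
  have e: "eu i i \<in> ?c" using c eu_diag_cartan[of i "Suc i"] by auto
  have p: "proj i ` ?c = proj i ` b" using proj_proj[of i "Suc i" b] by simp
  have "borel i (proj i ` ?c)" using proj_orbit(1)[OF c(1) e K_orbit_self[OF borelD(3)[OF c(1)]]] by blast
  moreover have "diag_cartan i \<subseteq> proj i ` ?c"
  proof
    fix A assume A: "A \<in> diag_cartan i"
    then have "A \<in> diag_cartan (Suc i)" using gl_Suc by (auto simp: diag_cartan_def)
    moreover have "proj i A = A" using A proj_id by (auto simp: diag_cartan_def)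
    ultimately show "A \<in> proj i ` ?c" using c(2) by force
  qed
  ultimately show ?case by (simp add: p)
qed

theorem theorem4p2:
  fixes n :: nat
  assumes "n \<ge> 1"
  shows "(\<forall>Q. (\<forall>i\<in>{1..n+1}. is_K_orbit i (Q i) \<and> zariski_closed_flag i (Q i)) \<longrightarrow>
            (\<exists>b. XQ n Q = {b} \<and> diag_cartan (n + 1) \<subseteq> b))
       \<and> (\<forall>b. borel (n + 1) b \<and> diag_cartan (n + 1) \<subseteq> b \<longrightarrow>
            (\<exists>Q. (\<forall>i\<in>{1..n+1}. is_K_orbit i (Q i) \<and> zariski_closed_flag i (Q i))
                 \<and> XQ n Q = {b}))"
proof (intro conjI allI impI)
  fix Q assume "\<forall>i\<in>{1..n+1}. is_K_orbit i (Q i) \<and> zariski_closed_flag i (Q i)"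
  then show "\<exists>b. XQ n Q = {b} \<and> diag_cartan (n + 1) \<subseteq> b"
    unfolding XQ_def by (rule closed_orbit_chain)
next
  fix b assume b: "borel (n + 1) b \<and> diag_cartan (n + 1) \<subseteq> b"
  \<comment> \<open>If \<open>b\<close> is to lie in the set, each \<open>Q i\<close> must be the
    orbit of its projection; closedness holds because that projection contains the last idempotent
    of its size.\<close>
  define Q where "Q i = K_orbit i (proj i ` b)" for i
  have Q: "is_K_orbit i (Q i) \<and> zariski_closed_flag i (Q i) \<and> proj i ` b \<in> Q i" if i: "i \<in> {1..n+1}" for i
  proof -
    obtain M where M: "i = Suc M" using i by (cases i) auto
    have p: "borel i (proj i ` b)" "diag_cartan i \<subseteq> proj i ` b"
      using borel_proj_descend[of "n + 1" b i] b i by auto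
    have "eu M M \<in> proj i ` b" using p(2) eu_diag_cartan[of M i] M by auto
    then have "zariski_closed_flag i (Q i)" using orbit_closed p(1) unfolding Q_def M by blast
    moreover have "is_K_orbit i (Q i)" unfolding is_K_orbit_def Q_def flag_def using p(1) by blast
    moreover have "proj i ` b \<in> Q i" using K_orbit_self borelD(3)[OF p(1)] unfolding Q_def M by blast
    ultimately show ?thesis by blast
  qed
  \<comment> \<open>For this sequence \<open>closed_orbit_chain\<close> gives a single element,
    which must be \<open>b\<close>.\<close>
  then obtain b' where "XQ n Q = {b'}"
    using closed_orbit_chain[of "n + 1" Q] unfolding XQ_def by blast
  moreover have "b \<in> XQ n Q" using Q b by (simp add: XQ_def flag_def)
  ultimately have "XQ n Q = {b}" by blast
  then show "\<exists>Q. (\<forall>i\<in>{1..n+1}. is_K_orbit i (Q i) \<and> zariski_closed_flag i (Q i)) \<and> XQ n Q = {b}"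
    using Q by blast
qed

end
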